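(* Let $S=\langle n_1,n_2,n_3,n_4\rangle$ be a $4$-generated pseudo-symmetric numerical semigroup whose tangent cone ring $gr_{\mathfrak m}(R_S)\cong A/I_S^*$ is Cohen-Macaulay. Then $S$ is of homogeneous type if and only if $S$ is homogeneous.
   Context: A numerical semigroup is $S=\langle n_1,\dots,n_k\rangle=\{u_1n_1+\cdots+u_kn_k : u_i\in\mathbb N\}$ with $n_i$ positive integers and $\gcd(n_1,\dots,n_k)=1$; it is $k$-generated if $n_1,\dots,n_k$ is its minimal generating set. Pseudo-symmetric $4$-generated semigroups (Komeda's parametrization, fixing the order of the generators): $S=\langle n_1,n_2,n_3,n_4\rangle$ (with $\gcd(n_1,n_2,n_3,n_4)=1$ and the $n_i$ minimal generators) such that there are integers $\alpha_i>1$ for $1\le i\le 4$ and $\alpha_{21}$ with $0<\alpha_{21}<\alpha_1-1$ satisfying $$n_1=\alpha_2\alpha_3(\alpha_4-1)+1,$$ $$n_2=\alpha_{21}\alpha_3\alpha_4+(\alpha_1-\alpha_{21}-1)(\alpha_3-1)+\alpha_3,$$ $$n_3=\alpha_1\alpha_4+(\alpha_1-\alpha_{21}-1)(\alpha_2-1)(\alpha_4-1)-\alpha_4+1,$$ $$n_4=\alpha_1\alpha_2(\alpha_3-1)+\alpha_{21}(\alpha_2-1)+\alpha_2.$$ Let $K$ be a field, $A=K[X_1,X_2,X_3,X_4]$, and let $I_S$ be the kernel of the $K$-algebra map $A\to K[t]$, $X_i\mapsto t^{n_i}$, so $K[S]:=K[t^{n_1},\dots,t^{n_4}]\cong A/I_S$.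 Then $I_S=\langle f_1,\dots,f_5\rangle$ with $f_1=X_1^{\alpha_1}-X_3X_4^{\alpha_4-1}$, $f_2=X_2^{\alpha_2}-X_1^{\alpha_{21}}X_4$, $f_3=X_3^{\alpha_3}-X_1^{\alpha_1-\alpha_{21}-1}X_2$, $f_4=X_4^{\alpha_4}-X_1X_2^{\alpha_2-1}X_3^{\alpha_3-1}$, $f_5=X_1^{\alpha_{21}+1}X_3^{\alpha_3-1}-X_2X_4^{\alpha_4-1}$. Let $R_S=K[[t^{n_1},\dots,t^{n_4}]]$ with maximal ideal $\mathfrak m=\langle t^{n_1},\dots,t^{n_4}\rangle$. Then $gr_{\mathfrak m}(R_S)=\bigoplus_{i\ge 0}\mathfrak m^i/\mathfrak m^{i+1}\cong A/I_S^*$, where $I_S^*=\langle f^* : f\in I_S\rangle$ and $f^*$ is the nonzero homogeneous summand of $f$ of least (standard) degree. The Betti sequence $\beta(M)=(\beta_0,\beta_1,\beta_2,\beta_3)$ of an $A$-module $M$ is the sequence of ranks of the free modules in a minimal graded free resolution of $M$ over $A$ (for $K[S]$ the grading is $\deg X_i=n_i$; for $A/I_S^*$ it is the standard grading). $S$ is of homogeneous type if $\beta(A/I_S^* )=\beta(K[S])$. It is known that $\beta(K[S])=(1,5,6,2)$ for every $4$-generated pseudo-symmetric $S$. For $s\in S$, the Apéry set is $AP(S,s)=\{x\in S : x-s\notin S\}$, and the set of lengths of $s$ is $L(s)=\{\sum_i u_i : s=\sum_i u_in_i,\ u_i\ge 0\}$. A subset $T\subset S$ is homogeneous if it is empty or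 $L(s)$ is a singleton for every $0\ne s\in T$. With $n_i$ the smallest of the generators (the multiplicity), $S$ is homogeneous if $AP(S,n_i)$ is homogeneous. *)

theory Defs
  imports
    "HOL-Library.Poly_Mapping"
    "HOL-Library.Extended_Nat"
    "HOL-Library.Numeral_Type"
    "HOL-Computational_Algebra.Polynomial"
    "HOL-Algebra.QuotRing"
    "HOL-Algebra.Ring_Divisibility"
    "HOL-Algebra.Algebraic_Closure_Type"
begin

section \<open>Numerical semigroups\<close>

definition semigroup_on :: "'v::finite set \<Rightarrow> ('v \<Rightarrow> nat) \<Rightarrow> nat set" where
  "semigroup_on J n = {s. \<exists>u :: 'v \<Rightarrow> nat. s = (\<Sum>i\<in>J. u i * n i)}"

abbreviation semigroup_of :: "('v::finite \<Rightarrow> nat) \<Rightarrow> nat set" where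
  "semigroup_of n \<equiv> semigroup_on UNIV n"

text \<open>Minimality is stated for the indexed family, so it also forces the generators to be distinct.\<close>

definition minimally_generated :: "('v::finite \<Rightarrow> nat) \<Rightarrow> bool" where
  "minimally_generated n \<longleftrightarrow>
     (\<forall>i. n i > 0) \<and> Gcd (range n) = 1 \<and>
     (\<forall>J. J \<subset> UNIV \<longrightarrow> semigroup_on J n \<noteq> semigroup_of n)"

text \<open>
  Komeda's parametrization. The index type \<open>4\<close> has the four elements \<open>1\<close>, \<open>2\<close>, \<open>3\<close>, \<open>4\<close>
  (with \<open>4 = 0\<close>); the parameters are integers, so that no subtraction is truncated.
\<close>

definition pseudo_symmetric_4_generated :: "(4 \<Rightarrow> nat) \<Rightarrow> bool" where
  "pseudo_symmetric_4_generated n \<longleftrightarrow>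
     minimally_generated n \<and>
     (\<exists>(\<alpha> :: 4 \<Rightarrow> int) (\<alpha>21 :: int).
        (\<forall>i. \<alpha> i > 1) \<and> 0 < \<alpha>21 \<and> \<alpha>21 < \<alpha> 1 - 1 \<and>
        int (n 1) = \<alpha> 2 * \<alpha> 3 * (\<alpha> 4 - 1) + 1 \<and>
        int (n 2) = \<alpha>21 * \<alpha> 3 * \<alpha> 4 + (\<alpha> 1 - \<alpha>21 - 1) * (\<alpha> 3 - 1) + \<alpha> 3 \<and>
        int (n 3) = \<alpha> 1 * \<alpha> 4 + (\<alpha> 1 - \<alpha>21 - 1) * (\<alpha> 2 - 1) * (\<alpha> 4 - 1) - \<alpha> 4 + 1 \<and>
        int (n 4) = \<alpha> 1 * \<alpha> 2 * (\<alpha> 3 - 1) + \<alpha>21 * (\<alpha> 2 - 1) + \<alpha> 2)"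

definition apery_set :: "nat set \<Rightarrow> nat \<Rightarrow> nat set" where
  "apery_set S s = {x \<in> S. int x - int s \<notin> int ` S}"

definition lengths :: "('v::finite \<Rightarrow> nat) \<Rightarrow> nat \<Rightarrow> nat set" where
  "lengths n s = {l. \<exists>u :: 'v \<Rightarrow> nat. s = (\<Sum>i\<in>UNIV. u i * n i) \<and> l = (\<Sum>i\<in>UNIV. u i)}"

definition homogeneous_subset :: "('v::finite \<Rightarrow> nat) \<Rightarrow> nat set \<Rightarrow> bool" where
  "homogeneous_subset n T \<longleftrightarrow> T = {} \<or> (\<forall>s\<in>T. s \<noteq> 0 \<longrightarrow> is_singleton (lengths n s))"

definition homogeneous_semigroup :: "('v::finite \<Rightarrow> nat) \<Rightarrow> bool" where
  "homogeneous_semigroup n \<longleftrightarrow>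
     homogeneous_subset n (apery_set (semigroup_of n) (Min (range n)))"

section \<open>Polynomials, the ideal of the semigroup ring and of the tangent cone\<close>

type_synonym ('v, 'k) mpoly = "('v \<Rightarrow>\<^sub>0 nat) \<Rightarrow>\<^sub>0 'k"

abbreviation mpoly_ring :: "('v, 'k::comm_ring_1) mpoly ring" where
  "mpoly_ring \<equiv> ring_of_type_algebra"

definition var :: "'v \<Rightarrow> ('v, 'k::comm_ring_1) mpoly" where
  "var i = Poly_Mapping.single (Poly_Mapping.single i 1) 1"

definition wdegree :: "('v::finite \<Rightarrow> nat) \<Rightarrow> ('v \<Rightarrow>\<^sub>0 nat) \<Rightarrow> nat" where
  "wdegree w m = (\<Sum>i\<in>UNIV. Poly_Mapping.lookup m i * w i)"

abbreviation standard_weight :: "'v \<Rightarrow> nat" where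
  "standard_weight \<equiv> (\<lambda>_. 1)"

text \<open>Degrees are integers since the entries of the matrices below have differences of shifts as
  degrees; the zero polynomial is homogeneous of every degree.\<close>

definition homogeneous_poly ::
  "('v::finite \<Rightarrow> nat) \<Rightarrow> int \<Rightarrow> ('v, 'k::comm_ring_1) mpoly \<Rightarrow> bool" where
  "homogeneous_poly w d p \<longleftrightarrow> (\<forall>m \<in> Poly_Mapping.keys p. int (wdegree w m) = d)"

definition monomial_curve_map ::
  "('v::finite \<Rightarrow> nat) \<Rightarrow> ('v, 'k::field) mpoly \<Rightarrow> 'k poly" where
  "monomial_curve_map n p =
     (\<Sum>m\<in>Poly_Mapping.keys p. Polynomial.smult (Poly_Mapping.lookup p m)
        (\<Prod>i\<in>UNIV. Polynomial.monom 1 (n i) ^ Poly_Mapping.lookup m i))"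

definition semigroup_ideal :: "('v::finite \<Rightarrow> nat) \<Rightarrow> ('v, 'k::field) mpoly set" where
  "semigroup_ideal n = {p. monomial_curve_map n p = 0}"

definition initial_form :: "('v::finite, 'k::field) mpoly \<Rightarrow> ('v, 'k) mpoly" where
  "initial_form f =
     (let d = Min (wdegree standard_weight ` Poly_Mapping.keys f)
      in \<Sum>m \<in> {m \<in> Poly_Mapping.keys f. wdegree standard_weight m = d}.
           Poly_Mapping.single m (Poly_Mapping.lookup f m))"

definition tangent_cone_ideal :: "('v::finite \<Rightarrow> nat) \<Rightarrow> ('v, 'k::field) mpoly set" where
  "tangent_cone_ideal n =
     Idl\<^bsub>mpoly_ring\<^esub> (initial_form ` (semigroup_ideal n - {0}))"

section \<open>Cohen-Macaulay rings\<close>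

definition regular_sequence :: "('a, 'b) ring_scheme \<Rightarrow> 'a list \<Rightarrow> bool" where
  "regular_sequence R xs \<longleftrightarrow>
     set xs \<subseteq> carrier R \<and>
     (\<forall>i<length xs. \<forall>r\<in>carrier R.
        r \<otimes>\<^bsub>R\<^esub> (xs ! i) \<in> Idl\<^bsub>R\<^esub> (set (take i xs)) \<longrightarrow> r \<in> Idl\<^bsub>R\<^esub> (set (take i xs))) \<and>
     Idl\<^bsub>R\<^esub> (set xs) \<noteq> carrier R"

definition grade :: "('a, 'b) ring_scheme \<Rightarrow> 'a set \<Rightarrow> enat" where
  "grade R I = (SUP xs \<in> {xs. regular_sequence R xs \<and> set xs \<subseteq> I}. enat (length xs))"

definition height :: "('a, 'b) ring_scheme \<Rightarrow> 'a set \<Rightarrow> enat" where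
  "height R P = (SUP k \<in> {k. \<exists>C :: nat \<Rightarrow> 'a set.
       (\<forall>i\<le>k. primeideal (C i) R) \<and> (\<forall>i<k. C i \<subset> C (Suc i)) \<and> C k = P}. enat k)"

text \<open>
  The definition of Kaplansky (Commutative Rings, Section 3-1). For a maximal ideal \<open>M\<close> of a
  Noetherian ring, the grade and the height of \<open>M\<close> are the depth and the Krull dimension of the
  localization at \<open>M\<close>.
\<close>

definition cohen_macaulay :: "('a, 'b) ring_scheme \<Rightarrow> bool" where
  "cohen_macaulay R \<longleftrightarrow>
     cring R \<and> noetherian_ring R \<and> (\<forall>M. maximalideal M R \<longrightarrow> grade R M = height R M)"

section \<open>Minimal graded free resolutions\<close>

text \<open>The free module of rank \<open>r\<close> consists of the vectors supported on the indices below \<open>r\<close>.\<close>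

definition free_module :: "nat \<Rightarrow> (nat \<Rightarrow> 'a::comm_ring_1) set" where
  "free_module r = {v. \<forall>j\<ge>r. v j = 0}"

definition matrix_map ::
  "nat \<Rightarrow> nat \<Rightarrow> (nat \<Rightarrow> nat \<Rightarrow> 'a::comm_ring_1) \<Rightarrow> (nat \<Rightarrow> 'a) \<Rightarrow> nat \<Rightarrow> 'a" where
  "matrix_map r c \<Phi> v = (\<lambda>k. if k < r then \<Sum>j<c. \<Phi> k j * v j else 0)"

text \<open>
  A minimal graded free resolution of \<open>A / I\<close>, where \<open>A\<close> is graded by \<open>w\<close> and \<open>I\<close> is homogeneous:
  \<open>F i\<close> is free of rank \<open>b i\<close> with basis elements in degrees \<open>d i j\<close>, the matrix \<open>\<Phi> i\<close> represents
  the differential \<open>F (i + 1) \<rightarrow> F i\<close>, and the augmentation \<open>F 0 \<rightarrow> A / I\<close> sends the \<open>j\<close>-th basis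
  element to the class of \<open>e j\<close>. Minimality means that the differentials have their entries in the
  ideal generated by the variables.
\<close>

definition minimal_graded_free_resolution ::
  "('v::finite \<Rightarrow> nat) \<Rightarrow> ('v, 'k::field) mpoly set \<Rightarrow> (nat \<Rightarrow> nat) \<Rightarrow> (nat \<Rightarrow> nat \<Rightarrow> int) \<Rightarrow>
   (nat \<Rightarrow> ('v, 'k) mpoly) \<Rightarrow> (nat \<Rightarrow> nat \<Rightarrow> nat \<Rightarrow> ('v, 'k) mpoly) \<Rightarrow> bool" where
  "minimal_graded_free_resolution w I b d e \<Phi> \<longleftrightarrow>
     (\<forall>j<b 0. homogeneous_poly w (d 0 j) (e j)) \<and>
     (\<forall>i. \<forall>k<b i. \<forall>j<b (Suc i). homogeneous_poly w (d (Suc i) j - d i k) (\<Phi> i k j)) \<and>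
     (\<forall>p. \<exists>v\<in>free_module (b 0). p - (\<Sum>j<b 0. v j * e j) \<in> I) \<and>
     {v \<in> free_module (b 0). (\<Sum>j<b 0. v j * e j) \<in> I} =
       matrix_map (b 0) (b 1) (\<Phi> 0) ` free_module (b 1) \<and>
     (\<forall>i. {v \<in> free_module (b (Suc i)). matrix_map (b i) (b (Suc i)) (\<Phi> i) v = (\<lambda>_. 0)} =
       matrix_map (b (Suc i)) (b (Suc (Suc i))) (\<Phi> (Suc i)) ` free_module (b (Suc (Suc i)))) \<and>
     (\<forall>i. \<forall>k<b i. \<forall>j<b (Suc i). \<Phi> i k j \<in> Idl\<^bsub>mpoly_ring\<^esub> (range var))"

text \<open>The Betti sequence is a relation here; it is single-valued for homogeneous ideals and
  positive weights. It includes the ranks that are zero.\<close>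

definition betti_sequence ::
  "('v::finite \<Rightarrow> nat) \<Rightarrow> ('v, 'k::field) mpoly set \<Rightarrow> (nat \<Rightarrow> nat) \<Rightarrow> bool" where
  "betti_sequence w I b \<longleftrightarrow> (\<exists>d e \<Phi>. minimal_graded_free_resolution w I b d e \<Phi>)"

definition homogeneous_type :: "'k::field itself \<Rightarrow> ('v::finite \<Rightarrow> nat) \<Rightarrow> bool" where
  "homogeneous_type K n \<longleftrightarrow>
     (\<exists>b. betti_sequence standard_weight (tangent_cone_ideal n :: ('v, 'k) mpoly set) b \<and>
          betti_sequence n (semigroup_ideal n :: ('v, 'k) mpoly set) b)"

end

theory Submission
  imports Defs
begin

text \<open>
  Let \<open>n i\<close> be the smallest generator. A Cohen-Macaulay tangent cone has a regular element in its
  irrelevant ideal, and then the parameter \<open>X i\<close> is regular too; in terms of factorizations, adding \<open>n i\<close>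
  raises the maximal length of every element of the semigroup by exactly one. Modulo \<open>X i\<close> the generators
  \<open>f\<^sub>1, \<dots>, f\<^sub>5\<close> become monomials up to sign, except for one binomial in case \<open>i \<noteq> 1\<close>, and the semigroup is
  homogeneous if and only if this binomial is.

  If it is, the explicit resolution of \<open>K[S]\<close> and the matrices of the leading forms of its entries agree
  modulo \<open>X i\<close>. Since \<open>X i\<close> is regular on both \<open>K[S]\<close> and the tangent cone, the latter matrices form a
  resolution of the tangent cone by the graded Nakayama lemma. The resolution of \<open>K[S]\<close> itself is obtained in
  the same way from a complex of monomials modulo the first variable.

  If it is not, compare the last Betti numbers, which are the socle dimensions modulo \<open>X i\<close>. Both socles are
  spanned by maximal elements of the Apery set of \<open>n i\<close>, but for the tangent cone fewer elements are comparable,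
  and in each case there is a maximal element for the tangent cone that is not maximal for \<open>K[S]\<close>.
\<close>

text \<open>Neither ideal is handled through generators. A polynomial lies in I_S iff, for every s,
  its coefficients on the factorizations of s add up to zero; for the tangent cone the same holds
  with the factorizations of maximal length. Questions about the two rings thus become questions
  about factorizations. To know all factorizations of an element, the five binomials are read as
  moves. That they connect all factorizations follows by counting: moves reduce every monomial to a
  power of X_1 times one of at most n_1 monomials without X_1, while the degrees of these must meet
  all n_1 residues modulo n_1. Between Betti numbers and socles stands one elementary device:
  setting one more variable to zero shifts the homology by one position. Once all variables are
  zero, minimality makes every differential vanish and the rank can be read off. The third Betti
  number is at least one count of maximal Apery elements and at most another, and the second set is
  contained in the first; equal Betti numbers therefore force the two sets to coincide.\<close>

abbreviation lookup :: "('a \<Rightarrow>\<^sub>0 'b::zero) \<Rightarrow> 'a \<Rightarrow> 'b" where "lookup \<equiv> Poly_Mapping.lookup"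
abbreviation keys :: "('a \<Rightarrow>\<^sub>0 'b::zero) \<Rightarrow> 'a set" where "keys \<equiv> Poly_Mapping.keys"
abbreviation single :: "'a \<Rightarrow> 'b \<Rightarrow> 'a \<Rightarrow>\<^sub>0 'b::zero" where "single \<equiv> Poly_Mapping.single"

section \<open>Polynomials as finitely supported functions\<close>

lemma sum_single_lookup: "(\<Sum>m\<in>keys p. single m (lookup p m)) = p"
  by (rule poly_mapping_eqI) (simp add: lookup_sum lookup_single when_def in_keys_iff)

lemma poly_mapping_add_induct [case_names single add]:
  assumes "\<And>m c. P (single m c)" and "\<And>p q. P p \<Longrightarrow> P q \<Longrightarrow> P (p + q)"
  shows "P (p :: 'a \<Rightarrow>\<^sub>0 'b::comm_monoid_add)"
proof -
  have "P (\<Sum>m\<in>A. single m (lookup p m))" if "finite A" for A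
    using that
  proof induction
    case empty
    \<comment> \<open>This is the zero polynomial, so the case \<open>single\<close> also covers the
      empty sum.\<close>
    have "P (single undefined 0)" by (rule assms(1))
    then show ?case by simp
  next
    case (insert x F)
    then show ?case by (simp add: assms)
  qed
  from this[of "keys p"] show ?thesis by (simp add: sum_single_lookup)
qed

text \<open>One operation covers truncation by degree, homogeneous components and substitution of
  zero for variables; only the set \<open>T\<close> changes.\<close>

definition keep :: "'m set \<Rightarrow> ('m \<Rightarrow>\<^sub>0 'k::zero) \<Rightarrow> 'm \<Rightarrow>\<^sub>0 'k" where
  "keep T p = Abs_poly_mapping (\<lambda>m. if m \<in> T then lookup p m else 0)"

lemma lookup_keep [simp]: "lookup (keep T p) m = (if m \<in> T then lookup p m else 0)"
proof -
  have "finite {m. (if m \<in> T then lookup p m else 0) \<noteq> 0}"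
    by (rule finite_subset[of _ "keys p"]) (auto simp: in_keys_iff split: if_splits)
  then show ?thesis by (simp add: keep_def)
qed

lemma keys_keep: "keys (keep T p) = keys p \<inter> T"
  by (auto simp: in_keys_iff split: if_splits)

lemma keep_zero [simp]: "keep T 0 = 0"
  by (rule poly_mapping_eqI) simp

lemma keep_add: "keep T (p + q) = keep T p + keep T (q :: 'm \<Rightarrow>\<^sub>0 'k::comm_monoid_add)"
  by (rule poly_mapping_eqI) (simp add: lookup_add)

lemma keep_minus: "keep T (p - q) = keep T p - keep T (q :: 'm \<Rightarrow>\<^sub>0 'k::ab_group_add)"
  by (rule poly_mapping_eqI) (simp add: lookup_minus)

lemma keep_uminus: "keep T (- p) = - keep T (p :: 'm \<Rightarrow>\<^sub>0 'k::ab_group_add)"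
  by (rule poly_mapping_eqI) simp

lemma keep_sum: "keep T (\<Sum>x\<in>A. f x) = (\<Sum>x\<in>A. keep T (f x :: 'm \<Rightarrow>\<^sub>0 'k::comm_monoid_add))"
  by (induction A rule: infinite_finite_induct) (simp_all add: keep_add)

lemma keep_single: "keep T (single m c) = (if m \<in> T then single m c else 0)"
  by (rule poly_mapping_eqI) (auto simp: lookup_single when_def)

lemma keep_keep: "keep S (keep T p) = keep (S \<inter> T) p"
  by (rule poly_mapping_eqI) simp

lemma keep_eq_self_iff: "keep T p = p \<longleftrightarrow> keys p \<subseteq> T"
proof
  assume "keep T p = p"
  then show "keys p \<subseteq> T" using keys_keep[of T p] by auto
next
  assume "keys p \<subseteq> T"
  then show "keep T p = p"
    by (intro poly_mapping_eqI) (auto simp: in_keys_iff)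
qed

lemma keep_eq_0_iff: "keep T p = 0 \<longleftrightarrow> keys p \<inter> T = {}"
proof -
  have "keep T p = 0 \<longleftrightarrow> (\<forall>m. lookup (keep T p) m = 0)"
    by (metis lookup_zero poly_mapping_eqI)
  then show ?thesis by (auto simp: in_keys_iff)
qed

lemma keep_UNIV [simp]: "keep UNIV p = p"
  by (rule poly_mapping_eqI) simp

text \<open>In the expansion into products of monomials, the hypothesis makes membership in
  \<open>T\<close> depend on the second factor alone, so the selection can be moved there.\<close>

lemma keep_mult:
  fixes h p :: "'m::comm_monoid_add \<Rightarrow>\<^sub>0 'k::comm_ring_1"
  assumes "\<And>m m'. m \<in> keys h \<Longrightarrow> m' \<in> keys p \<Longrightarrow> m + m' \<in> T \<longleftrightarrow> m' \<in> T'"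
  shows "keep T (h * p) = h * keep T' p"
proof -
  have "h * p = (\<Sum>m\<in>keys h. \<Sum>m'\<in>keys p. single (m + m') (lookup h m * lookup p m'))"
  proof -
    have "h * p = (\<Sum>m\<in>keys h. single m (lookup h m)) * (\<Sum>m'\<in>keys p. single m' (lookup p m'))"
      by (simp only: sum_single_lookup)
    then show ?thesis by (simp only: sum_product mult_single)
  qed
  then have "keep T (h * p) =
      (\<Sum>m\<in>keys h. \<Sum>m'\<in>keys p. keep T (single (m + m') (lookup h m * lookup p m')))"
    by (simp add: keep_sum)
  also have "\<dots> = (\<Sum>m\<in>keys h. \<Sum>m'\<in>keys p. single m (lookup h m) * keep T' (single m' (lookup p m')))"
    by (intro sum.cong refl) (simp add: keep_single assms mult_single)
  also have "\<dots> = (\<Sum>m\<in>keys h. single m (lookup h m)) * keep T' (\<Sum>m'\<in>keys p. single m' (lookup p m'))"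
    by (simp add: keep_sum sum_product)
  finally show ?thesis by (simp add: sum_single_lookup)
qed

text \<open>The linear functional behind both ideals: for \<open>T\<close> the set of all
  factorizations of \<open>s\<close> it is the coefficient of \<open>t^s\<close> in the image of
  \<open>p\<close>.\<close>

definition csum :: "'m set \<Rightarrow> ('m \<Rightarrow>\<^sub>0 'k::comm_monoid_add) \<Rightarrow> 'k" where
  "csum T p = (\<Sum>m\<in>keys p \<inter> T. lookup p m)"

lemma csum_superset:
  assumes "finite A" "keys p \<subseteq> A"
  shows "csum T p = (\<Sum>m\<in>A. if m \<in> T then lookup p m else 0)"
proof -
  have "csum T p = (\<Sum>m\<in>keys p. if m \<in> T then lookup p m else 0)"
    by (simp add: csum_def sum.inter_restrict)
  also have "\<dots> = (\<Sum>m\<in>A. if m \<in> T then lookup p m else 0)"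
    by (rule sum.mono_neutral_left) (use assms in \<open>auto simp: in_keys_iff\<close>)
  finally show ?thesis .
qed

lemma csum_zero [simp]: "csum T 0 = 0"
  by (simp add: csum_def)

lemma csum_single: "csum T (single m c) = (if m \<in> T then c else 0)"
  by (subst csum_superset[of "{m}"]) auto

lemma csum_add: "csum T (p + q) = csum T p + csum T q"
proof -
  have "csum T r = (\<Sum>m\<in>keys p \<union> keys q. if m \<in> T then lookup r m else 0)"
    if "r \<in> {p, q, p + q}" for r
    by (rule csum_superset) (use that keys_add[of p q] in auto)
  then have "csum T (p + q) = (\<Sum>m\<in>keys p \<union> keys q. if m \<in> T then lookup (p + q) m else 0)"
    "csum T p + csum T q = (\<Sum>m\<in>keys p \<union> keys q. (if m \<in> T then lookup p m else 0) + (if m \<in> T then lookup q m else 0))"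
    by (simp_all only: sum.distrib insert_iff simp_thms)
  then show ?thesis
    by (simp only:) (rule sum.cong, simp_all add: lookup_add)
qed

lemma csum_sum: "csum T (\<Sum>x\<in>A. f x) = (\<Sum>x\<in>A. csum T (f x))"
  by (induction A rule: infinite_finite_induct) (simp_all add: csum_add)

lemma csum_uminus: "csum T (- p) = - csum T (p :: 'm \<Rightarrow>\<^sub>0 'k::ab_group_add)"
  using csum_add[of T p "- p"] by (simp add: eq_neg_iff_add_eq_0 add.commute)

lemma csum_minus: "csum T (p - q) = csum T p - csum T (q :: 'm \<Rightarrow>\<^sub>0 'k::ab_group_add)"
  using csum_add[of T p "- q"] by (simp add: csum_uminus)

lemma csum_single_mult:
  "csum T (single m c * p) = c * csum {m'. m + m' \<in> T} (p :: 'm::comm_monoid_add \<Rightarrow>\<^sub>0 'k::comm_ring_1)"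
  by (induction p rule: poly_mapping_add_induct)
    (simp_all add: mult_single csum_single distrib_left csum_add)

lemma csum_cong: "(\<And>m. m \<in> keys p \<Longrightarrow> m \<in> S \<longleftrightarrow> m \<in> T) \<Longrightarrow> csum S p = csum T p"
  unfolding csum_def by (rule sum.cong) auto

lemma csum_keep: "csum S (keep T p) = csum (S \<inter> T) p"
  unfolding csum_def by (rule sum.cong) (auto simp: keys_keep)

section \<open>Monomials\<close>

definition mon :: "'m \<Rightarrow> 'm \<Rightarrow>\<^sub>0 'k::{zero,one}" where
  "mon m = single m 1"

lemma mon_mult: "mon m * mon m' = (mon (m + m') :: 'm::monoid_add \<Rightarrow>\<^sub>0 'k::comm_ring_1)"
  by (simp add: mon_def mult_single)

lemma mon_zero [simp]: "mon 0 = (1 :: 'm::monoid_add \<Rightarrow>\<^sub>0 'k::comm_ring_1)"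
  by (simp add: mon_def)

lemma keys_mon [simp]: "keys (mon m :: 'm \<Rightarrow>\<^sub>0 'k::zero_neq_one) = {m}"
  by (simp add: mon_def)

lemma csum_mon: "csum T (mon m) = (if m \<in> T then 1 else (0 :: 'k::comm_ring_1))"
  by (simp add: mon_def csum_single)

lemma keep_mon: "keep T (mon m) = (if m \<in> T then mon m else 0)"
  by (simp add: mon_def keep_single)

lemma csum_mon_mult:
  "csum T (mon m * p) = csum {m'. m + m' \<in> T} (p :: 'm::comm_monoid_add \<Rightarrow>\<^sub>0 'k::comm_ring_1)"
  by (simp add: mon_def csum_single_mult)

lemma lookup_mon_mult:
  "lookup (mon m * p) (m + m') = lookup (p :: 'm::cancel_comm_monoid_add \<Rightarrow>\<^sub>0 'k::comm_ring_1) m'"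
  by (induction p rule: poly_mapping_add_induct)
    (simp_all add: mon_def mult_single lookup_single when_def distrib_left lookup_add)

lemma mon_mult_cancel:
  "mon m * p = mon m * q \<longleftrightarrow> p = (q :: 'm::cancel_comm_monoid_add \<Rightarrow>\<^sub>0 'k::comm_ring_1)"
  by (metis lookup_mon_mult poly_mapping_eqI)

lemma mon_mult_eq_0_iff:
  "mon m * p = 0 \<longleftrightarrow> p = (0 :: 'm::cancel_comm_monoid_add \<Rightarrow>\<^sub>0 'k::comm_ring_1)"
  using mon_mult_cancel[of m p 0] by simp

lemma keys_mon_mult:
  "keys (mon m * p) = (+) m ` keys (p :: 'm::cancel_comm_monoid_add \<Rightarrow>\<^sub>0 'k::comm_ring_1)"
proof
  show "keys (mon m * p) \<subseteq> (+) m ` keys p"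
    using keys_mult[of "mon m" p] by auto
  show "(+) m ` keys p \<subseteq> keys (mon m * p)"
    by (auto simp: in_keys_iff lookup_mon_mult)
qed

lemma mon_dvd_iff:
  "mon m dvd p \<longleftrightarrow> (\<forall>k\<in>keys (p :: 'm::cancel_comm_monoid_add \<Rightarrow>\<^sub>0 'k::comm_ring_1). \<exists>r. k = m + r)"
proof
  assume "mon m dvd p"
  then show "\<forall>k\<in>keys p. \<exists>r. k = m + r" by (auto simp: dvd_def keys_mon_mult)
next
  assume *: "\<forall>k\<in>keys p. \<exists>r. k = m + r"
  have "mon m dvd (\<Sum>k\<in>keys p. single k (lookup p k))"
  proof (rule dvd_sum)
    fix k assume "k \<in> keys p"
    then obtain r where "k = m + r" using * by blast
    then have "single k (lookup p k) = mon m * single r (lookup p k)"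
      by (simp add: mon_def mult_single)
    then show "mon m dvd single k (lookup p k)" by (rule dvdI)
  qed
  then show "mon m dvd p" by (simp add: sum_single_lookup)
qed

lemma lookup_single_mult_zero:
  "lookup (single m c * p) 0 = (if m = 0 then c * lookup p 0 else 0)"
  for p :: "('v \<Rightarrow>\<^sub>0 nat) \<Rightarrow>\<^sub>0 'k::comm_ring_1"
proof (induction p rule: poly_mapping_add_induct)
  case (single m' c')
  have "m + m' = 0 \<longleftrightarrow> m = 0 \<and> m' = 0"
    by (auto simp: poly_mapping_eq_iff fun_eq_iff lookup_add)
  then show ?case by (auto simp: mult_single lookup_single when_def)
qed (auto simp: distrib_left lookup_add)

lemma lookup_mult_zero: "lookup (p * q) 0 = lookup p 0 * lookup q 0"
  for p :: "('v \<Rightarrow>\<^sub>0 nat) \<Rightarrow>\<^sub>0 'k::comm_ring_1"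
  by (induction p rule: poly_mapping_add_induct)
    (auto simp: lookup_single_mult_zero lookup_single when_def distrib_right lookup_add)

section \<open>Setting variables to zero\<close>

definition free_of :: "'v set \<Rightarrow> ('v \<Rightarrow>\<^sub>0 nat) set" where
  "free_of V = {m. \<forall>i\<in>V. lookup m i = 0}"

text \<open>Substitution of zero for the variables in \<open>V\<close>, as an endomorphism of the
  same polynomial ring: computing modulo variables means comparing images under
  \<open>kill\<close>.\<close>

definition kill :: "'v set \<Rightarrow> (('v \<Rightarrow>\<^sub>0 nat) \<Rightarrow>\<^sub>0 'k::zero) \<Rightarrow> ('v \<Rightarrow>\<^sub>0 nat) \<Rightarrow>\<^sub>0 'k" where
  "kill V p = keep (free_of V) p"

lemma kill_simps [simp]:
  "kill V 0 = 0" "kill {} p = p"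
  by (simp_all add: kill_def free_of_def)

lemma kill_add: "kill V (p + q) = kill V p + kill V (q :: ('v \<Rightarrow>\<^sub>0 nat) \<Rightarrow>\<^sub>0 'k::comm_monoid_add)"
  and kill_minus: "kill V (p' - q') = kill V p' - kill V (q' :: ('v \<Rightarrow>\<^sub>0 nat) \<Rightarrow>\<^sub>0 'l::ab_group_add)"
  and kill_uminus: "kill V (- p') = - kill V (p' :: ('v \<Rightarrow>\<^sub>0 nat) \<Rightarrow>\<^sub>0 'l::ab_group_add)"
  and kill_sum: "kill V (\<Sum>x\<in>A. f x) = (\<Sum>x\<in>A. kill V (f x :: ('v \<Rightarrow>\<^sub>0 nat) \<Rightarrow>\<^sub>0 'k::comm_monoid_add))"
  by (simp_all add: kill_def keep_add keep_minus keep_uminus keep_sum)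

lemma kill_kill: "kill V (kill W p) = kill (V \<union> W) p"
  by (auto simp: kill_def keep_keep free_of_def intro!: arg_cong[where f = "\<lambda>T. keep T p"])

lemma kill_single: "kill V (single m c) = (if m \<in> free_of V then single m c else 0)"
  by (simp add: kill_def keep_single)

lemma kill_mult: "kill V (p * q) = kill V p * kill V (q :: ('v \<Rightarrow>\<^sub>0 nat) \<Rightarrow>\<^sub>0 'k::comm_ring_1)"
proof (induction p rule: poly_mapping_add_induct)
  case (single m c)
  show ?case
  proof (induction q rule: poly_mapping_add_induct)
    case (single m' c')
    have "m + m' \<in> free_of V \<longleftrightarrow> m \<in> free_of V \<and> m' \<in> free_of V"
      by (auto simp: free_of_def lookup_add)
    then show ?case by (simp add: kill_single mult_single)
  qed (simp add: distrib_left kill_add)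
qed (simp add: distrib_right kill_add)

lemma kill_const: "kill V (single 0 c) = single 0 c"
  by (simp add: kill_single free_of_def)

lemma kill_one [simp]: "kill V 1 = (1 :: ('v \<Rightarrow>\<^sub>0 nat) \<Rightarrow>\<^sub>0 'k::comm_ring_1)"
  by (simp add: kill_const flip: single_one)

lemma var_mon: "var i = mon (single i 1)"
  by (simp add: var_def mon_def)

lemma kill_var: "kill V (var i :: ('v \<Rightarrow>\<^sub>0 nat) \<Rightarrow>\<^sub>0 'k::comm_ring_1) = (if i \<in> V then 0 else var i)"
  by (auto simp: var_def kill_single free_of_def lookup_single when_def)

lemma kill_UNIV: "kill UNIV p = single 0 (lookup p 0)"
proof (rule poly_mapping_eqI)
  fix m :: "'a \<Rightarrow>\<^sub>0 nat"
  have "m \<in> free_of UNIV \<longleftrightarrow> m = 0"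
    unfolding free_of_def by (auto intro: poly_mapping_eqI)
  then show "lookup (kill UNIV p) m = lookup (single 0 (lookup p 0)) m"
    by (cases "m = 0") (simp_all add: kill_def lookup_single when_def)
qed

lemma var_dvd_iff: "var i dvd p \<longleftrightarrow> kill {i} (p :: ('v \<Rightarrow>\<^sub>0 nat) \<Rightarrow>\<^sub>0 'k::comm_ring_1) = 0"
proof -
  have "(\<exists>r. m = single i 1 + r) \<longleftrightarrow> m \<notin> free_of {i}" for m :: "'v \<Rightarrow>\<^sub>0 nat"
  proof
    assume "\<exists>r. m = single i 1 + r"
    then show "m \<notin> free_of {i}" by (auto simp: free_of_def lookup_add)
  next
    assume "m \<notin> free_of {i}"
    then have "m = single i 1 + (m - single i 1)"
      by (intro poly_mapping_eqI) (auto simp: free_of_def lookup_add lookup_minus lookup_single when_def)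
    then show "\<exists>r. m = single i 1 + r" by blast
  qed
  then show ?thesis
    unfolding var_mon mon_dvd_iff kill_def keep_eq_0_iff by blast
qed

lemma kill_eq_var_split:
  fixes p q :: "('v \<Rightarrow>\<^sub>0 nat) \<Rightarrow>\<^sub>0 'k::comm_ring_1"
  assumes "kill {i} p = kill {i} q"
  obtains r where "p = q + var i * r"
proof -
  have "var i dvd p - q" using assms by (simp add: var_dvd_iff kill_minus)
  then obtain r where "p - q = var i * r" by (auto simp: dvd_def)
  then have "p = q + var i * r" by (simp add: algebra_simps)
  then show ?thesis by (rule that)
qed

section \<open>Weighted degrees\<close>

lemma wdegree_add: "wdegree w (m + m') = wdegree w m + wdegree w m'"
  by (simp add: wdegree_def lookup_add distrib_right sum.distrib)

lemma wdegree_zero [simp]: "wdegree w 0 = 0"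
  by (simp add: wdegree_def)

lemma wdegree_single [simp]: "wdegree w (single i k) = k * w i"
  by (simp add: wdegree_def lookup_single when_def if_distrib[of "\<lambda>x. x * _"] cong: if_cong)

lemma homogeneous_poly_zero [simp]: "homogeneous_poly w d 0"
  by (simp add: homogeneous_poly_def)

lemma homogeneous_poly_mon: "int (wdegree w m) = d \<Longrightarrow> homogeneous_poly w d (mon m)"
  by (simp add: homogeneous_poly_def)

lemma homogeneous_poly_uminus: "homogeneous_poly w d (- p) = homogeneous_poly w d p"
  by (simp add: homogeneous_poly_def in_keys_iff)

lemma homogeneous_poly_minus:
  "homogeneous_poly w d p \<Longrightarrow> homogeneous_poly w d q \<Longrightarrow> homogeneous_poly w d (p - q)"
  using keys_diff[of p q] by (auto simp: homogeneous_poly_def)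

lemma homogeneous_poly_keep_eq: "homogeneous_poly w d (keep {m. int (wdegree w m) = d} p)"
  by (simp add: homogeneous_poly_def keys_keep)

lemma keep_le_homogeneous_mult:
  fixes h p :: "('v::finite, 'k::comm_ring_1) mpoly"
  assumes "homogeneous_poly w e h"
  shows "keep {m. int (wdegree w m) \<le> d} (h * p) = h * keep {m. int (wdegree w m) \<le> d - e} p"
  by (rule keep_mult) (use assms in \<open>auto simp: homogeneous_poly_def wdegree_add\<close>)

text \<open>Monomials of the least possible degree \<open>d + e\<close> arise only from degree
  \<open>d\<close> in one factor and \<open>e\<close> in the other. The bounds need not be attained,
  so vanishing leading parts are covered.\<close>

lemma keep_eq_mult_leading:
  fixes p q :: "('v::finite, 'k::comm_ring_1) mpoly"
  assumes "\<And>m. m \<in> keys p \<Longrightarrow> d \<le> int (wdegree w m)"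
    and "\<And>m. m \<in> keys q \<Longrightarrow> e \<le> int (wdegree w m)"
  shows "keep {m. int (wdegree w m) = d + e} (p * q) =
    keep {m. int (wdegree w m) = d} p * keep {m. int (wdegree w m) = e} q"
proof -
  let ?P = "\<lambda>d. {m. int (wdegree w m) = d}"
  have "p = keep (?P d) p + keep (- ?P d) p"
    by (rule poly_mapping_eqI) (simp add: lookup_add)
  then have "p * q = keep (?P d) p * q + keep (- ?P d) p * q"
    by (metis distrib_right)
  then have "keep (?P (d + e)) (p * q) = keep (?P (d + e)) (keep (?P d) p * q) + keep (?P (d + e)) (keep (- ?P d) p * q)"
    by (simp add: keep_add)
  also have "keep (?P (d + e)) (keep (?P d) p * q) = keep (?P d) p * keep (?P e) q"
    by (rule keep_mult) (auto simp: keys_keep wdegree_add)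
  also have "keep (?P (d + e)) (keep (- ?P d) p * q) = keep (- ?P d) p * keep {} q"
    by (rule keep_mult) (use assms in \<open>force simp: keys_keep wdegree_add\<close>)
  also have "keep {} q = 0" by (simp add: keep_eq_0_iff)
  finally show ?thesis by simp
qed

section \<open>Ideals of the ring structure on a type\<close>

text \<open>Ideals in terms of the type class operations; \<open>ideal_iff\<close> connects this
  with the record-based notion in the theorem.\<close>

definition is_ideal :: "'a::comm_ring_1 set \<Rightarrow> bool" where
  "is_ideal I \<longleftrightarrow> 0 \<in> I \<and> (\<forall>p\<in>I. \<forall>q\<in>I. p + q \<in> I) \<and> (\<forall>p. \<forall>q\<in>I. p * q \<in> I)"

lemma is_idealD:
  assumes "is_ideal I"
  shows "0 \<in> I" "p \<in> I \<Longrightarrow> q \<in> I \<Longrightarrow> p + q \<in> I" "q \<in> I \<Longrightarrow> p * q \<in> I"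
    "p \<in> I \<Longrightarrow> - p \<in> I" "p \<in> I \<Longrightarrow> q \<in> I \<Longrightarrow> p - q \<in> I"
proof -
  have um: "- r \<in> I" if "r \<in> I" for r
    using assms that unfolding is_ideal_def by (metis mult_minus1)
  have "r + - s \<in> I" if "r \<in> I" "s \<in> I" for r s
    using assms that(1) um[OF that(2)] unfolding is_ideal_def by blast
  then show "0 \<in> I" "p \<in> I \<Longrightarrow> q \<in> I \<Longrightarrow> p + q \<in> I" "q \<in> I \<Longrightarrow> p * q \<in> I"
    "p \<in> I \<Longrightarrow> - p \<in> I" "p \<in> I \<Longrightarrow> q \<in> I \<Longrightarrow> p - q \<in> I"
    using assms um by (auto simp: is_ideal_def)
qed

lemma is_ideal_sum: "is_ideal I \<Longrightarrow> (\<And>x. x \<in> A \<Longrightarrow> f x \<in> I) \<Longrightarrow> (\<Sum>x\<in>A. f x) \<in> I"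
  by (induction A rule: infinite_finite_induct) (auto simp: is_idealD)

lemma mpoly_ring_sel [simp]:
  "carrier (ring_of_type_algebra :: 'a::comm_ring_1 ring) = UNIV"
  "x \<oplus>\<^bsub>(ring_of_type_algebra :: 'a ring)\<^esub> y = x + y"
  "x \<otimes>\<^bsub>(ring_of_type_algebra :: 'a ring)\<^esub> y = x * y"
  "\<zero>\<^bsub>(ring_of_type_algebra :: 'a ring)\<^esub> = 0"
  "\<one>\<^bsub>(ring_of_type_algebra :: 'a ring)\<^esub> = 1"
  by (simp_all add: ring_of_type_algebra_def)

lemma cring_type_algebra: "cring (ring_of_type_algebra :: 'a::comm_ring_1 ring)"
  by (rule cring_from_type_algebra)

lemma ideal_iff: "ideal I (ring_of_type_algebra :: 'a::comm_ring_1 ring) \<longleftrightarrow> is_ideal I"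
proof
  let ?R = "ring_of_type_algebra :: 'a ring"
  assume "ideal I ?R"
  then interpret ideal I ?R .
  show "is_ideal I"
    unfolding is_ideal_def
    using additive_subgroup.zero_closed[OF is_additive_subgroup]
      additive_subgroup.a_closed[OF is_additive_subgroup] I_l_closed by auto
next
  let ?R = "ring_of_type_algebra :: 'a ring"
  assume I: "is_ideal I"
  interpret cring ?R by (rule cring_type_algebra)
  have minus: "\<ominus>\<^bsub>?R\<^esub> x = - x" for x
    by (rule minus_equality) auto
  have "a * x \<in> I" if "a \<in> I" for a x
    using is_idealD(3)[OF I that, of x] by (simp add: Groups.mult_ac)
  then show "ideal I ?R"
  proof (intro idealI)
    show "subgroup I (add_monoid ?R)"
    proof (rule add.subgroupI)
      show "I \<noteq> {}" using is_idealD(1)[OF I] by blast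
      show "\<ominus>\<^bsub>?R\<^esub> a \<in> I" if "a \<in> I" for a
        using is_idealD(4)[OF I that] by (simp add: minus)
    qed (auto simp: is_idealD[OF I])
  qed (auto simp: is_idealD[OF I] ring_axioms)
qed

lemma genideal_is_ideal: "is_ideal (Idl\<^bsub>(ring_of_type_algebra :: 'a::comm_ring_1 ring)\<^esub> S)"
proof -
  interpret cring "ring_of_type_algebra :: 'a ring" by (rule cring_type_algebra)
  show ?thesis using genideal_ideal[of S] by (simp add: ideal_iff)
qed

lemma genideal_eqI:
  assumes "is_ideal I" "S \<subseteq> I" "\<And>p. p \<in> I \<Longrightarrow> p \<in> Idl\<^bsub>(ring_of_type_algebra :: 'a::comm_ring_1 ring)\<^esub> S"
  shows "Idl\<^bsub>(ring_of_type_algebra :: 'a::comm_ring_1 ring)\<^esub> S = I"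
proof -
  interpret cring "ring_of_type_algebra :: 'a ring" by (rule cring_type_algebra)
  show ?thesis using genideal_minimal[of I S] assms by (auto simp: ideal_iff)
qed

lemma genideal_superset: "S \<subseteq> Idl\<^bsub>(ring_of_type_algebra :: 'a::comm_ring_1 ring)\<^esub> S"
proof -
  interpret cring "ring_of_type_algebra :: 'a ring" by (rule cring_type_algebra)
  show ?thesis using genideal_self[of S] by simp
qed

lemma genideal_range_var:
  "Idl\<^bsub>mpoly_ring\<^esub> (range var) = {p :: ('v, 'k::comm_ring_1) mpoly. lookup p 0 = 0}"
proof (rule genideal_eqI)
  show "is_ideal {p :: ('v, 'k) mpoly. lookup p 0 = 0}"
    by (auto simp: is_ideal_def lookup_add lookup_mult_zero)
  show "range var \<subseteq> {p :: ('v, 'k) mpoly. lookup p 0 = 0}"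
  proof -
    have "single i (1::nat) \<noteq> 0" for i :: 'v
      by (metis lookup_single_eq lookup_zero one_neq_zero)
    then show ?thesis by (auto simp: var_def lookup_single when_def)
  qed
  fix p :: "('v, 'k) mpoly"
  assume p: "p \<in> {p. lookup p 0 = 0}"
  let ?I = "Idl\<^bsub>mpoly_ring\<^esub> (range (var :: 'v \<Rightarrow> ('v, 'k) mpoly))"
  have "(\<Sum>m\<in>keys p. single m (lookup p m)) \<in> ?I"
  proof (rule is_ideal_sum[OF genideal_is_ideal])
    fix m assume m: "m \<in> keys p"
    then have "m \<noteq> 0" using p by auto
    then obtain i where i: "lookup m i \<noteq> 0" by (metis lookup_zero poly_mapping_eqI)
    then have "kill {i} (single m (lookup p m)) = 0"
      by (simp add: kill_single free_of_def)
    then obtain q where "single m (lookup p m) = var i * q"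
      using var_dvd_iff[of i "single m (lookup p m)"] by (auto simp: dvd_def)
    moreover have "var i \<in> ?I"
      by (rule subsetD[OF genideal_superset]) simp
    ultimately show "single m (lookup p m) \<in> ?I"
      using is_idealD(3)[OF genideal_is_ideal, of "var i" _ q] by (simp add: mult.commute)
  qed
  then show "p \<in> ?I" by (simp add: sum_single_lookup)
qed

section \<open>Matrices over polynomial rings\<close>

lemma free_module_zero [simp]: "(\<lambda>_. 0) \<in> free_module r"
  and free_module_minus: "u \<in> free_module r \<Longrightarrow> v \<in> free_module r \<Longrightarrow> (\<lambda>k. u k - v k) \<in> free_module r"
  and free_module_scale: "u \<in> free_module r \<Longrightarrow> (\<lambda>k. p * u k) \<in> free_module r"
  and free_module_sum: "(\<And>x. x \<in> A \<Longrightarrow> g x \<in> free_module r) \<Longrightarrow> (\<lambda>k. \<Sum>x\<in>A. f x * g x k) \<in> free_module r"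
  and matrix_map_free: "matrix_map r c \<Phi> v \<in> free_module r"
  by (auto simp: free_module_def matrix_map_def)

lemma matrix_map_zero [simp]: "matrix_map r c \<Phi> (\<lambda>_. 0) = (\<lambda>_. 0)"
  by (auto simp: matrix_map_def)

lemma matrix_map_minus: "matrix_map r c \<Phi> (\<lambda>k. u k - v k) = (\<lambda>k. matrix_map r c \<Phi> u k - matrix_map r c \<Phi> v k)"
  by (auto simp: matrix_map_def right_diff_distrib sum_subtractf)

lemma matrix_map_add: "matrix_map r c \<Phi> (\<lambda>k. u k + v k) = (\<lambda>k. matrix_map r c \<Phi> u k + matrix_map r c \<Phi> v k)"
  by (auto simp: matrix_map_def distrib_left sum.distrib)

lemma matrix_map_scale: "matrix_map r c \<Phi> (\<lambda>k. p * v k) = (\<lambda>k. p * matrix_map r c \<Phi> v k)"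
  by (auto simp: matrix_map_def sum_distrib_left mult.left_commute)

lemma matrix_map_sum:
  "matrix_map r c \<Phi> (\<lambda>k. \<Sum>x\<in>A. f x * g x k) = (\<lambda>k. \<Sum>x\<in>A. f x * matrix_map r c \<Phi> (g x) k)"
proof
  fix k
  have "(\<Sum>j<c. \<Phi> k j * (\<Sum>x\<in>A. f x * g x j)) = (\<Sum>x\<in>A. f x * (\<Sum>j<c. \<Phi> k j * g x j))"
    by (simp add: sum_distrib_left mult.left_commute) (rule sum.swap)
  then show "matrix_map r c \<Phi> (\<lambda>k. \<Sum>x\<in>A. f x * g x k) k = (\<Sum>x\<in>A. f x * matrix_map r c \<Phi> (g x) k)"
    by (simp add: matrix_map_def)
qed

definition kill_vec :: "'v set \<Rightarrow> (nat \<Rightarrow> ('v, 'k::comm_ring_1) mpoly) \<Rightarrow> nat \<Rightarrow> ('v, 'k) mpoly" where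
  "kill_vec V v = (\<lambda>k. kill V (v k))"

lemma kill_vec_kill_vec: "kill_vec V (kill_vec W v) = kill_vec (V \<union> W) v"
  by (simp add: kill_vec_def kill_kill)

lemma kill_vec_mono: "kill_vec V u = kill_vec V v \<Longrightarrow> V \<subseteq> W \<Longrightarrow> kill_vec W u = kill_vec W v"
  by (metis kill_vec_kill_vec sup.absorb_iff1)

lemma kill_vec_zero [simp]: "kill_vec V (\<lambda>_. 0) = (\<lambda>_. 0)"
  by (simp add: kill_vec_def)

lemma kill_vec_empty [simp]: "kill_vec {} v = v"
  by (simp add: kill_vec_def)

lemma kill_vec_minus: "kill_vec V (\<lambda>k. u k - v k) = (\<lambda>k. kill_vec V u k - kill_vec V v k)"
  by (simp add: kill_vec_def kill_minus)

lemma kill_vec_scale: "kill_vec V (\<lambda>k. p * v k) = (\<lambda>k. kill V p * kill_vec V v k)"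
  by (simp add: kill_vec_def kill_mult)

lemma kill_vec_var: "x \<notin> V \<Longrightarrow> kill_vec V (\<lambda>k. var x * v k) = (\<lambda>k. var x * kill_vec V v k)"
  and kill_vec_var_in: "x \<in> V \<Longrightarrow> kill_vec V (\<lambda>k. var x * v k) = (\<lambda>k. 0)"
  by (simp_all add: kill_vec_scale kill_var)

lemma kill_vec_matrix_map:
  "kill_vec V (matrix_map r c \<Phi> v) = matrix_map r c (\<lambda>k j. kill V (\<Phi> k j)) (kill_vec V v)"
  by (auto simp: kill_vec_def matrix_map_def kill_sum kill_mult)

lemma kill_vec_matrix_map_cong:
  "kill_vec V u = kill_vec V v \<Longrightarrow> kill_vec V (matrix_map r c \<Phi> u) = kill_vec V (matrix_map r c \<Phi> v)"
  by (simp add: kill_vec_matrix_map)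

lemma var_cancel_vec:
  "(\<lambda>k. var x * u k) = (\<lambda>k. var x * v k) \<Longrightarrow> u = (v :: nat \<Rightarrow> ('v, 'k::comm_ring_1) mpoly)"
  by (simp add: fun_eq_iff var_mon mon_mult_cancel)

text \<open>The quotient is normalised to be free of the variables in \<open>V\<close>, so that
  divisibility modulo \<open>V\<close> becomes a true equation determining \<open>w\<close>.\<close>

lemma divide_vec_by_var:
  fixes u :: "nat \<Rightarrow> ('v, 'k::comm_ring_1) mpoly"
  assumes "x \<notin> V" "u \<in> free_module r" "kill_vec (insert x V) u = (\<lambda>_. 0)"
  obtains w where "w \<in> free_module r" "kill_vec V w = w" "kill_vec V u = (\<lambda>k. var x * w k)"
proof -
  have "\<exists>w. kill V (u k) = var x * w" for k
  proof -
    have "kill {x} (kill V (u k)) = 0"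
      using fun_cong[OF assms(3), of k] by (simp add: kill_kill kill_vec_def)
    then show ?thesis by (auto simp flip: var_dvd_iff simp: dvd_def)
  qed
  then obtain w where w: "\<And>k. kill V (u k) = var x * w k" by metis
  have "kill_vec V w = w"
  proof
    fix k
    have "var x * kill V (w k) = kill V (kill V (u k))"
      using assms(1) by (simp add: w kill_mult kill_var)
    also have "\<dots> = kill V (u k)" by (simp add: kill_kill)
    also have "\<dots> = var x * w k" by (rule w)
    finally show "kill_vec V w k = w k" by (simp add: kill_vec_def var_mon mon_mult_cancel)
  qed
  moreover have "w \<in> free_module r"
    using assms(2) w by (auto simp: free_module_def var_mon mon_mult_eq_0_iff[symmetric] simp del: mon_mult_eq_0_iff)
      (metis kill_simps(1) mon_mult_eq_0_iff)
  ultimately show ?thesis using that w by (auto simp: kill_vec_def)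
qed

section \<open>Complexes modulo variables\<close>

context
  fixes b :: "nat \<Rightarrow> nat" and \<Phi> :: "nat \<Rightarrow> nat \<Rightarrow> nat \<Rightarrow> ('v, 'k::comm_ring_1) mpoly"
begin

abbreviation "diff i \<equiv> matrix_map (b i) (b (Suc i)) (\<Phi> i)"

definition is_complex :: bool where
  "is_complex \<longleftrightarrow> (\<forall>i. \<forall>v. diff i (diff (Suc i) v) = (\<lambda>_. 0))"

definition boundaries_mod :: "'v set \<Rightarrow> nat \<Rightarrow> (nat \<Rightarrow> ('v, 'k) mpoly) set" where
  "boundaries_mod V i = {u. \<exists>q\<in>free_module (b (Suc i)). kill_vec V u = kill_vec V (diff i q)}"

text \<open>Vanishing of the homology at position \<open>i + 1\<close> of the complex modulo
  \<open>V\<close>; the index is that of the outgoing differential.\<close>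

definition exact_mod :: "'v set \<Rightarrow> nat \<Rightarrow> bool" where
  "exact_mod V i \<longleftrightarrow> (\<forall>v\<in>free_module (b (Suc i)). kill_vec V (diff i v) = (\<lambda>_. 0) \<longrightarrow>
     v \<in> boundaries_mod V (Suc i))"

text \<open>Part of the long exact sequence of multiplication by \<open>x\<close> on the complex
  modulo \<open>V\<close>: vanishing at positions \<open>i + 1\<close> and \<open>i + 2\<close>
  gives vanishing at \<open>i + 2\<close> after \<open>x\<close> is set to zero too.\<close>

lemma exact_mod_insert:
  assumes "is_complex" "exact_mod V i" "exact_mod V (Suc i)" "x \<notin> V"
  shows "exact_mod (insert x V) (Suc i)"
  unfolding exact_mod_def
proof (intro ballI impI)
  fix v assume v: "v \<in> free_module (b (Suc (Suc i)))" and 0: "kill_vec (insert x V) (diff (Suc i) v) = (\<lambda>_. 0)"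
  obtain w where w: "w \<in> free_module (b (Suc i))" "kill_vec V w = w" "kill_vec V (diff (Suc i) v) = (\<lambda>k. var x * w k)"
    by (rule divide_vec_by_var[OF assms(4) matrix_map_free 0])
  have "kill_vec V (diff i (\<lambda>k. var x * w k)) = kill_vec V (diff i (diff (Suc i) v))"
    by (rule kill_vec_matrix_map_cong) (simp add: kill_vec_kill_vec flip: w(3))
  also have "\<dots> = (\<lambda>_. 0)" using assms(1) by (simp add: is_complex_def)
  finally have "(\<lambda>k. var x * kill_vec V (diff i w) k) = (\<lambda>k. var x * 0)"
    using assms(4) by (simp add: matrix_map_scale kill_vec_var)
  then have "kill_vec V (diff i w) = (\<lambda>_. 0)" by (rule var_cancel_vec)
  then obtain q where q: "q \<in> free_module (b (Suc (Suc i)))" "kill_vec V w = kill_vec V (diff (Suc i) q)"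
    using assms(2) w(1) by (auto simp: exact_mod_def boundaries_mod_def)
  \<comment> \<open>The correction by \<open>x * q\<close> turns a cycle modulo \<open>x\<close> and
    \<open>V\<close> into a cycle modulo \<open>V\<close>, without changing it modulo
    \<open>x\<close>.\<close>
  have "kill_vec V (diff (Suc i) (\<lambda>k. v k - var x * q k)) = (\<lambda>_. 0)"
    using assms(4) w q by (simp add: matrix_map_minus matrix_map_scale kill_vec_minus kill_vec_var)
  moreover have "(\<lambda>k. v k - var x * q k) \<in> free_module (b (Suc (Suc i)))"
    using v q by (intro free_module_minus free_module_scale)
  ultimately obtain r where r: "r \<in> free_module (b (Suc (Suc (Suc i))))"
    "kill_vec V (\<lambda>k. v k - var x * q k) = kill_vec V (diff (Suc (Suc i)) r)"
    using assms(3) by (auto simp: exact_mod_def boundaries_mod_def)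
  have "kill_vec (insert x V) (\<lambda>k. v k - var x * q k) = kill_vec (insert x V) (diff (Suc (Suc i)) r)"
    by (rule kill_vec_mono[OF r(2)]) auto
  then have "kill_vec (insert x V) v = kill_vec (insert x V) (diff (Suc (Suc i)) r)"
    by (simp add: kill_vec_minus kill_vec_var_in)
  then show "v \<in> boundaries_mod (insert x V) (Suc (Suc i))"
    using r(1) by (auto simp: boundaries_mod_def)
qed

text \<open>Elements of homological degree \<open>i\<close> whose classes are linearly independent socle elements of the
  homology of the complex modulo \<open>V\<close>.\<close>

definition socle_family :: "'v set \<Rightarrow> nat \<Rightarrow> 'l set \<Rightarrow> ('l \<Rightarrow> nat \<Rightarrow> ('v, 'k) mpoly) \<Rightarrow> bool" where
  "socle_family V i L z \<longleftrightarrow>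
     (\<forall>l\<in>L. z l \<in> free_module (b i)) \<and>
     (\<forall>l\<in>L. \<forall>j. i = Suc j \<longrightarrow> kill_vec V (diff j (z l)) = (\<lambda>_. 0)) \<and>
     (\<forall>l\<in>L. \<forall>x. x \<notin> V \<longrightarrow> (\<lambda>k. var x * z l k) \<in> boundaries_mod V i) \<and>
     (\<forall>c. (\<lambda>k. \<Sum>l\<in>L. single 0 (c l) * z l k) \<in> boundaries_mod V i \<longrightarrow> (\<forall>l\<in>L. c l = 0))"

lemma kill_vec_lincomb:
  "kill_vec V (\<lambda>k. \<Sum>l\<in>L. single 0 (c l) * z l k) = (\<lambda>k. \<Sum>l\<in>L. single 0 (c l) * kill_vec V (z l) k)"
  by (simp add: kill_vec_def kill_sum kill_mult kill_const)

text \<open>The connecting homomorphism of multiplication by \<open>x\<close> identifies the elements of the homology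
  modulo \<open>V\<close> annihilated by \<open>x\<close> with the next homology modulo \<open>x\<close> and \<open>V\<close>.\<close>

lemma socle_family_up:
  assumes "is_complex" "exact_mod V i" "x \<notin> V" "socle_family V i L z"
  shows "\<exists>w. socle_family (insert x V) (Suc i) L w"
proof -
  let ?V = "insert x V"
  note z = assms(4)[unfolded socle_family_def]
  have "\<forall>l\<in>L. \<exists>q\<in>free_module (b (Suc i)). kill_vec V (\<lambda>k. var x * z l k) = kill_vec V (diff i q)"
    using z assms(3) by (auto simp: boundaries_mod_def)
  then obtain w where w: "\<And>l. l \<in> L \<Longrightarrow> w l \<in> free_module (b (Suc i))"
    "\<And>l. l \<in> L \<Longrightarrow> kill_vec V (diff i (w l)) = kill_vec V (\<lambda>k. var x * z l k)"
    by metis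
  have "kill_vec ?V (diff j (w l)) = (\<lambda>_. 0)" if "l \<in> L" "Suc i = Suc j" for l j
  proof -
    have "kill_vec ?V (diff i (w l)) = kill_vec ?V (\<lambda>k. var x * z l k)"
      by (rule kill_vec_mono[OF w(2)[OF that(1)]]) auto
    then show ?thesis using that by (simp add: kill_vec_var_in)
  qed
  moreover have "(\<lambda>k. var x' * w l k) \<in> boundaries_mod ?V (Suc i)" if "l \<in> L" "x' \<notin> ?V" for l x'
  proof -
    have "(\<lambda>k. var x' * z l k) \<in> boundaries_mod V i" using z that by blast
    then obtain q where q: "q \<in> free_module (b (Suc i))" "kill_vec V (\<lambda>k. var x' * z l k) = kill_vec V (diff i q)"
      unfolding boundaries_mod_def by blast
    let ?r = "\<lambda>k. var x' * w l k - var x * q k"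
    have "kill_vec V (diff i ?r) = (\<lambda>_. 0)"
      using that assms(3) w(2)[OF that(1)] q(2)
      by (simp add: matrix_map_minus matrix_map_scale kill_vec_minus kill_vec_var mult.left_commute flip: q(2))
    moreover have "?r \<in> free_module (b (Suc i))"
      using w(1)[OF that(1)] q(1) by (intro free_module_minus free_module_scale)
    ultimately obtain s where s: "s \<in> free_module (b (Suc (Suc i)))"
      "kill_vec V ?r = kill_vec V (diff (Suc i) s)"
      using assms(2) by (auto simp: exact_mod_def boundaries_mod_def)
    have "kill_vec ?V ?r = kill_vec ?V (diff (Suc i) s)"
      by (rule kill_vec_mono[OF s(2)]) auto
    then have "kill_vec ?V (\<lambda>k. var x' * w l k) = kill_vec ?V (diff (Suc i) s)"
      by (simp add: kill_vec_minus kill_vec_var_in)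
    then show ?thesis using s(1) by (auto simp: boundaries_mod_def)
  qed
  moreover have "\<forall>l\<in>L. c l = 0"
    if c: "(\<lambda>k. \<Sum>l\<in>L. single 0 (c l) * w l k) \<in> boundaries_mod ?V (Suc i)" for c
  proof -
    let ?W = "\<lambda>k. \<Sum>l\<in>L. single 0 (c l) * w l k"
    obtain q where q: "q \<in> free_module (b (Suc (Suc i)))" "kill_vec ?V ?W = kill_vec ?V (diff (Suc i) q)"
      using c by (auto simp: boundaries_mod_def)
    let ?u = "\<lambda>k. ?W k - diff (Suc i) q k"
    have "?W \<in> free_module (b (Suc i))" using w(1) by (rule free_module_sum)
    then have "?u \<in> free_module (b (Suc i))"
      by (intro free_module_minus matrix_map_free)
    moreover have "kill_vec ?V ?u = (\<lambda>_. 0)" using q(2) by (simp add: kill_vec_minus)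
    ultimately obtain w' where w': "w' \<in> free_module (b (Suc i))" "kill_vec V w' = w'"
      "kill_vec V ?u = (\<lambda>k. var x * w' k)"
      using divide_vec_by_var[OF assms(3)] by blast
    have "(\<lambda>k. var x * kill_vec V (\<lambda>k. \<Sum>l\<in>L. single 0 (c l) * z l k) k) =
        (\<lambda>k. \<Sum>l\<in>L. single 0 (c l) * kill_vec V (\<lambda>k. var x * z l k) k)"
      using assms(3) by (simp add: kill_vec_lincomb sum_distrib_left mult.left_commute kill_vec_var)
    also have "\<dots> = kill_vec V (diff i ?W)"
      by (simp add: matrix_map_sum kill_vec_lincomb w(2))
    also have "\<dots> = kill_vec V (diff i ?u)"
      using assms(1) by (simp add: matrix_map_minus is_complex_def)
    also have "\<dots> = kill_vec V (diff i (\<lambda>k. var x * w' k))"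
      by (rule kill_vec_matrix_map_cong) (simp add: kill_vec_kill_vec flip: w'(3))
    also have "\<dots> = (\<lambda>k. var x * kill_vec V (diff i w') k)"
      using assms(3) by (simp add: matrix_map_scale kill_vec_var)
    finally have "kill_vec V (\<lambda>k. \<Sum>l\<in>L. single 0 (c l) * z l k) = kill_vec V (diff i w')"
      by (rule var_cancel_vec)
    then have "(\<lambda>k. \<Sum>l\<in>L. single 0 (c l) * z l k) \<in> boundaries_mod V i"
      using w'(1) by (auto simp: boundaries_mod_def)
    then show ?thesis using z by blast
  qed
  ultimately show ?thesis
    unfolding socle_family_def using w(1) by (intro exI[of _ w]) blast
qed

text \<open>The inverse direction: \<open>w\<close> is a cycle only modulo \<open>x\<close>, so its
  differential is divisible by \<open>x\<close>, and the quotient is \<open>z\<close>.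
  Multiplication by \<open>x\<close> annihilates \<open>z\<close> because the product is the
  boundary of \<open>w\<close>.\<close>

lemma socle_family_down:
  assumes "is_complex" "exact_mod V i" "x \<notin> V" "socle_family (insert x V) (Suc i) L w"
  shows "\<exists>z. socle_family V i L z"
proof -
  let ?V = "insert x V"
  note w = assms(4)[unfolded socle_family_def]
  have "\<forall>l\<in>L. \<exists>z. z \<in> free_module (b i) \<and> kill_vec V z = z \<and> kill_vec V (diff i (w l)) = (\<lambda>k. var x * z k)"
  proof
    fix l assume "l \<in> L"
    then have "kill_vec ?V (diff i (w l)) = (\<lambda>_. 0)" using w by blast
    then show "\<exists>z. z \<in> free_module (b i) \<and> kill_vec V z = z \<and> kill_vec V (diff i (w l)) = (\<lambda>k. var x * z k)"
      by (rule divide_vec_by_var[OF assms(3) matrix_map_free]) blast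
  qed
  then obtain z where z: "\<And>l. l \<in> L \<Longrightarrow> z l \<in> free_module (b i)" "\<And>l. l \<in> L \<Longrightarrow> kill_vec V (z l) = z l"
    "\<And>l. l \<in> L \<Longrightarrow> kill_vec V (diff i (w l)) = (\<lambda>k. var x * z l k)"
    by metis
  have "kill_vec V (diff j (z l)) = (\<lambda>_. 0)" if "l \<in> L" "i = Suc j" for l j
  proof -
    have "(\<lambda>k. var x * kill_vec V (diff j (z l)) k) = kill_vec V (diff j (\<lambda>k. var x * z l k))"
      using assms(3) by (simp add: matrix_map_scale kill_vec_var)
    also have "\<dots> = kill_vec V (diff j (diff i (w l)))"
      by (rule kill_vec_matrix_map_cong) (simp add: kill_vec_kill_vec flip: z(3)[OF that(1)])
    also have "\<dots> = (\<lambda>k. var x * 0)" using assms(1) that by (simp add: is_complex_def)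
    finally show ?thesis by (rule var_cancel_vec)
  qed
  moreover have "(\<lambda>k. var x' * z l k) \<in> boundaries_mod V i" if l: "l \<in> L" and x': "x' \<notin> V" for l x'
  proof (cases "x' = x")
    case True
    have "kill_vec V (\<lambda>k. var x * z l k) = kill_vec V (diff i (w l))"
      by (simp add: kill_vec_kill_vec flip: z(3)[OF l])
    then show ?thesis using w l True by (auto simp: boundaries_mod_def)
  next
    case False
    then have "(\<lambda>k. var x' * w l k) \<in> boundaries_mod ?V (Suc i)" using w l x' by blast
    then obtain q where q: "q \<in> free_module (b (Suc (Suc i)))"
      "kill_vec ?V (\<lambda>k. var x' * w l k) = kill_vec ?V (diff (Suc i) q)"
      unfolding boundaries_mod_def by blast
    let ?u = "\<lambda>k. var x' * w l k - diff (Suc i) q k"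
    have "?u \<in> free_module (b (Suc i))"
      using w l by (intro free_module_minus free_module_scale matrix_map_free) auto
    moreover have "kill_vec ?V ?u = (\<lambda>_. 0)" using q(2) by (simp add: kill_vec_minus)
    ultimately obtain w' where w': "w' \<in> free_module (b (Suc i))" "kill_vec V w' = w'"
      "kill_vec V ?u = (\<lambda>k. var x * w' k)"
      using divide_vec_by_var[OF assms(3)] by blast
    have "(\<lambda>k. var x * (kill_vec V (\<lambda>k. var x' * z l k) k)) = (\<lambda>k. var x' * kill_vec V (diff i (w l)) k)"
      using x' z(2)[OF l] by (simp add: kill_vec_var z(3)[OF l] mult.left_commute)
    also have "\<dots> = kill_vec V (diff i ?u)"
      using assms(1) x' by (simp add: matrix_map_minus matrix_map_scale is_complex_def kill_vec_var)
    also have "\<dots> = kill_vec V (diff i (\<lambda>k. var x * w' k))"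
      by (rule kill_vec_matrix_map_cong) (simp add: kill_vec_kill_vec flip: w'(3))
    also have "\<dots> = (\<lambda>k. var x * kill_vec V (diff i w') k)"
      using assms(3) by (simp add: matrix_map_scale kill_vec_var)
    finally have "kill_vec V (\<lambda>k. var x' * z l k) = kill_vec V (diff i w')"
      by (rule var_cancel_vec)
    then show ?thesis using w'(1) by (auto simp: boundaries_mod_def)
  qed
  moreover have "\<forall>l\<in>L. c l = 0"
    if c: "(\<lambda>k. \<Sum>l\<in>L. single 0 (c l) * z l k) \<in> boundaries_mod V i" for c
  proof -
    let ?Z = "\<lambda>k. \<Sum>l\<in>L. single 0 (c l) * z l k" and ?W = "\<lambda>k. \<Sum>l\<in>L. single 0 (c l) * w l k"
    obtain v where v: "v \<in> free_module (b (Suc i))" "kill_vec V ?Z = kill_vec V (diff i v)"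
      using c by (auto simp: boundaries_mod_def)
    let ?u = "\<lambda>k. ?W k - var x * v k"
    have "kill_vec V (diff i ?W) = (\<lambda>k. var x * kill_vec V ?Z k)"
      by (simp add: matrix_map_sum kill_vec_lincomb z(2,3) sum_distrib_left mult.left_commute)
    then have "kill_vec V (diff i ?u) = (\<lambda>_. 0)"
      using assms(3) v(2) by (simp add: matrix_map_minus matrix_map_scale kill_vec_minus kill_vec_var)
    moreover have "?u \<in> free_module (b (Suc i))"
      using w v by (intro free_module_minus free_module_scale free_module_sum) auto
    ultimately obtain s where s: "s \<in> free_module (b (Suc (Suc i)))"
      "kill_vec V ?u = kill_vec V (diff (Suc i) s)"
      using assms(2) by (auto simp: exact_mod_def boundaries_mod_def)
    have "kill_vec ?V ?u = kill_vec ?V (diff (Suc i) s)"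
      by (rule kill_vec_mono[OF s(2)]) auto
    then have "kill_vec ?V ?W = kill_vec ?V (diff (Suc i) s)"
      by (simp add: kill_vec_minus kill_vec_var_in)
    then have "?W \<in> boundaries_mod ?V (Suc i)" using s(1) by (auto simp: boundaries_mod_def)
    then show ?thesis using w by blast
  qed
  ultimately show ?thesis
    unfolding socle_family_def using z(1) by (intro exI[of _ z]) blast
qed

text \<open>Modulo \<open>y\<close> alone exactness holds at all positions, and each further
  variable costs one position by \<open>exact_mod_insert\<close>; hence the bound on
  \<open>card V\<close>.\<close>

lemma exact_mod_superset:
  assumes "is_complex" "\<And>i. exact_mod {y} i" "finite V" "y \<in> V" "card V \<le> Suc i"
  shows "exact_mod V i"
proof -
  have "exact_mod (insert y W) i" if "finite W" "y \<notin> W" "card W \<le> i" for W i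
    using that
  proof (induction W arbitrary: i)
    case empty
    then show ?case using assms(2) by simp
  next
    case (insert x W)
    then obtain j where j: "i = Suc j" by (cases i) auto
    have "exact_mod (insert x (insert y W)) (Suc j)"
      by (rule exact_mod_insert) (use assms(1) insert j in auto)
    then show ?case by (simp add: j insert_commute)
  qed
  from this[of "V - {y}" i] assms(3-5) show ?thesis by (simp add: insert_absorb)
qed

text \<open>Each variable other than \<open>y\<close> moves the homology up by one position. For
  \<open>V\<close> the set of all variables this relates the socle modulo \<open>y\<close> to the
  last Tor module.\<close>

lemma socle_family_iff:
  assumes "is_complex" "\<And>i. exact_mod {y} i" "finite V" "y \<in> V"
  shows "(\<exists>z. socle_family {y} 0 L z) \<longleftrightarrow> (\<exists>z. socle_family V (card V - 1) L z)"
proof -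
  have "(\<exists>z. socle_family {y} 0 L z) \<longleftrightarrow> (\<exists>z. socle_family (insert y W) (card W) L z)"
    if "finite W" "y \<notin> W" for W
    using that
  proof (induction W)
    case (insert x W)
    have "exact_mod (insert y W) (card W)"
      by (rule exact_mod_superset[where y = y]) (use assms insert in auto)
    then have "(\<exists>z. socle_family (insert y W) (card W) L z) \<longleftrightarrow>
        (\<exists>z. socle_family (insert x (insert y W)) (Suc (card W)) L z)"
      using socle_family_up[OF assms(1), of "insert y W" "card W" x L]
        socle_family_down[OF assms(1), of "insert y W" "card W" x L] insert by auto
    then show ?case using insert by (simp add: insert_commute)
  qed simp
  from this[of "V - {y}"] assms show ?thesis by (simp add: insert_absorb)
qed

end

section \<open>The third Betti number and the socle\<close>

text \<open>Gaussian elimination on the last coordinate. The vectors form a family over an arbitrary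
  index set, since semigroup elements as well as basis positions serve as indices.\<close>

lemma card_le_of_independent:
  fixes a :: "'l \<Rightarrow> nat \<Rightarrow> 'k::field"
  assumes "finite L" "\<And>c. (\<forall>k<N. (\<Sum>l\<in>L. c l * a l k) = 0) \<Longrightarrow> \<forall>l\<in>L. c l = 0"
  shows "card L \<le> N"
  using assms
proof (induction N arbitrary: L a)
  case 0
  have "L = {}" using "0.prems"(2)[of "\<lambda>_. 1"] by auto
  then show ?case by simp
next
  case (Suc N)
  show ?case
  proof (cases "\<forall>l\<in>L. a l N = 0")
    case True
    have "card L \<le> N"
    proof (rule Suc.IH[OF Suc.prems(1)])
      fix c assume "\<forall>k<N. (\<Sum>l\<in>L. c l * a l k) = 0"
      then have "\<forall>k<Suc N. (\<Sum>l\<in>L. c l * a l k) = 0"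
        using True by (auto simp: less_Suc_eq)
      then show "\<forall>l\<in>L. c l = 0" by (rule Suc.prems(2))
    qed
    then show ?thesis by simp
  next
    case False
    then obtain m where m: "m \<in> L" "a m N \<noteq> 0" by blast
    let ?L = "L - {m}" and ?a = "\<lambda>l k. a l k - a l N / a m N * a m k"
    have "card ?L \<le> N"
    proof (rule Suc.IH)
      show "finite ?L" using Suc.prems(1) by simp
      fix c assume c: "\<forall>k<N. (\<Sum>l\<in>?L. c l * ?a l k) = 0"
      \<comment> \<open>This coefficient of the pivot \<open>m\<close> turns a relation among the
        reduced vectors into one among the original vectors.\<close>
      let ?c = "c(m := - (\<Sum>l\<in>?L. c l * a l N / a m N))"
      have sum: "(\<Sum>l\<in>L. ?c l * a l k) = (\<Sum>l\<in>?L. c l * ?a l k)" for k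
      proof -
        have "(\<Sum>l\<in>L. ?c l * a l k) = ?c m * a m k + (\<Sum>l\<in>?L. ?c l * a l k)"
          using Suc.prems(1) m(1) by (rule sum.remove)
        also have "(\<Sum>l\<in>?L. ?c l * a l k) = (\<Sum>l\<in>?L. c l * a l k)"
          by (rule sum.cong) auto
        finally show ?thesis
          by (simp add: right_diff_distrib sum_subtractf sum_distrib_right mult.assoc)
      qed
      have "(\<Sum>l\<in>L. ?c l * a l k) = 0" if "k < Suc N" for k
        using that c m(2) by (subst sum) (auto simp: less_Suc_eq)
      then have c0: "\<forall>l\<in>L. ?c l = 0" using Suc.prems(2) by blast
      have "c l = 0" if "l \<in> ?L" for l
        using c0[rule_format, of l] that by simp
      then show "\<forall>l\<in>?L. c l = 0" by blast
    qed
    then show ?thesis using m(1) Suc.prems(1) by (simp add: card_Diff_singleton)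
  qed
qed

lemma kill_UNIV_eq_iff: "kill UNIV p = kill UNIV q \<longleftrightarrow> lookup p 0 = lookup q 0"
  by (auto simp: kill_UNIV) (metis lookup_single_eq)

text \<open>The ideal \<open>I + (y)\<close>: agreement under \<open>kill {y}\<close> is agreement
  up to a multiple of the variable.\<close>

definition mod_ideal :: "'v \<Rightarrow> ('v, 'k::comm_ring_1) mpoly set \<Rightarrow> ('v, 'k) mpoly set" where
  "mod_ideal y I = {p. \<exists>q\<in>I. kill {y} p = kill {y} q}"

context
  fixes w :: "'v::finite \<Rightarrow> nat" and I :: "('v, 'k::field) mpoly set" and b d e \<Phi> y
  assumes res: "minimal_graded_free_resolution w I b d e \<Phi>"
    and ideal: "is_ideal I"
    and regular: "\<And>p. var y * p \<in> I \<Longrightarrow> p \<in> I"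
begin

abbreviation "dd \<equiv> diff b \<Phi>"

definition augment :: "(nat \<Rightarrow> ('v, 'k) mpoly) \<Rightarrow> ('v, 'k) mpoly" where
  "augment z = (\<Sum>j<b 0. z j * e j)"

lemma augment_scale: "augment (\<lambda>j. p * z j) = p * augment z"
  and augment_minus: "augment (\<lambda>j. z j - z' j) = augment z - augment z'"
  and augment_sum: "augment (\<lambda>j. \<Sum>l\<in>L. f l * g l j) = (\<Sum>l\<in>L. f l * augment (g l))"
  by (simp_all add: augment_def sum_distrib_left sum_distrib_right mult.assoc left_diff_distrib sum_subtractf)
    (rule sum.swap)

lemma augment_surj: "\<exists>z\<in>free_module (b 0). p - augment z \<in> I"
  and augment_ker: "z \<in> free_module (b 0) \<Longrightarrow> augment z \<in> I \<longleftrightarrow> (\<exists>q\<in>free_module (b (Suc 0)). z = dd 0 q)"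
  and res_exact: "v \<in> free_module (b (Suc i)) \<Longrightarrow> dd i v = (\<lambda>_. 0) \<longleftrightarrow> (\<exists>q\<in>free_module (b (Suc (Suc i))). v = dd (Suc i) q)"
  and res_minimal: "k < b i \<Longrightarrow> j < b (Suc i) \<Longrightarrow> lookup (\<Phi> i k j) 0 = 0"
proof -
  note r = res[unfolded minimal_graded_free_resolution_def genideal_range_var, folded augment_def]
  show "\<exists>z\<in>free_module (b 0). p - augment z \<in> I" using r by blast
  have "{v \<in> free_module (b 0). augment v \<in> I} = dd 0 ` free_module (b (Suc 0))"
    using r by (simp only: One_nat_def)
  then show "z \<in> free_module (b 0) \<Longrightarrow> augment z \<in> I \<longleftrightarrow> (\<exists>q\<in>free_module (b (Suc 0)). z = dd 0 q)"
    by blast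
  have "{v \<in> free_module (b (Suc i)). dd i v = (\<lambda>_. 0)} = dd (Suc i) ` free_module (b (Suc (Suc i)))"
    using r by blast
  then show "v \<in> free_module (b (Suc i)) \<Longrightarrow> dd i v = (\<lambda>_. 0) \<longleftrightarrow> (\<exists>q\<in>free_module (b (Suc (Suc i))). v = dd (Suc i) q)"
    by blast
  show "k < b i \<Longrightarrow> j < b (Suc i) \<Longrightarrow> lookup (\<Phi> i k j) 0 = 0"
    using r by blast
qed

lemma augment_diff: "augment (dd 0 q) \<in> I"
proof -
  \<comment> \<open>\<open>q\<close> is an arbitrary function; cutting it off at the rank makes it
    an element of the free module without changing its image.\<close>
  have "dd 0 q = dd 0 (\<lambda>j. if j < b (Suc 0) then q j else 0)"
    by (auto simp: matrix_map_def)
  moreover have "(\<lambda>j. if j < b (Suc 0) then q j else 0) \<in> free_module (b (Suc 0))"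
    by (simp add: free_module_def)
  ultimately have "\<exists>q'\<in>free_module (b (Suc 0)). dd 0 q = dd 0 q'" by blast
  then show ?thesis by (simp only: augment_ker[OF matrix_map_free])
qed

lemma res_complex: "is_complex b \<Phi>"
  unfolding is_complex_def
proof (intro allI)
  fix i and v :: "nat \<Rightarrow> ('v, 'k) mpoly"
  let ?v = "\<lambda>j. if j < b (Suc (Suc i)) then v j else 0"
  have "dd (Suc i) v = dd (Suc i) ?v" by (auto simp: matrix_map_def)
  moreover have "?v \<in> free_module (b (Suc (Suc i)))" by (simp add: free_module_def)
  ultimately have "\<exists>q\<in>free_module (b (Suc (Suc i))). dd (Suc i) v = dd (Suc i) q" by blast
  then show "dd i (dd (Suc i) v) = (\<lambda>_. 0)" by (simp only: res_exact[OF matrix_map_free])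
qed

text \<open>Beyond position one this is the long exact sequence. At position one the homology modulo
  \<open>y\<close> consists of the classes in A/I annihilated by \<open>y\<close>, and regularity
  leaves only zero.\<close>

lemma res_exact_mod_var: "exact_mod b \<Phi> {y} i"
proof (cases i)
  case (Suc j)
  have "exact_mod b \<Phi> {} k" for k
    using res_exact by (auto simp: exact_mod_def boundaries_mod_def)
  then show ?thesis using exact_mod_insert[OF res_complex, of "{}" j y] Suc by simp
next
  case 0
  show ?thesis unfolding 0 exact_mod_def
  proof (intro ballI impI)
    fix v assume v: "v \<in> free_module (b (Suc 0))" "kill_vec {y} (dd 0 v) = (\<lambda>_. 0)"
    then obtain u where u: "u \<in> free_module (b 0)" "dd 0 v = (\<lambda>k. var y * u k)"
      using divide_vec_by_var[of y "{}" "dd 0 v" "b 0"] by (auto simp: matrix_map_free)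
    have "var y * augment u \<in> I" using augment_diff[of v] by (simp add: u augment_scale)
    then have "augment u \<in> I" by (rule regular)
    then obtain q where q: "q \<in> free_module (b (Suc 0))" "u = dd 0 q"
      using augment_ker[OF u(1)] by blast
    have "dd 0 (\<lambda>k. v k - var y * q k) = (\<lambda>_. 0)"
      by (simp add: matrix_map_minus matrix_map_scale u(2) q(2))
    moreover have "(\<lambda>k. v k - var y * q k) \<in> free_module (b (Suc 0))"
      using v q by (intro free_module_minus free_module_scale)
    ultimately obtain r where r: "r \<in> free_module (b (Suc (Suc 0)))" "(\<lambda>k. v k - var y * q k) = dd (Suc 0) r"
      using res_exact by blast
    have "kill_vec {y} v = kill_vec {y} (\<lambda>k. v k - var y * q k)"
      by (simp add: kill_vec_minus kill_vec_var_in)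
    then show "v \<in> boundaries_mod b \<Phi> {y} (Suc 0)"
      using r by (auto simp: boundaries_mod_def)
  qed
qed

text \<open>The homology at position zero modulo \<open>y\<close> is A/(I + (y)): a multiple of
  \<open>y\<close> is absorbed by lifting its cofactor through the augmentation.\<close>

lemma boundaries_mod_iff_augment:
  assumes z: "z \<in> free_module (b 0)"
  shows "z \<in> boundaries_mod b \<Phi> {y} 0 \<longleftrightarrow> augment z \<in> mod_ideal y I"
proof
  assume "z \<in> boundaries_mod b \<Phi> {y} 0"
  then obtain q where q: "kill_vec {y} z = kill_vec {y} (dd 0 q)" by (auto simp: boundaries_mod_def)
  have "kill {y} (augment z) = kill {y} (augment (dd 0 q))"
    using q by (simp add: augment_def kill_sum kill_mult kill_vec_def fun_eq_iff)
  then show "augment z \<in> mod_ideal y I" using augment_diff by (auto simp: mod_ideal_def)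
next
  assume "augment z \<in> mod_ideal y I"
  then obtain p where p: "p \<in> I" "kill {y} (augment z) = kill {y} p" by (auto simp: mod_ideal_def)
  obtain r where r: "augment z = p + var y * r" using kill_eq_var_split[OF p(2)] by blast
  obtain u where u: "u \<in> free_module (b 0)" "r - augment u \<in> I" using augment_surj by blast
  have "augment (\<lambda>j. z j - var y * u j) = p + var y * (r - augment u)"
    by (simp add: augment_minus augment_scale r algebra_simps)
  then have "augment (\<lambda>j. z j - var y * u j) \<in> I"
    using is_idealD[OF ideal] p(1) u(2) by simp
  moreover have "(\<lambda>j. z j - var y * u j) \<in> free_module (b 0)"
    using z u by (intro free_module_minus free_module_scale)
  ultimately obtain q where q: "q \<in> free_module (b (Suc 0))" "(\<lambda>j. z j - var y * u j) = dd 0 q"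
    using augment_ker by blast
  have "kill_vec {y} z = kill_vec {y} (\<lambda>k. z k - var y * u k)"
    by (simp add: kill_vec_minus kill_vec_var_in)
  then show "z \<in> boundaries_mod b \<Phi> {y} 0"
    using q by (auto simp: boundaries_mod_def)
qed

text \<open>By minimality all differentials vanish once every variable is zero, so constant terms
  are coordinates on the homology.\<close>

lemma boundaries_mod_UNIV:
  assumes v: "v \<in> free_module (b i)"
  shows "v \<in> boundaries_mod b \<Phi> UNIV i \<longleftrightarrow> (\<forall>k<b i. lookup (v k) 0 = 0)"
proof -
  have "kill_vec UNIV (dd i q) = (\<lambda>_. 0)" for q
  proof
    fix k
    have "lookup (dd i q k) 0 = 0"
      by (simp add: matrix_map_def lookup_sum lookup_mult_zero res_minimal)
    then show "kill_vec UNIV (dd i q) k = 0"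
      using kill_UNIV_eq_iff[of _ 0] by (simp add: kill_vec_def kill_UNIV)
  qed
  then have "v \<in> boundaries_mod b \<Phi> UNIV i \<longleftrightarrow> kill_vec UNIV v = (\<lambda>_. 0)"
    unfolding boundaries_mod_def by (auto intro: exI[of _ "\<lambda>_. 0"])
  also have "\<dots> \<longleftrightarrow> (\<forall>k. lookup (v k) 0 = 0)"
    using kill_UNIV_eq_iff[of _ 0] by (auto simp: kill_vec_def fun_eq_iff)
  also have "\<dots> \<longleftrightarrow> (\<forall>k<b i. lookup (v k) 0 = 0)"
    using v by (auto simp: free_module_def) (metis lookup_zero not_le)
  finally show ?thesis .
qed

text \<open>Every polynomial is an augmentation up to \<open>I\<close>, so families of vectors and
  families of polynomials can be exchanged.\<close>

lemma socle_family_base: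
  "(\<exists>z. socle_family b \<Phi> {y} 0 L z) \<longleftrightarrow>
   (\<exists>u. (\<forall>l\<in>L. \<forall>x. x \<noteq> y \<longrightarrow> var x * u l \<in> mod_ideal y I) \<and>
        (\<forall>c. (\<Sum>l\<in>L. single 0 (c l) * u l) \<in> mod_ideal y I \<longrightarrow> (\<forall>l\<in>L. c l = 0)))"
  (is "_ \<longleftrightarrow> (\<exists>u. ?S u)")
proof
  assume "\<exists>z. socle_family b \<Phi> {y} 0 L z"
  then obtain z where z: "\<forall>l\<in>L. z l \<in> free_module (b 0)"
    "\<forall>l\<in>L. \<forall>x. x \<notin> {y} \<longrightarrow> (\<lambda>k. var x * z l k) \<in> boundaries_mod b \<Phi> {y} 0"
    "\<forall>c. (\<lambda>k. \<Sum>l\<in>L. single 0 (c l) * z l k) \<in> boundaries_mod b \<Phi> {y} 0 \<longrightarrow> (\<forall>l\<in>L. c l = 0)"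
    unfolding socle_family_def by blast
  have "(\<lambda>k. \<Sum>l\<in>L. single 0 (c l) * z l k) \<in> free_module (b 0)" for c
    using z(1) by (intro free_module_sum) auto
  then have "?S (\<lambda>l. augment (z l))"
    using z by (auto simp: boundaries_mod_iff_augment free_module_scale augment_scale augment_sum)
  then show "\<exists>u. ?S u" by (intro exI[of _ "\<lambda>l. augment (z l)"])
next
  assume "\<exists>u. ?S u"
  then obtain u where u: "?S u" by blast
  obtain z where z: "\<And>l. z l \<in> free_module (b 0)" "\<And>l. u l - augment (z l) \<in> I"
  proof -
    have "\<forall>l. \<exists>z. z \<in> free_module (b 0) \<and> u l - augment z \<in> I" using augment_surj by blast
    then show ?thesis using that choice[of "\<lambda>l z. z \<in> free_module (b 0) \<and> u l - augment z \<in> I"] by blast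
  qed
  have diff_mem: "p \<in> mod_ideal y I \<longleftrightarrow> q \<in> mod_ideal y I" if "p - q \<in> I" for p q
  proof -
    have *: "p' \<in> mod_ideal y I \<Longrightarrow> q' \<in> mod_ideal y I" if d: "q' - p' \<in> I" for p' q'
    proof -
      assume "p' \<in> mod_ideal y I"
      then obtain r where r: "r \<in> I" "kill {y} p' = kill {y} r" by (auto simp: mod_ideal_def)
      have "kill {y} q' = kill {y} (r + (q' - p'))" using r by (simp add: kill_add kill_minus)
      moreover have "r + (q' - p') \<in> I" using is_idealD[OF ideal] r d by blast
      ultimately show "q' \<in> mod_ideal y I" unfolding mod_ideal_def by blast
    qed
    have "q - p \<in> I" using is_idealD(4)[OF ideal that] by simp
    then show ?thesis using *[OF that] *[of q p] by blast
  qed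
  have "var x * u l \<in> mod_ideal y I \<longleftrightarrow> var x * augment (z l) \<in> mod_ideal y I" for x l
    using is_idealD(3)[OF ideal z(2)[of l], of "var x"] by (intro diff_mem) (simp add: right_diff_distrib)
  moreover have "(\<Sum>l\<in>L. single 0 (c l) * u l) \<in> mod_ideal y I \<longleftrightarrow>
      (\<Sum>l\<in>L. single 0 (c l) * augment (z l)) \<in> mod_ideal y I" for c
  proof (rule diff_mem)
    have "(\<Sum>l\<in>L. single 0 (c l) * (u l - augment (z l))) \<in> I"
      by (intro is_ideal_sum[OF ideal] is_idealD(3)[OF ideal] z(2))
    then show "(\<Sum>l\<in>L. single 0 (c l) * u l) - (\<Sum>l\<in>L. single 0 (c l) * augment (z l)) \<in> I"
      by (simp add: right_diff_distrib sum_subtractf)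
  qed
  moreover have "(\<lambda>k. \<Sum>l\<in>L. single 0 (c l) * z l k) \<in> free_module (b 0)" for c
    using z(1) by (intro free_module_sum) auto
  ultimately have "socle_family b \<Phi> {y} 0 L z"
    using u unfolding socle_family_def
    by (auto simp: boundaries_mod_iff_augment free_module_scale augment_scale augment_sum z(1))
  then show "\<exists>z. socle_family b \<Phi> {y} 0 L z" by blast
qed

text \<open>With all variables zero the homology is a vector space of dimension \<open>b i\<close>
  and the socle condition is void; the unit vectors attain the bound.\<close>

lemma socle_family_top:
  "(\<exists>z. socle_family b \<Phi> UNIV i (L :: 'l set) z) \<Longrightarrow> finite L \<Longrightarrow> card L \<le> b i"
  "\<exists>z. socle_family b \<Phi> UNIV i {..<b i} z"
proof -
  assume "\<exists>z. socle_family b \<Phi> UNIV i L z" and L: "finite L"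
  then obtain z where z: "\<forall>l\<in>L. z l \<in> free_module (b i)"
    "\<forall>c. (\<lambda>k. \<Sum>l\<in>L. single 0 (c l) * z l k) \<in> boundaries_mod b \<Phi> UNIV i \<longrightarrow> (\<forall>l\<in>L. c l = 0)"
    unfolding socle_family_def by blast
  show "card L \<le> b i"
  proof (rule card_le_of_independent[OF L, where a = "\<lambda>l k. lookup (z l k) 0"])
    fix c assume c: "\<forall>k<b i. (\<Sum>l\<in>L. c l * lookup (z l k) 0) = 0"
    have "(\<lambda>k. \<Sum>l\<in>L. single 0 (c l) * z l k) \<in> free_module (b i)"
      using z(1) by (intro free_module_sum) auto
    then have "(\<lambda>k. \<Sum>l\<in>L. single 0 (c l) * z l k) \<in> boundaries_mod b \<Phi> UNIV i"
      using c by (simp add: boundaries_mod_UNIV lookup_sum lookup_mult_zero)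
    then show "\<forall>l\<in>L. c l = 0" using z(2) by blast
  qed
next
  let ?z = "\<lambda>l k. if k = l then 1 else 0 :: ('v, 'k) mpoly"
  have free: "?z l \<in> free_module (b i)" if "l < b i" for l
    using that by (auto simp: free_module_def)
  have "kill_vec UNIV (dd j (?z l)) = (\<lambda>_. 0)" if "l < b (Suc j)" for l j
  proof
    fix k
    have "lookup (dd j (?z l) k) 0 = 0"
      using that by (simp add: matrix_map_def lookup_sum lookup_mult_zero res_minimal)
    then show "kill_vec UNIV (dd j (?z l)) k = 0"
      using kill_UNIV_eq_iff[of _ 0] by (simp add: kill_vec_def kill_UNIV)
  qed
  moreover have "\<forall>l\<in>{..<b i}. c l = 0"
    if c: "(\<lambda>k. \<Sum>l\<in>{..<b i}. single 0 (c l) * ?z l k) \<in> boundaries_mod b \<Phi> UNIV i" for c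
  proof -
    have "(\<lambda>k. \<Sum>l\<in>{..<b i}. single 0 (c l) * ?z l k) \<in> free_module (b i)"
      using free by (intro free_module_sum) auto
    then have "\<forall>k<b i. lookup (\<Sum>l\<in>{..<b i}. single 0 (c l) * ?z l k) 0 = 0"
      using c boundaries_mod_UNIV by blast
    then show ?thesis
      by (auto simp: lookup_sum lookup_mult_zero lookup_one if_distrib[of "\<lambda>p. lookup p 0"] if_distrib[of "(*) _"] cong: if_cong)
  qed
  ultimately have "socle_family b \<Phi> UNIV i {..<b i} ?z"
    using free unfolding socle_family_def by auto
  then show "\<exists>z. socle_family b \<Phi> UNIV i {..<b i} z" by blast
qed

text \<open>A socle family modulo \<open>y\<close> bounds the last rank from below;
  \<open>socle_of_betti_size\<close> provides a family of exactly that size. The index is one less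
  than the number of variables because the count starts at position zero with \<open>y\<close>
  already set to zero.\<close>

lemma card_socle_le_betti:
  assumes "finite L"
    and "\<And>l x. l \<in> L \<Longrightarrow> x \<noteq> y \<Longrightarrow> var x * u l \<in> mod_ideal y I"
    and "\<And>c. (\<Sum>l\<in>L. single 0 (c l) * u l) \<in> mod_ideal y I \<Longrightarrow> \<forall>l\<in>L. c l = 0"
  shows "card L \<le> b (CARD('v) - 1)"
proof (rule socle_family_top(1)[OF _ assms(1)])
  have "\<exists>z. socle_family b \<Phi> {y} 0 L z" unfolding socle_family_base using assms(2,3) by blast
  then show "\<exists>z. socle_family b \<Phi> UNIV (CARD('v) - 1) L z"
    using socle_family_iff[OF res_complex res_exact_mod_var, of UNIV L] by simp
qed

lemma socle_of_betti_size:
  obtains u where "\<And>l x. l < b (CARD('v) - 1) \<Longrightarrow> x \<noteq> y \<Longrightarrow> var x * u l \<in> mod_ideal y I"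
    and "\<And>c. (\<Sum>l<b (CARD('v) - 1). single 0 (c l) * u l) \<in> mod_ideal y I \<Longrightarrow> \<forall>l<b (CARD('v) - 1). c l = 0"
proof -
  have "\<exists>z. socle_family b \<Phi> {y} 0 {..<b (CARD('v) - 1)} z"
    by (rule iffD2[OF socle_family_iff[OF res_complex res_exact_mod_var, of UNIV] socle_family_top(2)]) simp_all
  then show ?thesis unfolding socle_family_base using that by (auto simp: Ball_def)
qed

end

section \<open>Transfer of resolutions along a regular variable\<close>

text \<open>Iterating the hypothesis expresses \<open>v\<close> modulo arbitrarily high powers of the variable \<open>y\<close>;
  these disappear after truncation to the finitely many degrees that occur in \<open>v\<close>.\<close>

lemma graded_nakayama:
  fixes w :: "'v::finite \<Rightarrow> nat" and \<Phi> :: "nat \<Rightarrow> nat \<Rightarrow> ('v, 'k::comm_ring_1) mpoly"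
  assumes pos: "w y > 0"
    and graded: "\<And>k j. k < r \<Longrightarrow> j < c \<Longrightarrow> homogeneous_poly w (d' j - d k) (\<Phi> k j)"
    and Z: "Z \<subseteq> free_module r"
    and step: "\<And>v. v \<in> Z \<Longrightarrow> \<exists>q\<in>free_module c. \<exists>v'\<in>Z. v = (\<lambda>k. matrix_map r c \<Phi> q k + var y * v' k)"
    and v: "v \<in> Z"
  shows "\<exists>q\<in>free_module c. v = matrix_map r c \<Phi> q"
proof -
  have iter: "\<exists>q\<in>free_module c. \<exists>v'\<in>Z. u = (\<lambda>k. matrix_map r c \<Phi> q k + var y ^ N * v' k)" if "u \<in> Z" for u N
    using that
  proof (induction N arbitrary: u)
    case 0
    have "u = (\<lambda>k. matrix_map r c \<Phi> (\<lambda>_. 0) k + var y ^ 0 * u k)" by simp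
    then show ?case using 0 free_module_zero by blast
  next
    case (Suc N)
    obtain q u' where q: "q \<in> free_module c" "u' \<in> Z" "u = (\<lambda>k. matrix_map r c \<Phi> q k + var y * u' k)"
      using step[OF Suc.prems] by blast
    obtain q' v' where q': "q' \<in> free_module c" "v' \<in> Z" "u' = (\<lambda>k. matrix_map r c \<Phi> q' k + var y ^ N * v' k)"
      using Suc.IH[OF q(2)] by blast
    have "u = (\<lambda>k. matrix_map r c \<Phi> (\<lambda>k. q k + var y * q' k) k + var y ^ Suc N * v' k)"
      by (simp add: q(3) q'(3) matrix_map_add matrix_map_scale algebra_simps)
    moreover have "(\<lambda>k. q k + var y * q' k) \<in> free_module c"
      using q(1) q'(1) by (simp add: free_module_def)
    ultimately show ?case using q'(2) by blast
  qed
  \<comment> \<open>\<open>D\<close> bounds degree plus shift over all monomials of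
    \<open>v\<close>. With \<open>N\<close> below, every monomial of \<open>y^N * v'\<close> in row
    \<open>k\<close> has degree above \<open>D - d k\<close>, so truncation removes that
    term.\<close>
  define D where "D = (\<Sum>k<r. \<bar>d k\<bar> + (\<Sum>m\<in>keys (v k). int (wdegree w m)))"
  have D: "int (wdegree w m) \<le> D - d k" if "k < r" "m \<in> keys (v k)" for k m
  proof -
    have "int (wdegree w m) \<le> (\<Sum>m\<in>keys (v k). int (wdegree w m))"
      by (rule member_le_sum) (use that in auto)
    moreover have "\<bar>d k\<bar> + (\<Sum>m\<in>keys (v k). int (wdegree w m)) \<le> D"
      unfolding D_def by (rule member_le_sum) (use that in \<open>auto intro!: add_nonneg_nonneg sum_nonneg\<close>)
    ultimately show ?thesis by linarith
  qed
  define N where "N = nat (D + (\<Sum>k<r. \<bar>d k\<bar>)) + 1"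
  have N: "int N > D - d k" if "k < r" for k
  proof -
    have "\<bar>d k\<bar> \<le> (\<Sum>k<r. \<bar>d k\<bar>)" by (rule member_le_sum) (use that in auto)
    then show ?thesis unfolding N_def by linarith
  qed
  obtain q v' where q: "q \<in> free_module c" "v' \<in> Z" "v = (\<lambda>k. matrix_map r c \<Phi> q k + var y ^ N * v' k)"
    using iter[OF v] by blast
  let ?T = "\<lambda>s. keep {m. int (wdegree w m) \<le> s}"
  let ?q = "\<lambda>j. ?T (D - d' j) (q j)"
  have "v k = matrix_map r c \<Phi> ?q k" for k
  proof (cases "k < r")
    case True
    have yN: "var y ^ N = mon (single y N)"
      by (induction N) (simp_all add: var_mon mon_mult flip: single_add)
    have "v k = ?T (D - d k) (v k)"
      using D[OF True] by (subst keep_eq_self_iff[THEN iffD2]) auto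
    also have "\<dots> = ?T (D - d k) (matrix_map r c \<Phi> q k) + ?T (D - d k) (mon (single y N) * v' k)"
      by (subst q(3)) (simp add: keep_add yN)
    also have "?T (D - d k) (mon (single y N) * v' k) = 0"
    proof -
      have "D - d k < int (N * w y + wdegree w m)" for m
        using N[OF True] pos by (smt (verit) mult_le_mono2 nat_mult_1_right of_nat_le_iff One_nat_def Suc_leI le_add1 le_trans)
      then have "\<not> int (wdegree w (single y N + m)) \<le> D - d k" for m
        by (simp add: wdegree_add not_le)
      then show ?thesis by (auto simp: keep_eq_0_iff keys_mon_mult)
    qed
    also have "?T (D - d k) (matrix_map r c \<Phi> q k) = matrix_map r c \<Phi> ?q k"
    proof -
      have "?T (D - d k) (\<Phi> k j * q j) = \<Phi> k j * ?q j" if "j < c" for j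
        using keep_le_homogeneous_mult[OF graded[OF True that], of "D - d k" "q j"] by simp
      then show ?thesis using True by (simp add: matrix_map_def keep_sum)
    qed
    finally show ?thesis by simp
  next
    case False
    then show ?thesis using Z v by (auto simp: free_module_def matrix_map_def)
  qed
  moreover have "?q \<in> free_module c" using q(1) by (simp add: free_module_def)
  ultimately show ?thesis by blast
qed

text \<open>By exactness of \<open>\<Phi>\<close>, an element of a kernel of \<open>\<Psi>\<close>
  agrees modulo \<open>y\<close> with a boundary. The difference is \<open>y\<close> times a vector
  that again lies in the kernel, as \<open>y\<close> can be cancelled;
  \<open>graded_nakayama\<close> then removes the error. For the ideal itself the cancellation is
  the regularity of \<open>y\<close>.\<close>

lemma resolution_transfer:
  fixes w :: "'v::finite \<Rightarrow> nat" and I :: "('v, 'k::field) mpoly set"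
  assumes ideal: "is_ideal I" and pos: "w y > 0"
    and regular: "\<And>p. var y * p \<in> I \<Longrightarrow> p \<in> I"
    and exact: "\<And>i. exact_mod b \<Phi> {y} i"
    and cover: "\<And>p. p \<in> I \<Longrightarrow> \<exists>q\<in>free_module (b (Suc 0)). kill {y} p = kill {y} (matrix_map (b 0) (b (Suc 0)) (\<Phi> 0) q 0)"
    and congruent: "\<And>i k j. k < b i \<Longrightarrow> j < b (Suc i) \<Longrightarrow> kill {y} (\<Psi> i k j) = kill {y} (\<Phi> i k j)"
    and "complex": "is_complex b \<Psi>"
    and gens: "\<And>j. j < b (Suc 0) \<Longrightarrow> \<Psi> 0 0 j \<in> I"
    and b0: "b 0 = 1" and d0: "d 0 0 = 0"
    and graded: "\<And>i k j. k < b i \<Longrightarrow> j < b (Suc i) \<Longrightarrow> homogeneous_poly w (d (Suc i) j - d i k) (\<Psi> i k j)"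
    and minimal: "\<And>i k j. k < b i \<Longrightarrow> j < b (Suc i) \<Longrightarrow> lookup (\<Psi> i k j) 0 = 0"
  shows "minimal_graded_free_resolution w I b d (\<lambda>_. 1) \<Psi>"
proof -
  let ?D = "\<lambda>i. matrix_map (b i) (b (Suc i)) (\<Psi> i)" and ?E = "\<lambda>i. matrix_map (b i) (b (Suc i)) (\<Phi> i)"
  have cong: "kill_vec {y} (?D i v) = kill_vec {y} (?E i v)" for i v
    by (auto simp: kill_vec_def matrix_map_def kill_sum kill_mult congruent intro!: sum.cong)
  have split: "\<exists>u. v = (\<lambda>k. v' k + var y * u k) \<and> u \<in> free_module r"
    if vf: "v \<in> free_module r" "v' \<in> free_module r" and vk: "kill_vec {y} v = kill_vec {y} v'" for v v' :: "nat \<Rightarrow> ('v, 'k) mpoly" and r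
  proof -
    have "kill_vec (insert y {}) (\<lambda>k. v k - v' k) = (\<lambda>_. 0)" using vk by (simp add: kill_vec_minus)
    from divide_vec_by_var[OF _ free_module_minus[OF vf] this]
    obtain u where "u \<in> free_module r" "(\<lambda>k. v k - v' k) = (\<lambda>k. var y * u k)" by auto
    then show ?thesis by (intro exI[of _ u]) (auto simp: fun_eq_iff algebra_simps)
  qed
  have exact': "\<exists>q\<in>free_module (b (Suc (Suc i))). v = ?D (Suc i) q"
    if v: "v \<in> free_module (b (Suc i))" "?D i v = (\<lambda>_. 0)" for i v
  proof (rule graded_nakayama[where w = w and y = y and d = "d (Suc i)" and d' = "d (Suc (Suc i))"
        and Z = "{v \<in> free_module (b (Suc i)). ?D i v = (\<lambda>_. 0)}"])
    fix v assume "v \<in> {v \<in> free_module (b (Suc i)). ?D i v = (\<lambda>_. 0)}"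
    then have v: "v \<in> free_module (b (Suc i))" "?D i v = (\<lambda>_. 0)" by auto
    have "kill_vec {y} (?E i v) = (\<lambda>_. 0)" using v(2) cong[of i v] by simp
    then obtain q where q: "q \<in> free_module (b (Suc (Suc i)))" "kill_vec {y} v = kill_vec {y} (?D (Suc i) q)"
      using exact[of i] v(1) by (auto simp: exact_mod_def boundaries_mod_def cong)
    then obtain u where u: "v = (\<lambda>k. ?D (Suc i) q k + var y * u k)" "u \<in> free_module (b (Suc i))"
      using split[OF v(1) matrix_map_free q(2)] by blast
    have "(\<lambda>k. var y * ?D i u k) = ?D i v"
      using "complex" by (subst u(1)) (simp add: matrix_map_add matrix_map_scale is_complex_def)
    also have "\<dots> = (\<lambda>k. var y * 0)" using v(2) by simp
    finally have "?D i u = (\<lambda>_. 0)" by (rule var_cancel_vec)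
    then show "\<exists>q\<in>free_module (b (Suc (Suc i))). \<exists>v'\<in>{v \<in> free_module (b (Suc i)). ?D i v = (\<lambda>_. 0)}.
        v = (\<lambda>k. ?D (Suc i) q k + var y * v' k)"
      using q(1) u by blast
  qed (use pos graded v in auto)
  have gens': "?D 0 q 0 \<in> I" for q
    using gens b0 by (auto simp: matrix_map_def mult.commute[of "\<Psi> _ _ _"] intro!: is_ideal_sum[OF ideal] is_idealD(3)[OF ideal])
  have exact0: "\<exists>q\<in>free_module (b (Suc 0)). v = ?D 0 q" if v: "v \<in> free_module (b 0)" "v 0 \<in> I" for v
  proof (rule graded_nakayama[where w = w and y = y and d = "d 0" and d' = "d (Suc 0)"
        and Z = "{v \<in> free_module (b 0). v 0 \<in> I}"])
    fix v assume "v \<in> {v \<in> free_module (b 0). v 0 \<in> I}"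
    then have v: "v \<in> free_module (b 0)" "v 0 \<in> I" by auto
    obtain q where q: "q \<in> free_module (b (Suc 0))" "kill {y} (v 0) = kill {y} (?E 0 q 0)"
      using cover[OF v(2)] by blast
    have "kill_vec {y} v k = kill_vec {y} (?D 0 q) k" for k
      using q(2) v(1) b0 cong[of 0 q]
      by (cases "k = 0") (auto simp: kill_vec_def free_module_def matrix_map_def fun_eq_iff)
    then have "kill_vec {y} v = kill_vec {y} (?D 0 q)" by blast
    then obtain u where u: "v = (\<lambda>k. ?D 0 q k + var y * u k)" "u \<in> free_module (b 0)"
      using split[OF v(1) matrix_map_free] by blast
    have "var y * u 0 = v 0 - ?D 0 q 0" by (subst u(1)) simp
    then have "var y * u 0 \<in> I" using is_idealD(5)[OF ideal v(2) gens'] by simp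
    then have "u 0 \<in> I" by (rule regular)
    then show "\<exists>q\<in>free_module (b (Suc 0)). \<exists>v'\<in>{v \<in> free_module (b 0). v 0 \<in> I}.
        v = (\<lambda>k. ?D 0 q k + var y * v' k)"
      using q(1) u by blast
  qed (use pos graded v in auto)
  have b0': "{..<b 0} = {0}" using b0 by auto
  show ?thesis
    unfolding minimal_graded_free_resolution_def genideal_range_var
  proof (intro conjI allI impI)
    show "homogeneous_poly w (d 0 j) 1" if "j < b 0" for j
      using that b0 d0 by (auto simp: homogeneous_poly_def)
    show "\<exists>v\<in>free_module (b 0). p - (\<Sum>j<b 0. v j * 1) \<in> I" for p
      by (rule bexI[of _ "\<lambda>j. if j = 0 then p else 0"])
        (use b0 is_idealD(1)[OF ideal] in \<open>auto simp: free_module_def b0'\<close>)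
    show "{v \<in> free_module (b 0). (\<Sum>j<b 0. v j * 1) \<in> I} = matrix_map (b 0) (b 1) (\<Psi> 0) ` free_module (b 1)"
      using exact0 gens' by (auto simp: b0' matrix_map_free)
    show "{v \<in> free_module (b (Suc i)). ?D i v = (\<lambda>_. 0)} = ?D (Suc i) ` free_module (b (Suc (Suc i)))" for i
      using exact' "complex" by (auto simp: matrix_map_free is_complex_def)
  qed (use graded minimal in auto)
qed

section \<open>Factorizations\<close>

abbreviation len :: "('v::finite \<Rightarrow>\<^sub>0 nat) \<Rightarrow> nat" where
  "len \<equiv> wdegree standard_weight"

definition deg_class :: "('v::finite \<Rightarrow> nat) \<Rightarrow> nat \<Rightarrow> ('v \<Rightarrow>\<^sub>0 nat) set" where
  "deg_class n s = {m. wdegree n m = s}"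

text \<open>The length of a tight factorization of \<open>s\<close> is the order of
  \<open>t^s\<close> in the filtration by the powers of the maximal ideal.\<close>

definition tight :: "('v::finite \<Rightarrow> nat) \<Rightarrow> ('v \<Rightarrow>\<^sub>0 nat) \<Rightarrow> bool" where
  "tight n m \<longleftrightarrow> (\<forall>m'. wdegree n m' = wdegree n m \<longrightarrow> len m' \<le> len m)"

definition max_class :: "('v::finite \<Rightarrow> nat) \<Rightarrow> nat \<Rightarrow> ('v \<Rightarrow>\<^sub>0 nat) set" where
  "max_class n s = {m. wdegree n m = s \<and> tight n m}"

definition apery_mon :: "('v::finite \<Rightarrow> nat) \<Rightarrow> 'v \<Rightarrow> ('v \<Rightarrow>\<^sub>0 nat) \<Rightarrow> bool" where
  "apery_mon n i m \<longleftrightarrow> (\<forall>m'. wdegree n m' = wdegree n m \<longrightarrow> lookup m' i = 0)"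

lemma ex_exponent: "\<exists>m :: 'v::finite \<Rightarrow>\<^sub>0 nat. lookup m = u"
  using lookup_Abs_poly_mapping[of u] finite_code by blast

lemma ex_exponent_iff: "(\<exists>u. P u) \<longleftrightarrow> (\<exists>m :: 'v::finite \<Rightarrow>\<^sub>0 nat. P (lookup m))"
proof
  assume "\<exists>u. P u"
  then obtain u where u: "P u" ..
  obtain m :: "'v \<Rightarrow>\<^sub>0 nat" where "lookup m = u" using ex_exponent by blast
  with u show "\<exists>m :: 'v \<Rightarrow>\<^sub>0 nat. P (lookup m)" by blast
qed blast

lemma semigroup_of_eq: "semigroup_of n = range (wdegree n)"
proof -
  have "semigroup_of n = {s. \<exists>m. s = wdegree n m}"
    unfolding semigroup_on_def wdegree_def by (subst ex_exponent_iff) (rule refl)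
  then show ?thesis by blast
qed

lemma lengths_eq: "lengths n s = len ` deg_class n s"
proof -
  have "lengths n s = {l. \<exists>m. s = wdegree n m \<and> l = len m}"
    unfolding lengths_def wdegree_def mult_1_right by (subst ex_exponent_iff) (rule refl)
  then show ?thesis by (auto simp: deg_class_def)
qed

lemma tight_cong: "wdegree n m = wdegree n m' \<Longrightarrow> tight n m \<Longrightarrow> len m' = len m \<Longrightarrow> tight n m'"
  by (simp add: tight_def)

lemma tight_len_eq: "wdegree n m = wdegree n m' \<Longrightarrow> tight n m \<Longrightarrow> tight n m' \<Longrightarrow> len m = len m'"
  by (simp add: tight_def antisym)

lemma apery_mon_cong: "wdegree n m = wdegree n m' \<Longrightarrow> apery_mon n i m \<Longrightarrow> apery_mon n i m'"
  by (simp add: apery_mon_def)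

lemma exponent_split: "lookup m i \<noteq> 0 \<Longrightarrow> \<exists>r :: 'v \<Rightarrow>\<^sub>0 nat. m = single i 1 + r"
  by (rule exI[of _ "m - single i 1"], rule poly_mapping_eqI)
    (auto simp: lookup_add lookup_minus lookup_single when_def)

lemma not_apery_mon: "\<not> apery_mon n i m \<longleftrightarrow> (\<exists>r. wdegree n (single i 1 + r) = wdegree n m)"
proof
  assume "\<not> apery_mon n i m"
  then show "\<exists>r. wdegree n (single i 1 + r) = wdegree n m"
    unfolding apery_mon_def using exponent_split by metis
next
  assume "\<exists>r. wdegree n (single i 1 + r) = wdegree n m"
  then show "\<not> apery_mon n i m"
    unfolding apery_mon_def by (metis add_eq_0_iff_both_eq_0 lookup_add lookup_single_eq one_neq_zero)
qed

lemma apery_mon_add_iff: "wdegree n m = wdegree n m' \<Longrightarrow> apery_mon n i (m + r) \<longleftrightarrow> apery_mon n i (m' + r)"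
  by (simp add: apery_mon_def wdegree_add)

lemma apery_set_eq: "apery_set (semigroup_of n) (n i) = wdegree n ` {m. apery_mon n i m}"
proof -
  have "int (wdegree n m) - int (n i) \<in> int ` range (wdegree n) \<longleftrightarrow> \<not> apery_mon n i m" for m
  proof -
    have "int (wdegree n m) - int (n i) = int s \<longleftrightarrow> n i + s = wdegree n m" for s by linarith
    then have "int (wdegree n m) - int (n i) \<in> int ` range (wdegree n) \<longleftrightarrow> (\<exists>r. n i + wdegree n r = wdegree n m)"
      by (auto simp: image_iff)
    then show ?thesis by (simp add: not_apery_mon wdegree_add)
  qed
  then show ?thesis unfolding apery_set_def semigroup_of_eq by auto
qed

text \<open>If \<open>n i\<close> is the multiplicity, the variable \<open>i\<close> is a parameter of the tangent cone; the condition says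
  that it is a nonzerodivisor.\<close>

definition param_regular :: "('v::finite \<Rightarrow> nat) \<Rightarrow> 'v \<Rightarrow> bool" where
  "param_regular n i \<longleftrightarrow> (\<forall>m. tight n m \<longrightarrow> tight n (single i 1 + m))"

locale positive_weights =
  fixes n :: "'v::finite \<Rightarrow> nat"
  assumes pos: "n i > 0"
begin

lemma len_le_wdegree: "len m \<le> wdegree n m"
proof -
  have "lookup m i * 1 \<le> lookup m i * n i" for i
    using pos[of i] by (intro mult_le_mono2) simp
  then show ?thesis unfolding wdegree_def by (intro sum_mono) simp
qed

lemma ex_tight: "\<exists>m'. wdegree n m' = wdegree n m \<and> tight n m'"
proof -
  have "\<exists>m'. wdegree n m' = wdegree n m \<and> (\<forall>y. wdegree n y = wdegree n m \<longrightarrow> len y \<le> len m')"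
  proof (rule ex_has_greatest_nat[where b = "Suc (wdegree n m)"])
    show "\<forall>y. wdegree n y = wdegree n m \<longrightarrow> len y < Suc (wdegree n m)"
      using len_le_wdegree by (auto simp: less_Suc_eq_le simp del: One_nat_def) metis
  qed (rule refl)
  then show ?thesis by (auto simp: tight_def)
qed

lemma wdegree_eq_0_iff: "wdegree n m = 0 \<longleftrightarrow> m = 0"
proof
  assume "wdegree n m = 0"
  then have "lookup m i * n i = 0" for i by (simp add: wdegree_def)
  then have "lookup m i = 0" for i using pos[of i] by (metis mult_is_0 not_less_zero)
  then show "m = 0" by (intro poly_mapping_eqI) simp
qed simp

text \<open>A longer factorization of the summand would lengthen the sum.\<close>

lemma tight_add_right: "tight n (m + m') \<Longrightarrow> tight n m'"
  unfolding tight_def by (metis (no_types, lifting) wdegree_add nat_add_left_cancel_le)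

lemma homogeneous_semigroup_iff:
  assumes i: "n i = Min (range n)"
  shows "homogeneous_semigroup n \<longleftrightarrow>
    (\<forall>m m'. apery_mon n i m \<longrightarrow> wdegree n m' = wdegree n m \<longrightarrow> len m' = len m)"
proof -
  have "homogeneous_semigroup n \<longleftrightarrow>
      (\<forall>m. apery_mon n i m \<longrightarrow> wdegree n m \<noteq> 0 \<longrightarrow> is_singleton (len ` deg_class n (wdegree n m)))"
    unfolding homogeneous_semigroup_def homogeneous_subset_def i[symmetric] apery_set_eq lengths_eq by auto
  also have "\<dots> \<longleftrightarrow> (\<forall>m. apery_mon n i m \<longrightarrow> (\<forall>m'. wdegree n m' = wdegree n m \<longrightarrow> len m' = len m))"
  proof -
    have "(wdegree n m \<noteq> 0 \<longrightarrow> is_singleton (len ` deg_class n (wdegree n m))) \<longleftrightarrow>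
        (\<forall>m'. wdegree n m' = wdegree n m \<longrightarrow> len m' = len m)" for m
    proof (cases "wdegree n m = 0")
      case True
      then show ?thesis by (simp add: wdegree_eq_0_iff)
    next
      case False
      have "is_singleton (len ` deg_class n (wdegree n m)) \<longleftrightarrow> len ` deg_class n (wdegree n m) = {len m}"
      proof -
        have "len m \<in> len ` deg_class n (wdegree n m)" by (simp add: deg_class_def)
        then show ?thesis by (metis is_singleton_def singletonD)
      qed
      then show ?thesis using False by (auto simp: deg_class_def)
    qed
    then show ?thesis by simp
  qed
  finally show ?thesis by blast
qed

end

section \<open>The two ideals\<close>

text \<open>Multiplication by a monomial translates exponents, so coefficient sums define an ideal
  as soon as translation pulls each class back to a class or to the empty set.\<close>

lemma is_ideal_classes:
  fixes C :: "'s \<Rightarrow> 'm::comm_monoid_add set"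
  assumes "\<And>m s. {m'. m + m' \<in> C s} = {} \<or> (\<exists>s'. {m'. m + m' \<in> C s} = C s')"
  shows "is_ideal {p :: 'm \<Rightarrow>\<^sub>0 'k::comm_ring_1. \<forall>s. csum (C s) p = 0}"
  unfolding is_ideal_def
proof (intro conjI ballI allI)
  fix p q :: "'m \<Rightarrow>\<^sub>0 'k" assume q: "q \<in> {p. \<forall>s. csum (C s) p = 0}"
  show "p * q \<in> {p. \<forall>s. csum (C s) p = 0}"
  proof (induction p rule: poly_mapping_add_induct)
    case (single m c)
    have "csum {m'. m + m' \<in> C s} q = 0" for s
    proof (cases "{m'. m + m' \<in> C s} = {}")
      case False
      then obtain s' where "{m'. m + m' \<in> C s} = C s'" using assms by blast
      then show ?thesis using q by simp
    qed (simp add: csum_def)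
    then show ?case by (simp add: csum_single_mult)
  qed (simp add: distrib_right csum_add)
qed (auto simp: csum_add)

lemma monomial_curve_map_coeff:
  fixes p :: "('v::finite, 'k::field) mpoly"
  shows "Polynomial.coeff (monomial_curve_map n p) s = csum (deg_class n s) p"
proof -
  have "(\<Prod>i\<in>A. monom (1::'k) (n i) ^ lookup m i) = monom 1 (\<Sum>i\<in>A. lookup m i * n i)" for m and A :: "'v set"
    by (induction A rule: infinite_finite_induct)
      (simp_all add: monom_power mult_monom mult.commute one_poly_eq_simps)
  then have "monomial_curve_map n p = (\<Sum>m\<in>keys p. Polynomial.smult (lookup p m) (monom 1 (wdegree n m)))"
    by (simp add: monomial_curve_map_def wdegree_def)
  then have "Polynomial.coeff (monomial_curve_map n p) s = (\<Sum>m\<in>keys p. if m \<in> deg_class n s then lookup p m else 0)"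
    by (auto simp: coeff_sum deg_class_def intro!: sum.cong)
  then show ?thesis by (simp add: csum_def sum.inter_restrict)
qed

lemma semigroup_ideal_eq: "semigroup_ideal n = {p. \<forall>s. csum (deg_class n s) p = 0}"
  by (auto simp: semigroup_ideal_def poly_eq_iff monomial_curve_map_coeff)

lemma semigroup_ideal_is_ideal: "is_ideal (semigroup_ideal n)"
  unfolding semigroup_ideal_eq
proof (rule is_ideal_classes)
  fix m s
  show "{m'. m + m' \<in> deg_class n s} = {} \<or> (\<exists>s'. {m'. m + m' \<in> deg_class n s} = deg_class n s')"
  proof (cases "wdegree n m \<le> s")
    case True
    then have "{m'. m + m' \<in> deg_class n s} = deg_class n (s - wdegree n m)"
      by (auto simp: deg_class_def wdegree_add)
    then show ?thesis by blast
  qed (auto simp: deg_class_def wdegree_add)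
qed

lemma binomial_in_semigroup_ideal: "wdegree n m = wdegree n m' \<Longrightarrow> mon m - mon m' \<in> semigroup_ideal n"
  by (auto simp: semigroup_ideal_eq csum_minus csum_mon deg_class_def)

lemma semigroup_ideal_regular: "var i * p \<in> semigroup_ideal n \<Longrightarrow> p \<in> semigroup_ideal n"
proof -
  assume p: "var i * p \<in> semigroup_ideal n"
  have "csum (deg_class n s) p = csum (deg_class n (n i + s)) (var i * p)" for s
    unfolding var_mon csum_mon_mult by (simp add: deg_class_def wdegree_add)
  then show ?thesis using p by (simp add: semigroup_ideal_eq)
qed

lemma initial_form_eq: "initial_form f = keep {m. len m = Min (len ` keys f)} f"
  by (rule poly_mapping_eqI) (auto simp: initial_form_def Let_def lookup_sum lookup_single when_def in_keys_iff
      intro!: sum.neutral split: if_splits)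

section \<open>The tangent cone ideal through factorizations of maximal length\<close>

context positive_weights
begin

text \<open>The prefix refers to maximal length, not to maximal ideals. Shorter factorizations do
  not enter the sums, since their monomials vanish in the tangent cone.\<close>

definition max_ideal :: "('v, 'k::field) mpoly set" where
  "max_ideal = {p. \<forall>s. csum (max_class n s) p = 0}"

lemma max_ideal_is_ideal: "is_ideal (max_ideal :: ('v, 'k::field) mpoly set)"
  unfolding max_ideal_def
proof (rule is_ideal_classes)
  fix m s
  show "{m'. m + m' \<in> max_class n s} = {} \<or> (\<exists>s'. {m'. m + m' \<in> max_class n s} = max_class n s')"
  proof (cases "\<exists>m0. m + m0 \<in> max_class n s")
    case True
    then obtain m0 where m0: "wdegree n (m + m0) = s" "tight n (m + m0)" by (auto simp: max_class_def)
    have "m + m' \<in> max_class n s \<longleftrightarrow> m' \<in> max_class n (wdegree n m0)" for m'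
    proof
      assume "m + m' \<in> max_class n s"
      then show "m' \<in> max_class n (wdegree n m0)"
        using m0 tight_add_right[of m m'] by (auto simp: max_class_def wdegree_add)
    next
      assume m': "m' \<in> max_class n (wdegree n m0)"
      have "tight n m0" using m0(2) by (rule tight_add_right)
      then have "len m' = len m0" using m' tight_len_eq[of n m' m0] by (auto simp: max_class_def)
      then have "tight n (m + m')"
        using m' by (intro tight_cong[OF _ m0(2)]) (auto simp: max_class_def wdegree_add)
      then show "m + m' \<in> max_class n s" using m' m0 by (auto simp: max_class_def wdegree_add)
    qed
    then show ?thesis by blast
  qed blast
qed

lemma not_tight_in_max_ideal: "\<not> tight n m \<Longrightarrow> mon m \<in> max_ideal"
  by (simp add: max_ideal_def csum_mon max_class_def)

lemma binomial_in_max_ideal: "wdegree n m = wdegree n m' \<Longrightarrow> len m = len m' \<Longrightarrow> mon m - mon m' \<in> max_ideal"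
  unfolding max_ideal_def
  by (auto simp: csum_minus csum_mon max_class_def intro: tight_cong)

text \<open>Suppose the support of \<open>f\<close> contains a tight factorization of
  \<open>s\<close> of length \<open>d\<close>. All factorizations of \<open>s\<close> in the support
  have length at least \<open>d\<close> by assumption and at most \<open>d\<close> by tightness, so
  no term of degree \<open>s\<close> is lost and the sum vanishes as for \<open>f\<close>.\<close>

lemma leading_in_max_ideal:
  assumes f: "f \<in> semigroup_ideal n" and d: "\<And>m. m \<in> keys f \<Longrightarrow> d \<le> len m"
  shows "keep {m. len m = d} f \<in> max_ideal"
proof -
  have "csum (max_class n s \<inter> {m. len m = d}) f = 0" for s
  proof (cases "\<exists>m0\<in>keys f. m0 \<in> max_class n s \<and> len m0 = d")
    case True
    then obtain m0 where m0: "m0 \<in> max_class n s" "len m0 = d" by blast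
    have "csum (max_class n s \<inter> {m. len m = d}) f = csum (deg_class n s) f"
    proof (rule csum_cong)
      fix m assume m: "m \<in> keys f"
      show "m \<in> max_class n s \<inter> {m. len m = d} \<longleftrightarrow> m \<in> deg_class n s"
      proof
        assume "m \<in> deg_class n s"
        then have ms: "wdegree n m = wdegree n m0" using m0 by (simp add: deg_class_def max_class_def)
        then have "len m \<le> d" using m0 by (simp add: max_class_def tight_def)
        then have "len m = d" using d[OF m] by simp
        then show "m \<in> max_class n s \<inter> {m. len m = d}"
          using m0 ms tight_cong[of n m0 m] by (simp add: max_class_def)
      qed (auto simp: max_class_def deg_class_def)
    qed
    then show ?thesis using f by (simp add: semigroup_ideal_eq)
  next
    case False
    then have "keys f \<inter> (max_class n s \<inter> {m. len m = d}) = {}" by blast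
    then show ?thesis by (simp add: csum_def)
  qed
  then show ?thesis by (simp add: max_ideal_def csum_keep)
qed

lemma initial_form_binomial:
  assumes "m \<noteq> m'" "len m \<le> len m'"
  shows "initial_form (mon m - mon m' :: ('v, 'k::field) mpoly) = (if len m = len m' then mon m - mon m' else mon m)"
proof -
  have "keys (mon m - mon m' :: ('v, 'k) mpoly) = {m, m'}"
    using assms(1) by (auto simp: in_keys_iff lookup_minus mon_def lookup_single when_def split: if_splits)
  then show ?thesis using assms(2) unfolding initial_form_eq
    by (auto simp: keep_minus keep_mon min_def)
qed

text \<open>The harder inclusion rests on binomials only: a monomial that is not tight is the
  initial form of its difference with a longer factorization, and two tight factorizations of the
  same element form a homogeneous binomial.\<close>

lemma tangent_cone_ideal_eq: "tangent_cone_ideal n = (max_ideal :: ('v, 'k::field) mpoly set)"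
  unfolding tangent_cone_ideal_def
proof (rule genideal_eqI[OF max_ideal_is_ideal])
  show "initial_form ` (semigroup_ideal n - {0}) \<subseteq> (max_ideal :: ('v, 'k) mpoly set)"
  proof
    fix g :: "('v, 'k) mpoly" assume "g \<in> initial_form ` (semigroup_ideal n - {0})"
    then obtain f where f: "f \<in> semigroup_ideal n" "g = initial_form f" by blast
    show "g \<in> max_ideal"
      unfolding f(2) initial_form_eq by (rule leading_in_max_ideal[OF f(1)]) simp
  qed
  fix p :: "('v, 'k) mpoly" assume p: "p \<in> max_ideal"
  let ?G = "initial_form ` (semigroup_ideal n - {0 :: ('v, 'k) mpoly})"
  let ?I = "Idl\<^bsub>mpoly_ring\<^esub> ?G"
  have bin: "initial_form (mon m - mon m') \<in> ?I" if "m \<noteq> m'" "wdegree n m = wdegree n m'" for m m'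
  proof -
    have "mon m - mon m' \<noteq> (0 :: ('v, 'k) mpoly)"
      using that(1) by (metis eq_iff_diff_eq_0 keys_mon singleton_inject)
    then have "initial_form (mon m - mon m') \<in> ?G"
      using binomial_in_semigroup_ideal[OF that(2)] by blast
    then show ?thesis by (rule subsetD[OF genideal_superset])
  qed
  define rep where "rep m = (SOME m'. wdegree n m' = wdegree n m \<and> tight n m')" for m
  have rep: "wdegree n (rep m) = wdegree n m \<and> tight n (rep m)" for m
    unfolding rep_def by (rule someI_ex[OF ex_tight])
  have rep_eq: "rep m = rep m'" if "wdegree n m = wdegree n m'" for m m'
    using that by (simp add: rep_def)
  let ?h = "\<lambda>m. if tight n m then mon m - mon (rep m) else mon m :: ('v, 'k) mpoly"
  have h: "?h m \<in> ?I" for m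
  proof (cases "tight n m")
    case True
    then have "len (rep m) = len m" using rep[of m] tight_len_eq by blast
    then show ?thesis using True bin[of m "rep m"] rep[of m] is_idealD(1)[OF genideal_is_ideal]
      by (cases "m = rep m") (auto simp: initial_form_binomial)
  next
    case False
    then obtain m' where m': "wdegree n m' = wdegree n m" "len m < len m'" by (auto simp: tight_def not_le)
    then have "m \<noteq> m'" by auto
    then have "initial_form (mon m - mon m' :: ('v, 'k) mpoly) = mon m"
      using m' by (simp add: initial_form_binomial)
    then show ?thesis using False bin[of m m'] m' \<open>m \<noteq> m'\<close> by simp
  qed
  have "(\<Sum>m\<in>keys p. single 0 (lookup p m) * ?h m) \<in> ?I"
    by (intro is_ideal_sum[OF genideal_is_ideal] is_idealD(3)[OF genideal_is_ideal] h)
  moreover have "(\<Sum>m\<in>keys p. single 0 (lookup p m) * ?h m) = p"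
  proof -
    have "single 0 (lookup p m) * ?h m = single m (lookup p m) - (if tight n m then single (rep m) (lookup p m) else 0)" for m
      by (simp add: mon_def mult_single right_diff_distrib)
    then have "(\<Sum>m\<in>keys p. single 0 (lookup p m) * ?h m) =
        p - (\<Sum>m\<in>keys p. if tight n m then single (rep m) (lookup p m) else 0)"
      by (simp add: sum_subtractf sum_single_lookup)
    \<comment> \<open>Each representative collects the coefficients of \<open>p\<close> on its
      class, and these add up to zero.\<close>
    moreover have "(\<Sum>m\<in>keys p. if tight n m then single (rep m) (lookup p m) else 0) = 0"
    proof (rule poly_mapping_eqI)
      fix k
      have "lookup (if tight n m then single (rep m) (lookup p m) else 0) k =
          (if m \<in> (if rep k = k then max_class n (wdegree n k) else {}) then lookup p m else 0)" for m
      proof -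
        have "rep m = k \<longleftrightarrow> wdegree n m = wdegree n k \<and> rep k = k"
          using rep[of m] rep_eq by metis
        then show ?thesis by (auto simp: lookup_single when_def max_class_def)
      qed
      then have "lookup (\<Sum>m\<in>keys p. if tight n m then single (rep m) (lookup p m) else 0) k =
          csum (if rep k = k then max_class n (wdegree n k) else {}) p"
        by (simp add: lookup_sum csum_superset[of "keys p"])
      also have "\<dots> = 0" using p by (simp add: max_ideal_def csum_def[of "{}"])
      finally show "lookup (\<Sum>m\<in>keys p. if tight n m then single (rep m) (lookup p m) else 0) k = lookup 0 k"
        by simp
    qed
    ultimately show ?thesis by simp
  qed
  ultimately show "p \<in> ?I" by simp
qed

lemma max_ideal_regular:
  assumes "param_regular n i" "var i * p \<in> max_ideal"
  shows "p \<in> max_ideal"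
proof -
  have "csum (max_class n s) p = csum (max_class n (n i + s)) (var i * p)" for s
  proof -
    have "{m'. single i 1 + m' \<in> max_class n (n i + s)} = max_class n s"
      using assms(1) tight_add_right unfolding param_regular_def max_class_def
      by (auto simp: wdegree_add)
    then show ?thesis by (simp add: var_mon csum_mon_mult)
  qed
  then show ?thesis using assms(2) by (simp add: max_ideal_def)
qed

text \<open>Monomials of degree outside the Apery set can be exchanged for multiples of the variable
  \<open>i\<close> of the same degree, while in Apery degrees no such multiple exists; thus the
  Apery set indexes a basis of the quotient.\<close>

lemma mod_semigroup_ideal_iff:
  "p \<in> mod_ideal i (semigroup_ideal n) \<longleftrightarrow> (\<forall>m. apery_mon n i m \<longrightarrow> csum (deg_class n (wdegree n m)) p = 0)"
proof
  assume "p \<in> mod_ideal i (semigroup_ideal n)"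
  then obtain q where q: "q \<in> semigroup_ideal n" "kill {i} p = kill {i} q" by (auto simp: mod_ideal_def)
  obtain r where r: "p = q + var i * r" using kill_eq_var_split[OF q(2)] by blast
  show "\<forall>m. apery_mon n i m \<longrightarrow> csum (deg_class n (wdegree n m)) p = 0"
  proof (intro allI impI)
    fix m assume m: "apery_mon n i m"
    have "{m'. single i 1 + m' \<in> deg_class n (wdegree n m)} = {}"
      using m not_apery_mon[of n i m] by (auto simp: deg_class_def)
    then show "csum (deg_class n (wdegree n m)) p = 0"
      using q(1) by (simp add: r csum_add var_mon csum_mon_mult semigroup_ideal_eq csum_def[of "{}"])
  qed
next
  assume *: "\<forall>m. apery_mon n i m \<longrightarrow> csum (deg_class n (wdegree n m)) p = 0"
  have "\<exists>r. \<not> apery_mon n i m \<longrightarrow> wdegree n (single i 1 + r) = wdegree n m" for m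
    using not_apery_mon[of n i m] by blast
  then obtain r where r: "\<And>m. \<not> apery_mon n i m \<Longrightarrow> wdegree n (single i 1 + r m) = wdegree n m" by metis
  define g where "g m = (if apery_mon n i m then 0 else single (single i 1 + r m) (lookup p m))" for m
  let ?q = "p - (\<Sum>m\<in>keys p. g m)"
  have "csum (deg_class n s) ?q = 0" for s
  proof (cases "\<exists>m. apery_mon n i m \<and> wdegree n m = s")
    case True
    then obtain m0 where m0: "apery_mon n i m0" "wdegree n m0 = s" by blast
    have "csum (deg_class n s) (g m) = 0" for m
      using m0 r[of m] apery_mon_cong[of n m0 m i] by (auto simp: g_def csum_single deg_class_def)
    then show ?thesis using * m0 by (auto simp: csum_minus csum_sum)
  next
    case False
    then have "csum (deg_class n s) (g m) = (if m \<in> deg_class n s then lookup p m else 0)" for m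
      using r[of m] by (auto simp: g_def csum_single deg_class_def)
    then show ?thesis by (simp add: csum_minus csum_sum csum_superset[of "keys p" p])
  qed
  moreover have "kill {i} (g m) = 0" for m
    by (simp add: g_def kill_single free_of_def lookup_add)
  then have "kill {i} ?q = kill {i} p" by (simp add: kill_minus kill_sum)
  ultimately show "p \<in> mod_ideal i (semigroup_ideal n)"
    unfolding mod_ideal_def semigroup_ideal_eq by force
qed

lemma csum_mod_max_ideal:
  assumes "p \<in> mod_ideal i max_ideal" "apery_mon n i m"
  shows "csum (max_class n (wdegree n m)) p = 0"
proof -
  obtain q where q: "q \<in> max_ideal" "kill {i} p = kill {i} q" using assms(1) by (auto simp: mod_ideal_def)
  obtain r where r: "p = q + var i * r" using kill_eq_var_split[OF q(2)] by blast
  have "{m'. single i 1 + m' \<in> max_class n (wdegree n m)} = {}"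
    using assms(2) not_apery_mon[of n i m] by (auto simp: max_class_def)
  then show ?thesis
    using q(1) by (simp add: r csum_add var_mon csum_mon_mult max_ideal_def csum_def[of "{}"])
qed

text \<open>A tight monomial outside the Apery set has a factorization through \<open>i\<close>.
  With a tight cofactor, \<open>param_regular\<close> makes the product tight as well, so both have
  equal length and their difference lies in the ideal.\<close>

lemma mon_in_mod_max_ideal:
  assumes "param_regular n i" "\<not> (apery_mon n i m \<and> tight n m)"
  shows "mon m \<in> mod_ideal i max_ideal"
proof (cases "tight n m")
  case False
  then show ?thesis using not_tight_in_max_ideal by (auto simp: mod_ideal_def)
next
  case True
  then obtain r where "wdegree n (single i 1 + r) = wdegree n m"
    using assms(2) not_apery_mon[of n i m] by blast
  moreover obtain r' where r': "wdegree n r' = wdegree n r" "tight n r'" using ex_tight by blast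
  ultimately have *: "wdegree n (single i 1 + r') = wdegree n m" "tight n (single i 1 + r')"
    using assms(1) by (auto simp: wdegree_add param_regular_def)
  then have "mon m - mon (single i 1 + r') \<in> max_ideal"
    using True tight_len_eq[OF *(1)] by (intro binomial_in_max_ideal) simp_all
  moreover have "kill {i} (mon (single i 1 + r')) = (0 :: ('v, 'k::field) mpoly)"
    by (simp add: mon_def kill_single free_of_def lookup_add)
  then have "kill {i} (mon m) = kill {i} (mon m - mon (single i 1 + r') :: ('v, 'k::field) mpoly)"
    by (simp add: kill_minus)
  ultimately show ?thesis unfolding mod_ideal_def by blast
qed

section \<open>Homogeneous type\<close>

lemma finite_apery: "finite (wdegree n ` {m. apery_mon n i m})"
proof -
  have bound: "wdegree n m \<le> (\<Sum>j\<in>UNIV. n i * n j)" if m: "apery_mon n i m" for m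
  proof -
    \<comment> \<open>\<open>n i\<close> copies of \<open>j\<close> weigh as much as
      \<open>n j\<close> copies of \<open>i\<close>, so more of them would lead out of the Apery
      set.\<close>
    have "lookup m j \<le> n i" for j
    proof (rule ccontr)
      assume "\<not> lookup m j \<le> n i"
      then have "m = single j (n i) + (m - single j (n i))"
        by (intro poly_mapping_eqI) (auto simp: lookup_add lookup_minus lookup_single when_def)
      then have "wdegree n m = wdegree n (single i (n j) + (m - single j (n i)))"
        by (metis mult.commute wdegree_add wdegree_single)
      then have "lookup (single i (n j) + (m - single j (n i))) i = 0" using m by (simp add: apery_mon_def)
      then show False using pos[of j] by (simp add: lookup_add)
    qed
    then show ?thesis unfolding wdegree_def by (intro sum_mono mult_le_mono1)
  qed
  show ?thesis
    by (rule finite_subset[OF _ finite_atMost[of "\<Sum>j\<in>UNIV. n i * n j"]]) (intro image_subsetI, simp only: atMost_iff mem_Collect_eq bound)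
qed

text \<open>The last Betti number of the semigroup ring is at most the number of maximal elements of the
  Apery set for the order of the semigroup, the one of the tangent cone is at least the number of
  maximal elements for the finer order in which only additions preserving maximal lengths count.\<close>

lemma homogeneous_type_maximal:
  assumes reg: "param_regular n i"
    and type: "homogeneous_type TYPE('k::field) n"
    and m: "apery_mon n i m" "tight n m"
    and maximal: "\<And>j. j \<noteq> i \<Longrightarrow> \<not> (apery_mon n i (m + single j 1) \<and> tight n (m + single j 1))"
    and j: "j \<noteq> i"
  shows "\<not> apery_mon n i (m + single j 1)"
proof -
  obtain b d e \<Phi> d' e' \<Phi>' where
    tangent: "minimal_graded_free_resolution standard_weight (max_ideal :: ('v, 'k) mpoly set) b d e \<Phi>" and
    ring: "minimal_graded_free_resolution n (semigroup_ideal n :: ('v, 'k) mpoly set) b d' e' \<Phi>'"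
    using type unfolding homogeneous_type_def betti_sequence_def tangent_cone_ideal_eq by blast
  define N where "N = b (CARD('v) - 1)"
  \<comment> \<open>The estimates \<open>card MM <= N <= card MS\<close> and the inclusion of
    \<open>MS\<close> in \<open>MM\<close> will force equality.\<close>
  define MM where "MM = wdegree n ` {m. apery_mon n i m \<and> tight n m \<and>
    (\<forall>j. j \<noteq> i \<longrightarrow> \<not> (apery_mon n i (m + single j 1) \<and> tight n (m + single j 1)))}"
  define MS where "MS = wdegree n ` {m. apery_mon n i m \<and> (\<forall>j. j \<noteq> i \<longrightarrow> \<not> apery_mon n i (m + single j 1))}"
  have fin: "finite MM" "finite MS"
    unfolding MM_def MS_def by (rule finite_subset[OF _ finite_apery[of i]], blast)+
  have sub: "MS \<subseteq> MM"
  proof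
    fix s assume "s \<in> MS"
    then obtain m where m: "wdegree n m = s" "apery_mon n i m" "\<forall>j. j \<noteq> i \<longrightarrow> \<not> apery_mon n i (m + single j 1)"
      by (auto simp: MS_def)
    obtain m' where m': "wdegree n m' = wdegree n m" "tight n m'" using ex_tight by blast
    then have "apery_mon n i m'" "\<forall>j. j \<noteq> i \<longrightarrow> \<not> apery_mon n i (m' + single j 1)"
      using m apery_mon_cong[of n m m' i] apery_mon_add_iff[of n m m' i] by auto
    then show "s \<in> MM" unfolding MM_def using m(1) m' by (intro image_eqI[of _ _ m']) auto
  qed
  have "card MM \<le> N"
  proof -
    define rep where "rep s = (SOME m. wdegree n m = s \<and> apery_mon n i m \<and> tight n m \<and>
      (\<forall>j. j \<noteq> i \<longrightarrow> \<not> (apery_mon n i (m + single j 1) \<and> tight n (m + single j 1))))" for s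
    have rep: "wdegree n (rep s) = s \<and> apery_mon n i (rep s) \<and> tight n (rep s) \<and>
      (\<forall>j. j \<noteq> i \<longrightarrow> \<not> (apery_mon n i (rep s + single j 1) \<and> tight n (rep s + single j 1)))" if "s \<in> MM" for s
      unfolding rep_def by (rule someI_ex) (use that in \<open>auto simp: MM_def\<close>)
    show ?thesis unfolding N_def
    proof (rule card_socle_le_betti[OF tangent max_ideal_is_ideal max_ideal_regular[OF reg] fin(1), where u = "\<lambda>s. mon (rep s)"])
      show "var x * mon (rep s) \<in> mod_ideal i (max_ideal :: ('v, 'k) mpoly set)" if "s \<in> MM" "x \<noteq> i" for s x
      proof -
        have "\<not> (apery_mon n i (single x 1 + rep s) \<and> tight n (single x 1 + rep s))"
          using rep[OF that(1)] that(2) by (simp add: add.commute)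
        then show ?thesis unfolding var_mon mon_mult by (rule mon_in_mod_max_ideal[OF reg])
      qed
      fix c :: "nat \<Rightarrow> 'k"
      assume c: "(\<Sum>s\<in>MM. single 0 (c s) * mon (rep s)) \<in> mod_ideal i max_ideal"
      show "\<forall>s\<in>MM. c s = 0"
      proof
        fix s assume s: "s \<in> MM"
        have "csum (max_class n (wdegree n (rep s))) (\<Sum>s\<in>MM. single 0 (c s) * mon (rep s)) = 0"
          by (rule csum_mod_max_ideal[OF c]) (use rep[OF s] in blast)
        moreover have "csum (max_class n (wdegree n (rep s))) (single 0 (c s') * mon (rep s')) = (if s' = s then c s else 0)"
          if "s' \<in> MM" for s'
          using rep[OF s] rep[OF that] by (auto simp: mon_def mult_single csum_single max_class_def)
        ultimately show "c s = 0" using s fin(1) by (simp add: csum_sum)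
      qed
    qed
  qed
  also have "N \<le> card MS"
  proof -
    obtain u :: "nat \<Rightarrow> ('v, 'k) mpoly" where
      u: "\<And>l x. l < N \<Longrightarrow> x \<noteq> i \<Longrightarrow> var x * u l \<in> mod_ideal i (semigroup_ideal n)"
         "\<And>c. (\<Sum>l<N. single 0 (c l) * u l) \<in> mod_ideal i (semigroup_ideal n) \<Longrightarrow> \<forall>l<N. c l = 0"
    proof (rule socle_of_betti_size[OF ring semigroup_ideal_is_ideal semigroup_ideal_regular[where i = i], folded N_def])
      fix u :: "nat \<Rightarrow> ('v, 'k) mpoly"
      assume "\<And>l x. l < N \<Longrightarrow> x \<noteq> i \<Longrightarrow> var x * u l \<in> mod_ideal i (semigroup_ideal n)"
        and "\<And>c. (\<Sum>l<N. single 0 (c l) * u l) \<in> mod_ideal i (semigroup_ideal n) \<Longrightarrow> \<forall>l<N. c l = 0"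
      then show thesis by (rule that)
    qed
    obtain h where h: "bij_betw h {..<card MS} MS"
      using ex_bij_betw_nat_finite[OF fin(2)] by (auto simp: atLeast0LessThan)
    have "card {..<N} \<le> card MS"
    proof (rule card_le_of_independent[where a = "\<lambda>l k. csum (deg_class n (h k)) (u l)"])
      fix c assume c: "\<forall>k<card MS. (\<Sum>l\<in>{..<N}. c l * csum (deg_class n (h k)) (u l)) = 0"
      have lin: "csum T (\<Sum>l<N. single 0 (c l) * u l) = (\<Sum>l<N. c l * csum T (u l))" for T
        by (simp add: csum_sum csum_single_mult)
      have "(\<Sum>l<N. single 0 (c l) * u l) \<in> mod_ideal i (semigroup_ideal n)"
        unfolding mod_semigroup_ideal_iff
      proof (intro allI impI)
        fix m assume m: "apery_mon n i m"
        show "csum (deg_class n (wdegree n m)) (\<Sum>l<N. single 0 (c l) * u l) = 0"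
        proof (cases "wdegree n m \<in> MS")
          case True
          then obtain k where "k < card MS" "h k = wdegree n m"
            using bij_betw_imp_surj_on[OF h] by (metis imageE lessThan_iff)
          then show ?thesis using c by (auto simp: lin)
        next
          case False
          \<comment> \<open>In a degree that is not maximal, multiplication by \<open>j\<close>
            carries the coefficient sum of \<open>u l\<close> to another Apery degree, where it
            vanishes because \<open>j\<close> annihilates the socle.\<close>
          then obtain j where j: "j \<noteq> i" "apery_mon n i (m + single j 1)" using m by (auto simp: MS_def)
          have "csum (deg_class n (wdegree n m)) (u l) = 0" if "l < N" for l
          proof -
            have "csum (deg_class n (wdegree n (m + single j 1))) (var j * u l) = 0"
              using u(1)[OF that j(1)] j(2) unfolding mod_semigroup_ideal_iff by blast
            moreover have "{m'. single j 1 + m' \<in> deg_class n (wdegree n (m + single j 1))} = deg_class n (wdegree n m)"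
              by (auto simp: deg_class_def wdegree_add)
            ultimately show ?thesis by (simp add: var_mon csum_mon_mult)
          qed
          then show ?thesis by (simp add: lin)
        qed
      qed
      then show "\<forall>l\<in>{..<N}. c l = 0" using u(2) by blast
    qed simp
    then show ?thesis by simp
  qed
  finally have "MS = MM" using card_seteq[OF fin(1) sub] by simp
  moreover have "wdegree n m \<in> MM" unfolding MM_def using m maximal by blast
  ultimately obtain m' where m': "wdegree n m' = wdegree n m" "\<forall>j. j \<noteq> i \<longrightarrow> \<not> apery_mon n i (m' + single j 1)"
    by (auto simp: MS_def)
  then show ?thesis using j apery_mon_add_iff[of n m' m i] by blast
qed

end

section \<open>Cohen-Macaulay tangent cones\<close>

context
  fixes I :: "'a::comm_ring_1 set"
  assumes I: "is_ideal I"
begin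

abbreviation "coset x \<equiv> I +>\<^bsub>ring_of_type_algebra\<^esub> x"
abbreviation "quot \<equiv> ring_of_type_algebra Quot I"

lemma mem_coset_iff: "z \<in> coset x \<longleftrightarrow> z - x \<in> I"
proof -
  have "z \<in> coset x \<longleftrightarrow> (\<exists>h\<in>I. z = h + x)" by (simp add: a_r_coset_def')
  then show ?thesis by (metis add_diff_cancel_right' diff_add_cancel)
qed

lemma coset_eq_iff: "coset x = coset y \<longleftrightarrow> x - y \<in> I"
proof
  assume "coset x = coset y"
  moreover have "x \<in> coset x" using is_idealD(1)[OF I] by (simp add: mem_coset_iff)
  ultimately show "x - y \<in> I" by (simp add: mem_coset_iff)
next
  assume xy: "x - y \<in> I"
  have "z - x \<in> I \<longleftrightarrow> z - y \<in> I" for z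
    using is_idealD(2)[OF I xy, of "z - x"] is_idealD(5)[OF I _ xy, of "z - y"] by (auto simp: algebra_simps)
  then show "coset x = coset y" by (auto simp: mem_coset_iff)
qed

lemma quot_simps:
  "carrier quot = range coset" "\<one>\<^bsub>quot\<^esub> = coset 1" "\<zero>\<^bsub>quot\<^esub> = I"
  by (auto simp: FactRing_def A_RCOSETS_def')

lemma quot_mult: "coset x \<otimes>\<^bsub>quot\<^esub> coset y = coset (x * y)"
proof -
  interpret ideal I "ring_of_type_algebra :: 'a ring" using I by (simp add: ideal_iff)
  show ?thesis using rcoset_mult_add[of x y] by (simp add: FactRing_def)
qed

lemma quot_add: "coset x \<oplus>\<^bsub>quot\<^esub> coset y = coset (x + y)"
proof -
  interpret ideal I "ring_of_type_algebra :: 'a ring" using I by (simp add: ideal_iff)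
  show ?thesis using a_rcos_sum[of x y] by (simp add: FactRing_def)
qed

lemma quot_cring: "cring quot"
proof -
  have "ideal I (ring_of_type_algebra :: 'a ring)" using I by (simp add: ideal_iff)
  then show ?thesis by (rule ideal.quotient_is_cring[OF _ cring_type_algebra])
qed

lemma quot_ideal: "is_ideal J \<Longrightarrow> ideal (coset ` J) quot"
proof -
  assume J: "is_ideal J"
  interpret cring "ring_of_type_algebra :: 'a ring" by (rule cring_type_algebra)
  show ?thesis using ring_ideal_imp_quot_ideal[of I J] I J by (simp add: ideal_iff)
qed

end

lemma var_neq_0: "var i \<noteq> (0 :: ('v, 'k::comm_ring_1) mpoly)"
  unfolding var_def by (metis lookup_single_eq lookup_zero one_neq_zero)

lemma is_ideal_kill_kernel: "is_ideal {p :: ('v, 'k::comm_ring_1) mpoly. kill V p = 0}"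
  by (auto simp: is_ideal_def kill_add kill_mult)

context
  fixes I :: "('v, 'k::field) mpoly set" and V :: "'v set"
  assumes I: "is_ideal I" and sub: "\<And>p. p \<in> I \<Longrightarrow> kill V p = 0"
begin

lemma coset_mem_kill_kernel: "coset I p \<in> coset I ` {p. kill V p = 0} \<longleftrightarrow> kill V p = 0"
proof
  assume "coset I p \<in> coset I ` {p. kill V p = 0}"
  then obtain q where q: "kill V q = 0" "p - q \<in> I" using coset_eq_iff[OF I] by auto
  have "kill V (p - q) = 0" using q(2) by (rule sub)
  then show "kill V p = 0" using q(1) by (simp add: kill_minus)
qed blast

lemma kill_kernel_proper: "coset I ` {p. kill V p = 0} \<noteq> carrier (quot I)"
  using coset_mem_kill_kernel[of 1] by (auto simp: quot_simps[OF I])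

end

text \<open>Primality comes from the polynomial ring being a domain, for which the linear order on
  the variables supplies an order of the monomials.\<close>

lemma kill_kernel_prime:
  fixes I :: "('v::linorder, 'k::field) mpoly set"
  assumes I: "is_ideal I" and sub: "\<And>p. p \<in> I \<Longrightarrow> kill V p = 0"
  shows "primeideal (coset I ` {p. kill V p = 0}) (quot I)"
proof (rule primeidealI)
  show "ideal (coset I ` {p. kill V p = 0}) (quot I)"
    by (rule quot_ideal[OF I is_ideal_kill_kernel])
  show "cring (quot I)" by (rule quot_cring[OF I])
  show "carrier (quot I) \<noteq> coset I ` {p. kill V p = 0}"
    using kill_kernel_proper[OF I sub] by simp
  fix a b assume ab: "a \<in> carrier (quot I)" "b \<in> carrier (quot I)"
    "a \<otimes>\<^bsub>quot I\<^esub> b \<in> coset I ` {p. kill V p = 0}"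
  then obtain p q where pq: "a = coset I p" "b = coset I q" by (auto simp: quot_simps[OF I])
  then have "kill V (p * q) = 0"
    using ab(3) by (simp add: quot_mult[OF I] coset_mem_kill_kernel[OF I sub])
  then have "kill V p = 0 \<or> kill V q = 0" by (simp add: kill_mult)
  then show "a \<in> coset I ` {p. kill V p = 0} \<or> b \<in> coset I ` {p. kill V p = 0}"
    unfolding pq by blast
qed

lemma kill_kernel_maximal:
  fixes I :: "('v, 'k::field) mpoly set"
  assumes I: "is_ideal I" and sub: "\<And>p. p \<in> I \<Longrightarrow> lookup p 0 = 0"
  shows "maximalideal (coset I ` {p. kill UNIV p = 0}) (quot I)"
proof (rule maximalidealI)
  have sub': "kill UNIV p = 0" if "p \<in> I" for p using sub[OF that] by (simp add: kill_UNIV)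
  show "ideal (coset I ` {p. kill UNIV p = 0}) (quot I)"
    by (rule quot_ideal[OF I is_ideal_kill_kernel])
  show "carrier (quot I) \<noteq> coset I ` {p. kill UNIV p = 0}"
    using kill_kernel_proper[OF I sub'] by simp
  fix J assume J: "ideal J (quot I)" and MJ: "coset I ` {p. kill UNIV p = 0} \<subseteq> J" and JQ: "J \<subseteq> carrier (quot I)"
  show "J = coset I ` {p. kill UNIV p = 0} \<or> J = carrier (quot I)"
  proof (cases "J = coset I ` {p. kill UNIV p = 0}")
    case False
    then have "\<exists>a. a \<in> J \<and> a \<notin> coset I ` {p. kill UNIV p = 0}" using MJ by blast
    then obtain a where X: "a \<in> J" "a \<notin> coset I ` {p. kill UNIV p = 0}" by blast
    have "a \<in> carrier (quot I)" using JQ X(1) by blast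
    then obtain p where p: "a = coset I p" by (auto simp: quot_simps[OF I])
    define c where "c = lookup p 0"
    have "kill UNIV p \<noteq> 0" using X(2) p by blast
    then have c0: "c \<noteq> 0" by (auto simp: kill_UNIV c_def)
    \<comment> \<open>Scaled to constant term 1, \<open>p\<close> differs from 1 by an element of
      the irrelevant ideal, so \<open>J\<close> contains 1.\<close>
    have "coset I (single 0 (inverse c) * p) \<in> J"
      using ideal.I_l_closed[OF J X(1), of "coset I (single 0 (inverse c))"]
      by (simp add: p quot_mult[OF I] quot_simps[OF I])
    moreover have "coset I (1 - single 0 (inverse c) * p) \<in> J"
    proof -
      have "kill UNIV (1 - single 0 (inverse c) * p) = 0"
        using c0 by (simp add: kill_UNIV lookup_minus lookup_one lookup_mult_zero c_def)
      then show ?thesis using MJ by blast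
    qed
    ultimately have "coset I (1 - single 0 (inverse c) * p) \<oplus>\<^bsub>quot I\<^esub> coset I (single 0 (inverse c) * p) \<in> J"
      by (intro additive_subgroup.a_closed[OF ideal.axioms(1)[OF J]])
    then have "\<one>\<^bsub>quot I\<^esub> \<in> J" by (simp add: quot_add[OF I] quot_simps[OF I])
    then show ?thesis using ideal.one_imp_carrier[OF J] by blast
  qed blast
qed

lemma enat_SUP_ge_1D:
  assumes "(SUP x\<in>A. enat (f x)) \<ge> 1"
  obtains x where "x \<in> A" "f x \<ge> 1"
proof -
  have "\<exists>x\<in>A. f x \<ge> 1"
  proof (rule ccontr)
    assume "\<not> (\<exists>x\<in>A. f x \<ge> 1)"
    then have "(SUP x\<in>A. enat (f x)) \<le> 0"
      by (intro SUP_least) (force simp: zero_enat_def)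
    then show False using assms by simp
  qed
  then show ?thesis using that by blast
qed

text \<open>The ideal of the variables other than \<open>i\<close> is a prime properly below the
  irrelevant maximal ideal, which therefore has height at least one. Equality with the grade gives a
  nonempty regular sequence, and its first member is a nonzerodivisor.\<close>

lemma cohen_macaulay_regular_element:
  fixes I :: "('v::linorder, 'k::field) mpoly set"
  assumes cm: "cohen_macaulay (quot I)" and I: "is_ideal I"
    and sub0: "\<And>p. p \<in> I \<Longrightarrow> lookup p 0 = 0"
    and sub: "\<And>p. p \<in> I \<Longrightarrow> kill (- {i}) p = 0"
  obtains r where "lookup r 0 = 0" "\<And>p. p * r \<in> I \<Longrightarrow> p \<in> I"
proof -
  let ?P = "coset I ` {p. kill (- {i}) p = 0}" and ?M = "coset I ` {p. kill UNIV p = 0}"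
  have sub': "kill UNIV p = 0" if "p \<in> I" for p using sub0[OF that] by (simp add: kill_UNIV)
  have "?P \<subseteq> ?M"
  proof (intro image_mono subsetI CollectI)
    fix p :: "('v, 'k) mpoly" assume "p \<in> {p. kill (- {i}) p = 0}"
    then have "kill UNIV (kill (- {i}) p) = 0" by simp
    then show "kill UNIV p = 0" by (simp add: kill_kill)
  qed
  moreover have "coset I (var i) \<in> ?M" "coset I (var i) \<notin> ?P"
    using coset_mem_kill_kernel[OF I sub'] coset_mem_kill_kernel[OF I sub, of "var i"]
    by (simp_all add: kill_var var_neq_0)
  ultimately have "?P \<subset> ?M" by blast
  moreover have "primeideal ?P (quot I)" "primeideal ?M (quot I)"
    using kill_kernel_prime[OF I] sub sub' by blast+
  ultimately have "1 \<le> height (quot I) ?M"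
    unfolding height_def one_enat_def
    by (intro SUP_upper CollectI exI[of _ "\<lambda>k::nat. if k = 0 then ?P else ?M"]) (auto simp: le_Suc_eq)
  moreover have "grade (quot I) ?M = height (quot I) ?M"
    using cm kill_kernel_maximal[OF I sub0] by (simp add: cohen_macaulay_def)
  ultimately have "1 \<le> grade (quot I) ?M" by simp
  then obtain xs where xs: "regular_sequence (quot I) xs" "set xs \<subseteq> ?M" "length xs \<ge> 1"
    unfolding grade_def by (rule enat_SUP_ge_1D) blast
  have "xs ! 0 \<in> set xs" using xs(3) by (cases xs) auto
  then have "xs ! 0 \<in> ?M" using xs(2) by blast
  then obtain r where r: "xs ! 0 = coset I r" "kill UNIV r = 0" by blast
  have zero: "Idl\<^bsub>quot I\<^esub> {} = {I}"
  proof -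
    interpret Q: cring "quot I" by (rule quot_cring[OF I])
    have "Idl\<^bsub>quot I\<^esub> {} \<subseteq> {\<zero>\<^bsub>quot I\<^esub>}" by (rule Q.genideal_minimal[OF Q.zeroideal]) simp
    moreover have "\<zero>\<^bsub>quot I\<^esub> \<in> Idl\<^bsub>quot I\<^esub> {}"
      using Q.genideal_ideal[of "{}"] by (simp add: additive_subgroup.zero_closed ideal.axioms(1))
    ultimately show ?thesis by (auto simp: quot_simps[OF I])
  qed
  have coset_I: "coset I p = I \<longleftrightarrow> p \<in> I" for p
    using coset_eq_iff[OF I, of p 0] coset_eq_iff[OF I, of 0 0] mem_coset_iff[OF I, of _ 0] by auto
  have "p \<in> I" if "p * r \<in> I" for p
  proof -
    have "\<forall>a\<in>carrier (quot I). a \<otimes>\<^bsub>quot I\<^esub> (xs ! 0) \<in> {I} \<longrightarrow> a \<in> {I}"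
      using xs(1,3) unfolding regular_sequence_def zero[symmetric] by (metis One_nat_def Suc_le_lessD empty_set take_0)
    then have "coset I p \<otimes>\<^bsub>quot I\<^esub> coset I r \<in> {I} \<longrightarrow> coset I p \<in> {I}"
      by (simp add: r(1) quot_simps[OF I])
    then show ?thesis using that by (simp add: quot_mult[OF I] coset_I)
  qed
  moreover have "lookup r 0 = 0" using r(2) by (metis kill_UNIV lookup_single_eq lookup_zero)
  ultimately show ?thesis using that by blast
qed

lemma keys_power_len:
  assumes "lookup r 0 = 0" "m \<in> keys (r ^ N :: ('v::finite, 'k::comm_ring_1) mpoly)"
  shows "N \<le> len m"
  using assms(2)
proof (induction N arbitrary: m)
  case (Suc N)
  then obtain a b where ab: "m = a + b" "a \<in> keys r" "b \<in> keys (r ^ N)"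
    using keys_mult[of r "r ^ N"] by auto
  have "a \<noteq> 0" using ab(2) assms(1) by auto
  have "\<exists>i. lookup a i \<noteq> 0"
  proof (rule ccontr)
    assume "\<nexists>i. lookup a i \<noteq> 0"
    then have "a = 0" by (intro poly_mapping_eqI) simp
    with \<open>a \<noteq> 0\<close> show False by simp
  qed
  then obtain i where "lookup a i \<noteq> 0" ..
  from exponent_split[OF this] obtain a' where "a = single i 1 + a'" ..
  then have "1 \<le> len a" by (simp add: wdegree_add)
  then show ?case using Suc.IH[OF ab(3)] by (simp add: ab(1) wdegree_add)
qed simp

section \<open>From some regular element to regularity of the variable of least weight\<close>

context positive_weights
begin

text \<open>A factorization this long either contains \<open>i\<close> or, by the pigeonhole
  principle, at least \<open>n i\<close> copies of some \<open>j\<close>, which can be exchanged for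
  \<open>n j\<close> copies of \<open>i\<close> without loss of length. So its degree has a
  factorization through \<open>i\<close> that is at least as long, and adding \<open>i\<close>
  already destroys the tightness of \<open>m0\<close>.\<close>

lemma large_add_not_tight:
  assumes min: "\<And>j. n i \<le> n j" and large: "CARD('v) * n i \<le> len m"
    and m0: "\<not> tight n (single i 1 + m0)" "tight n m0"
  shows "\<not> tight n (m + m0)"
proof -
  have "\<exists>r. wdegree n (single i 1 + r) = wdegree n m \<and> len m \<le> len (single i 1 + r)"
  proof (cases "lookup m i = 0")
    case False
    from exponent_split[OF this] obtain r where "m = single i 1 + r" ..
    then show ?thesis by (intro exI[of _ r]) simp
  next
    case True
    have "\<exists>j. n i \<le> lookup m j"
    proof (rule ccontr)
      assume "\<not> (\<exists>j. n i \<le> lookup m j)"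
      then have "(\<Sum>j\<in>UNIV. lookup m j) < (\<Sum>j\<in>(UNIV :: 'v set). n i)"
        by (intro sum_strict_mono) (auto simp: not_le)
      then show False using large by (simp add: wdegree_def)
    qed
    then obtain j where j: "n i \<le> lookup m j" by blast
    let ?r = "single i (n j - 1) + (m - single j (n i))"
    have m: "m = single j (n i) + (m - single j (n i))"
      using j by (intro poly_mapping_eqI) (auto simp: lookup_add lookup_minus lookup_single when_def)
    have "single i 1 + ?r = single i (n j) + (m - single j (n i))"
      using pos[of j] by (simp flip: add.assoc single_add)
    moreover have "wdegree n (single i (n j) + (m - single j (n i))) = wdegree n m"
      by (subst (2) m) (simp add: wdegree_add)
    moreover have "len m \<le> len (single i (n j) + (m - single j (n i)))"
      using min[of j] by (subst m) (simp add: wdegree_add)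
    ultimately show ?thesis by metis
  qed
  then obtain r where r: "wdegree n (single i 1 + r) = wdegree n m" "len m \<le> len (single i 1 + r)" by blast
  obtain m1 where m1: "wdegree n m1 = wdegree n (single i 1 + m0)" "len (single i 1 + m0) < len m1"
    using m0(1) by (auto simp: tight_def not_le)
  have "wdegree n (r + m1) = wdegree n (m + m0)" using r m1 by (simp add: wdegree_add)
  moreover have "len (m + m0) < len (r + m1)" using r m1 by (simp add: wdegree_add)
  ultimately show ?thesis by (auto simp: tight_def not_le)
qed

text \<open>Since \<open>n i\<close> is strictly smallest, every other factorization of
  \<open>k * n i\<close> is shorter than \<open>k\<close>. The class of maximal length is then a
  single power of the variable, and the coefficient sum is one coefficient.\<close>

lemma max_ideal_coefficients:
  assumes "\<And>j. j \<noteq> i \<Longrightarrow> n i < n j" "p \<in> max_ideal"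
  shows "lookup p 0 = 0" "kill (- {i}) p = 0"
proof -
  have "lookup p (single i k) = 0" for k
  proof -
    have le: "len m \<le> k \<and> (len m = k \<longrightarrow> m = single i k)" if m: "wdegree n m = k * n i" for m
    proof -
      have ge: "n i \<le> n j" for j using assms(1)[of j] by (cases "j = i") auto
      have "len m * n i \<le> wdegree n m"
        unfolding wdegree_def by (simp add: sum_distrib_right sum_mono ge)
      then have "len m \<le> k" using m pos[of i] by simp
      moreover have "m = single i k" if "len m = k"
      proof -
        have "(\<Sum>j\<in>UNIV. lookup m j * n j) = (\<Sum>j\<in>UNIV. lookup m j * n i)"
          using m that by (simp add: wdegree_def flip: sum_distrib_right)
        then have "lookup m j * n i = lookup m j * n j" for j
          by (intro sum_mono_inv[of "\<lambda>j. lookup m j * n i" UNIV "\<lambda>j. lookup m j * n j"]) (simp_all add: ge)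
        then have 0: "lookup m j = 0" if "j \<noteq> i" for j
          using assms(1)[OF that] by (metis mult_cancel1 less_irrefl)
        have "m = single i (lookup m i)"
          by (intro poly_mapping_eqI) (auto simp: lookup_single when_def 0)
        moreover have "lookup m i = k" using m calculation pos[of i] by (metis wdegree_single mult_cancel2 less_irrefl)
        ultimately show ?thesis by simp
      qed
      ultimately show ?thesis by blast
    qed
    have "tight n (single i k)" using le by (simp add: tight_def)
    then have "max_class n (k * n i) = {single i k}"
      using le tight_len_eq[of n _ "single i k"] by (auto simp: max_class_def)
    moreover have "csum (max_class n (k * n i)) p = 0" using assms(2) by (simp add: max_ideal_def)
    ultimately have "csum {single i k} p = 0" by (simp only:)
    moreover have "csum {single i k} p = lookup p (single i k)"
      by (auto simp: csum_def in_keys_iff Int_insert_right)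
    ultimately show ?thesis by simp
  qed
  note coeff = this
  show "lookup p 0 = 0" using coeff[of 0] by simp
  have "m = single i (lookup m i)" if "m \<in> free_of (- {i})" for m
    using that by (intro poly_mapping_eqI) (auto simp: free_of_def lookup_single when_def)
  then have "lookup (kill (- {i}) p) m = 0" for m
    using coeff[of "lookup m i"] by (auto simp: kill_def)
  then show "kill (- {i}) p = 0" by (intro poly_mapping_eqI) simp
qed

end

text \<open>If \<open>i\<close> annihilated a tight monomial \<open>m0\<close>, every monomial of
  large length would do so by \<open>large_add_not_tight\<close>, hence also a high power of the
  regular element \<open>r\<close>; cancelling \<open>r\<close> repeatedly puts \<open>m0\<close>
  into the ideal, against tightness.\<close>

lemma cohen_macaulay_imp_param_regular:
  fixes n :: "'v::{finite,linorder} \<Rightarrow> nat"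
  assumes pos: "\<And>j. n j > 0" and min: "\<And>j. j \<noteq> i \<Longrightarrow> n i < n j"
    and cm: "cohen_macaulay (mpoly_ring Quot (tangent_cone_ideal n :: ('v, 'k::field) mpoly set))"
  shows "param_regular n i"
proof -
  interpret positive_weights n by standard (rule pos)
  have le: "n i \<le> n j" for j using min[of j] by (cases "j = i") auto
  obtain r :: "('v, 'k) mpoly" where r: "lookup r 0 = 0" "\<And>p. p * r \<in> max_ideal \<Longrightarrow> p \<in> max_ideal"
    using cohen_macaulay_regular_element[OF cm[unfolded tangent_cone_ideal_eq] max_ideal_is_ideal
        max_ideal_coefficients[OF min]] by blast
  show ?thesis unfolding param_regular_def
  proof (intro allI impI, rule ccontr)
    fix m0 assume m0: "tight n m0" "\<not> tight n (single i 1 + m0)"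
    let ?N = "CARD('v) * n i"
    have pow: "(mon m0 :: ('v, 'k) mpoly) \<in> max_ideal" if "mon m0 * r ^ N \<in> max_ideal" for N
      using that
    proof (induction N)
      case 0
      then show ?case by simp
    next
      case (Suc N)
      have "(mon m0 * r ^ N) * r \<in> max_ideal" using Suc.prems by (simp add: mult_ac)
      then show ?case by (rule Suc.IH[OF r(2)])
    qed
    have "mon m0 * r ^ ?N = (\<Sum>m\<in>keys (r ^ ?N). single 0 (lookup (r ^ ?N) m) * mon (m + m0))"
    proof -
      have "mon m0 * r ^ ?N = mon m0 * (\<Sum>m\<in>keys (r ^ ?N). single m (lookup (r ^ ?N) m))"
        by (simp only: sum_single_lookup)
      also have "\<dots> = (\<Sum>m\<in>keys (r ^ ?N). mon m0 * single m (lookup (r ^ ?N) m))"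
        by (rule sum_distrib_left)
      also have "\<dots> = (\<Sum>m\<in>keys (r ^ ?N). single 0 (lookup (r ^ ?N) m) * mon (m + m0))"
        by (rule sum.cong) (simp_all add: mon_def mult_single add.commute)
      finally show ?thesis .
    qed
    also have "\<dots> \<in> max_ideal"
    proof (intro is_ideal_sum[OF max_ideal_is_ideal] is_idealD(3)[OF max_ideal_is_ideal] not_tight_in_max_ideal)
      fix m assume "m \<in> keys (r ^ ?N)"
      then have "?N \<le> len m" by (rule keys_power_len[OF r(1)])
      then show "\<not> tight n (m + m0)" using large_add_not_tight[OF le] m0 by blast
    qed
    finally have "mon m0 * r ^ ?N \<in> max_ideal" .
    then have "mon m0 \<in> (max_ideal :: ('v, 'k) mpoly set)" by (rule pow)
    then have "csum (max_class n (wdegree n m0)) (mon m0 :: ('v, 'k) mpoly) = 0" by (simp add: max_ideal_def)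
    then show False using m0(1) by (simp add: csum_mon max_class_def)
  qed
qed

section \<open>Exponent vectors in four variables\<close>

lemma exhaust_4: "x = 1 \<or> x = 2 \<or> x = 3 \<or> x = 4" for x :: 4
proof (induct x)
  case (of_int z)
  then have "z = 0 \<or> z = 1 \<or> z = 2 \<or> z = 3" by simp arith
  then show ?case by auto
qed

lemma UNIV_4: "UNIV = {1, 2, 3, 4 :: 4}"
  using exhaust_4 by auto

lemma distinct_4 [simp]:
  "(1::4) \<noteq> 2" "(1::4) \<noteq> 3" "(1::4) \<noteq> 4" "(2::4) \<noteq> 1" "(2::4) \<noteq> 3" "(2::4) \<noteq> 4"
  "(3::4) \<noteq> 1" "(3::4) \<noteq> 2" "(3::4) \<noteq> 4" "(4::4) \<noteq> 1" "(4::4) \<noteq> 2" "(4::4) \<noteq> 3"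
  by simp_all

definition mk :: "nat \<Rightarrow> nat \<Rightarrow> nat \<Rightarrow> nat \<Rightarrow> 4 \<Rightarrow>\<^sub>0 nat" where
  "mk a b c d = single 1 a + single 2 b + single 3 c + single 4 d"

lemma lookup_mk [simp]:
  "lookup (mk a b c d) 1 = a" "lookup (mk a b c d) 2 = b" "lookup (mk a b c d) 3 = c" "lookup (mk a b c d) 4 = d"
  by (simp_all add: mk_def lookup_add lookup_single when_def del: one_neq_zero numeral_eq_iff)

lemma mk_eqI: "lookup m 1 = a \<Longrightarrow> lookup m 2 = b \<Longrightarrow> lookup m 3 = c \<Longrightarrow> lookup m 4 = d \<Longrightarrow> m = mk a b c d"
proof (rule poly_mapping_eqI)
  fix i assume "lookup m 1 = a" "lookup m 2 = b" "lookup m 3 = c" "lookup m 4 = d"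
  then show "lookup m i = lookup (mk a b c d) i" using exhaust_4[of i] by (elim disjE) simp_all
qed

lemma mk_cases: obtains a b c d where "m = mk a b c d"
  using mk_eqI by blast

lemma mk_eq_iff [simp]: "mk a b c d = mk a' b' c' d' \<longleftrightarrow> a = a' \<and> b = b' \<and> c = c' \<and> d = d'"
  by (metis lookup_mk)

lemma mk_add [simp]: "mk a b c d + mk a' b' c' d' = mk (a + a') (b + b') (c + c') (d + d')"
  by (rule mk_eqI) (simp_all add: lookup_add)

lemma single_eq_mk: "single 1 k = mk k 0 0 0" "single 2 k = mk 0 k 0 0" "single 3 k = mk 0 0 k 0" "single 4 k = mk 0 0 0 k"
  by (simp_all add: mk_def)

lemma wdegree_mk [simp]: "wdegree w (mk a b c d) = a * w 1 + b * w 2 + c * w 3 + d * w 4"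
  unfolding mk_def by (simp add: wdegree_add del: distinct_4)

lemma mk_eq_add_iff: "mk a b c d = mk a' b' c' d' + r \<longleftrightarrow>
    a' \<le> a \<and> b' \<le> b \<and> c' \<le> c \<and> d' \<le> d \<and> r = mk (a - a') (b - b') (c - c') (d - d')"
proof (cases r rule: mk_cases)
  case (1 a'' b'' c'' d'')
  then show ?thesis by auto
qed

lemma residue_classes:
  fixes n :: "4 \<Rightarrow> nat"
  assumes "Gcd (range n) = 1" "n 1 > 0"
  shows "\<exists>u. wdegree n u mod n 1 = r mod n 1"
proof -
  have "gcd (n 1) (gcd (n 2) (gcd (n 3) (n 4))) = 1"
    using assms(1) unfolding UNIV_4 by (simp add: gcd.assoc)
  then have "gcd (int (n 1)) (gcd (int (n 2)) (gcd (int (n 3)) (int (n 4)))) = 1"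
    by (simp only: gcd_int_int_eq of_nat_1)
  moreover obtain x1 y1 where "x1 * int (n 1) + y1 * gcd (int (n 2)) (gcd (int (n 3)) (int (n 4))) =
      gcd (int (n 1)) (gcd (int (n 2)) (gcd (int (n 3)) (int (n 4))))" using bezout_int by blast
  moreover obtain x2 y2 where "x2 * int (n 2) + y2 * gcd (int (n 3)) (int (n 4)) = gcd (int (n 2)) (gcd (int (n 3)) (int (n 4)))"
    using bezout_int by blast
  moreover obtain x3 y3 where "x3 * int (n 3) + y3 * int (n 4) = gcd (int (n 3)) (int (n 4))"
    using bezout_int by blast
  ultimately have "x1 * int (n 1) + y1 * (x2 * int (n 2) + y2 * (x3 * int (n 3) + y3 * int (n 4))) = 1"
    by simp
  then have one: "x1 * int (n 1) + (y1 * x2) * int (n 2) + (y1 * y2 * x3) * int (n 3) + (y1 * y2 * y3) * int (n 4) = 1"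
    by (simp add: algebra_simps)
  \<comment> \<open>Bezout coefficients times \<open>r\<close>, reduced modulo \<open>n 1\<close> to
    become nonnegative exponents.\<close>
  let ?c = "\<lambda>x. nat ((int r * x) mod int (n 1))"
  let ?u = "mk (?c x1) (?c (y1 * x2)) (?c (y1 * y2 * x3)) (?c (y1 * y2 * y3))"
  have c: "int (?c x) = (int r * x) mod int (n 1)" for x using assms(2) by simp
  have "int (wdegree n ?u) mod int (n 1) =
      (int r * x1 * int (n 1) + int r * (y1 * x2) * int (n 2) + int r * (y1 * y2 * x3) * int (n 3) + int r * (y1 * y2 * y3) * int (n 4)) mod int (n 1)"
    unfolding wdegree_mk of_nat_add of_nat_mult c
    by (intro mod_add_cong mod_mult_cong refl mod_mod_trivial)
  also have "int r * x1 * int (n 1) + int r * (y1 * x2) * int (n 2) + int r * (y1 * y2 * x3) * int (n 3) + int r * (y1 * y2 * y3) * int (n 4) =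
      int r * (x1 * int (n 1) + (y1 * x2) * int (n 2) + (y1 * y2 * x3) * int (n 3) + (y1 * y2 * y3) * int (n 4))"
    by (simp add: algebra_simps)
  also have "\<dots> = int r" by (simp only: one mult_1_right)
  finally have "wdegree n ?u mod n 1 = r mod n 1" by (simp only: of_nat_mod[symmetric] of_nat_eq_iff)
  then show ?thesis by blast
qed

section \<open>Komeda's semigroups\<close>

text \<open>In terms of the paper, \<open>\<alpha>\<^sub>1 = e + g + 1\<close>, \<open>\<alpha>\<^sub>2\<^sub>1 = e\<close>, \<open>\<alpha>\<^sub>2 = B + 1\<close>, \<open>\<alpha>\<^sub>3 = C + 1\<close>, \<open>\<alpha>\<^sub>4 = D + 1\<close>.\<close>

locale komeda =
  fixes n :: "4 \<Rightarrow> nat" and e g B C D :: nat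
  assumes params: "e \<ge> 1" "g \<ge> 1" "B \<ge> 1" "C \<ge> 1" "D \<ge> 1"
    and n1: "n 1 = (B + 1) * (C + 1) * D + 1"
    and n2: "n 2 = e * (C + 1) * (D + 1) + g * C + C + 1"
    and n3: "n 3 = (e + g) * (D + 1) + g * B * D + 1"
    and n4: "n 4 = (e + g + 1) * (B + 1) * C + e * B + B + 1"
    and gcd: "Gcd (range n) = 1"
begin

lemma n_pos: "n i > 0"
  using exhaust_4[of i] by (elim disjE) (simp_all add: n1 n2 n3 n4)

sublocale positive_weights n
  by standard (rule n_pos)

lemma degree_relations:
  "(e + g + 1) * n 1 = n 3 + D * n 4"
  "(B + 1) * n 2 = e * n 1 + n 4"
  "(C + 1) * n 3 = g * n 1 + n 2"
  "(D + 1) * n 4 = n 1 + B * n 2 + C * n 3"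
  "(e + 1) * n 1 + C * n 3 = n 2 + D * n 4"
  unfolding n1 n2 n3 n4 by (simp_all add: algebra_simps)

section \<open>Moves along the five binomials and normal forms\<close>

definition moves :: "((4 \<Rightarrow>\<^sub>0 nat) \<times> (4 \<Rightarrow>\<^sub>0 nat)) set" where
  "moves = {(mk (e + g + 1) 0 0 0, mk 0 0 1 D), (mk 0 (B + 1) 0 0, mk e 0 0 1), (mk 0 0 (C + 1) 0, mk g 1 0 0),
    (mk 0 0 0 (D + 1), mk 1 B C 0), (mk (e + 1) 0 C 0, mk 0 1 0 D)}"

inductive move :: "(4 \<Rightarrow>\<^sub>0 nat) \<Rightarrow> (4 \<Rightarrow>\<^sub>0 nat) \<Rightarrow> bool" where
  forward: "(p, q) \<in> moves \<Longrightarrow> move (p + r) (q + r)"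
| backward: "(p, q) \<in> moves \<Longrightarrow> move (q + r) (p + r)"

text \<open>All neighbours in coordinates; closure of an explicit set under moves thereby becomes a
  case check.\<close>

lemma move_mk_iff: "move (mk a b c d) v \<longleftrightarrow>
    e + g + 1 \<le> a \<and> v = mk (a - (e + g + 1)) b (c + 1) (d + D) \<or>
    1 \<le> c \<and> D \<le> d \<and> v = mk (a + (e + g + 1)) b (c - 1) (d - D) \<or>
    B + 1 \<le> b \<and> v = mk (a + e) (b - (B + 1)) c (d + 1) \<or>
    e \<le> a \<and> 1 \<le> d \<and> v = mk (a - e) (b + (B + 1)) c (d - 1) \<or>
    C + 1 \<le> c \<and> v = mk (a + g) (b + 1) (c - (C + 1)) d \<or>
    g \<le> a \<and> 1 \<le> b \<and> v = mk (a - g) (b - 1) (c + (C + 1)) d \<or>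
    D + 1 \<le> d \<and> v = mk (a + 1) (b + B) (c + C) (d - (D + 1)) \<or>
    1 \<le> a \<and> B \<le> b \<and> C \<le> c \<and> v = mk (a - 1) (b - B) (c - C) (d + (D + 1)) \<or>
    e + 1 \<le> a \<and> C \<le> c \<and> v = mk (a - (e + 1)) (b + 1) (c - C) (d + D) \<or>
    1 \<le> b \<and> D \<le> d \<and> v = mk (a + (e + 1)) (b - 1) (c + C) (d - D)"
proof -
  have move_iff: "move u v \<longleftrightarrow> (\<exists>(p, q)\<in>moves. (\<exists>r. u = p + r \<and> v = q + r) \<or> (\<exists>r. u = q + r \<and> v = p + r))" for u v
  proof
    assume "move u v"
    then show "\<exists>(p, q)\<in>moves. (\<exists>r. u = p + r \<and> v = q + r) \<or> (\<exists>r. u = q + r \<and> v = p + r)"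
    proof cases
      case (forward p q r)
      then show ?thesis by (intro bexI[of _ "(p, q)"]) auto
    next
      case (backward p q r)
      then show ?thesis by (intro bexI[of _ "(p, q)"]) auto
    qed
  next
    assume "\<exists>(p, q)\<in>moves. (\<exists>r. u = p + r \<and> v = q + r) \<or> (\<exists>r. u = q + r \<and> v = p + r)"
    then show "move u v" by (elim bexE case_prodE disjE exE conjE) (simp_all only: move.intros)
  qed
  show ?thesis
    unfolding move_iff moves_def
    by (simp add: mk_eq_add_iff del: One_nat_def) (simp add: ac_simps)
qed

abbreviation "linked \<equiv> move\<^sup>*\<^sup>*"

lemma moves_wdegree: "(p, q) \<in> moves \<Longrightarrow> wdegree n p = wdegree n q"
proof -
  have "wdegree n (mk (e + g + 1) 0 0 0) = wdegree n (mk 0 0 1 D)"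
    using degree_relations(1) by simp
  moreover have "wdegree n (mk 0 (B + 1) 0 0) = wdegree n (mk e 0 0 1)"
    using degree_relations(2) by simp
  moreover have "wdegree n (mk 0 0 (C + 1) 0) = wdegree n (mk g 1 0 0)"
    using degree_relations(3) by simp
  moreover have "wdegree n (mk 0 0 0 (D + 1)) = wdegree n (mk 1 B C 0)"
    using degree_relations(4) by simp
  moreover have "wdegree n (mk (e + 1) 0 C 0) = wdegree n (mk 0 1 0 D)"
    using degree_relations(5) by simp
  ultimately show "(p, q) \<in> moves \<Longrightarrow> wdegree n p = wdegree n q"
    unfolding moves_def by blast
qed

lemma move_sym: "move u v \<Longrightarrow> move v u"
  by (induction rule: move.induct) (simp_all only: move.intros)

lemma move_wdegree: "move u v \<Longrightarrow> wdegree n u = wdegree n v"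
  by (induction rule: move.induct) (simp_all only: wdegree_add moves_wdegree)

lemma move_add: "move u v \<Longrightarrow> move (r + u) (r + v)"
  by (induction rule: move.induct) (simp_all only: add.left_commute[of r] move.intros)

lemma linked_add: "linked u v \<Longrightarrow> linked (r + u) (r + v)"
  by (induction rule: rtranclp_induct) (auto intro: rtranclp.rtrancl_into_rtrancl move_add)

lemma linked_sym: "linked u v \<Longrightarrow> linked v u"
  by (induction rule: rtranclp_induct) (auto intro: converse_rtranclp_into_rtranclp move_sym)

lemma linked_wdegree: "linked u v \<Longrightarrow> wdegree n u = wdegree n v"
  by (induction rule: rtranclp_induct) (auto dest: move_wdegree)

text \<open>The monomials without the first variable that are divisible by none of the five binomial
  terms without it. Their count matches the formula for \<open>n 1\<close>.\<close>

definition standard_monomials :: "(4 \<Rightarrow>\<^sub>0 nat) set" where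
  "standard_monomials = insert (mk 0 0 0 D) ((\<lambda>(b, c, d). mk 0 b c d) ` ({..B} \<times> {..C} \<times> {..<D}))"

lemma card_standard_monomials: "finite standard_monomials" "card standard_monomials \<le> n 1"
proof -
  have "card standard_monomials \<le> Suc (card ((\<lambda>(b, c, d). mk 0 b c d) ` ({..B} \<times> {..C} \<times> {..<D})))"
    unfolding standard_monomials_def by (simp add: card_insert_if)
  also have "\<dots> \<le> Suc (card ({..B} \<times> {..C} \<times> {..<D}))" by (intro Suc_le_mono[THEN iffD2] card_image_le) simp
  finally show "card standard_monomials \<le> n 1" by (simp add: card_cartesian_product n1 algebra_simps)
qed (simp add: standard_monomials_def)

lemma mk_standard_iff: "mk 0 b c d \<in> standard_monomials \<longleftrightarrow> b \<le> B \<and> c \<le> C \<and> d < D \<or> b = 0 \<and> c = 0 \<and> d = D"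
  by (force simp: standard_monomials_def image_iff)

text \<open>In each of the five binomials exactly one term avoids the first variable; replacing that
  term introduces the variable.\<close>

lemma nonstandard_linked:
  assumes "lookup u 1 = 0" "u \<notin> standard_monomials"
  shows "\<exists>v. linked u (single 1 1 + v)"
proof (cases u rule: mk_cases)
  case (1 a b c d)
  then have u: "u = mk 0 b c d" using assms(1) by simp
  have "\<exists>a' b' c' d'. 1 \<le> a' \<and> move u (mk a' b' c' d')"
  proof -
    consider "B + 1 \<le> b" | "C + 1 \<le> c" | "1 \<le> c" "D \<le> d" | "D + 1 \<le> d" | "1 \<le> b" "D \<le> d"
      using assms(2) unfolding u mk_standard_iff by linarith
    then show ?thesis
    proof cases
      case 1
      then have "move u (mk (0 + e) (b - (B + 1)) c (d + 1))" unfolding u move_mk_iff by blast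
      then show ?thesis using params(1) by (metis add_0)
    next
      case 2
      then have "move u (mk (0 + g) (b + 1) (c - (C + 1)) d)" unfolding u move_mk_iff by blast
      then show ?thesis using params(2) by (metis add_0)
    next
      case 3
      then have "move u (mk (0 + (e + g + 1)) b (c - 1) (d - D))" unfolding u move_mk_iff by blast
      then show ?thesis by (metis le_add2 add_0)
    next
      case 4
      then have "move u (mk (0 + 1) (b + B) (c + C) (d - (D + 1)))" unfolding u move_mk_iff by blast
      then show ?thesis by (metis le_add2 add_0)
    next
      case 5
      then have "move u (mk (0 + (e + 1)) (b - 1) (c + C) (d - D))" unfolding u move_mk_iff by blast
      then show ?thesis by (metis le_add2 add_0)
    qed
  qed
  then obtain a' b' c' d' where "1 \<le> a'" "move u (mk a' b' c' d')" by blast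
  moreover have "mk a' b' c' d' = single 1 1 + mk (a' - 1) b' c' d'"
    using \<open>1 \<le> a'\<close> by (simp add: single_eq_mk(1) del: One_nat_def)
  ultimately show ?thesis by (metis r_into_rtranclp)
qed

text \<open>Once the first variable is split off, the cofactor has smaller degree, so the process
  ends at a standard monomial.\<close>

lemma normal_form: "\<exists>k. \<exists>s\<in>standard_monomials. linked u (single 1 k + s)"
proof (induction "wdegree n u" arbitrary: u rule: less_induct)
  case less
  show ?case
  proof (cases "u \<in> standard_monomials")
    case True
    have "linked u (single 1 0 + u)" by simp
    then show ?thesis using True by blast
  next
    case False
    have "\<exists>v. linked u (single 1 1 + v)"
    proof (cases "lookup u 1 = 0")
      case True
      then show ?thesis using nonstandard_linked False by blast
    next
      case False
      then show ?thesis by (metis exponent_split rtranclp.rtrancl_refl)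
    qed
    then obtain v where v: "linked u (single 1 1 + v)" by blast
    then have "wdegree n v < wdegree n u" using linked_wdegree[OF v] n_pos[of 1] by (simp add: wdegree_add)
    then obtain k s where ks: "s \<in> standard_monomials" "linked v (single 1 k + s)" using less by blast
    have "linked (single 1 1 + v) (single 1 1 + (single 1 k + s))" by (rule linked_add[OF ks(2)])
    moreover have "single 1 1 + (single 1 k + s) = single 1 (1 + k) + s"
      by (simp only: single_add add.assoc)
    ultimately have "linked u (single 1 (1 + k) + s)"
      using v by (metis rtranclp_trans)
    then show ?thesis using ks(1) by blast
  qed
qed

text \<open>There are at most \<open>n 1\<close> standard monomials, and their degrees meet all residue classes
  modulo \<open>n 1\<close>; so different ones have different residues.\<close>

lemma linked_iff: "linked u v \<longleftrightarrow> wdegree n u = wdegree n v"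
proof
  assume uv: "wdegree n u = wdegree n v"
  let ?f = "\<lambda>s. wdegree n s mod n 1"
  have "{..<n 1} \<subseteq> ?f ` standard_monomials"
  proof
    fix r assume r: "r \<in> {..<n 1}"
    obtain u where u: "wdegree n u mod n 1 = r mod n 1" using residue_classes[OF gcd n_pos] by blast
    obtain k s where ks: "s \<in> standard_monomials" "linked u (single 1 k + s)" using normal_form by blast
    have "wdegree n u = k * n 1 + wdegree n s" using linked_wdegree[OF ks(2)] by (simp add: wdegree_add)
    then have "?f s = r" using u r by simp
    then show "r \<in> ?f ` standard_monomials" using ks(1) by blast
  qed
  then have "n 1 \<le> card (?f ` standard_monomials)"
    using card_mono[of "?f ` standard_monomials" "{..<n 1}"] card_standard_monomials(1) by simp
  then have "card (?f ` standard_monomials) = card standard_monomials"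
    using card_standard_monomials card_image_le[of standard_monomials ?f] by linarith
  then have inj: "inj_on ?f standard_monomials"
    using card_standard_monomials(1) by (simp add: eq_card_imp_inj_on)
  obtain k s where ks: "s \<in> standard_monomials" "linked u (single 1 k + s)" using normal_form by blast
  obtain l t where lt: "t \<in> standard_monomials" "linked v (single 1 l + t)" using normal_form by blast
  have eq: "k * n 1 + wdegree n s = l * n 1 + wdegree n t"
    using linked_wdegree[OF ks(2)] linked_wdegree[OF lt(2)] uv by (simp add: wdegree_add)
  then have "?f s = ?f t" by (metis mod_mult_self3)
  then have st: "s = t" using inj ks(1) lt(1) by (auto dest: inj_onD)
  then have "k = l" using eq n_pos[of 1] by simp
  then show "linked u v" using ks(2) linked_sym[OF lt(2)] st by (metis rtranclp_trans)
qed (rule linked_wdegree)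

text \<open>Moves reach every factorization of an element by \<open>linked_iff\<close>. Tightness
  and Apery membership of concrete monomials are decided below by exhibiting closed sets.\<close>

lemma factorizations_closed:
  assumes "u \<in> S" "\<And>x y. x \<in> S \<Longrightarrow> move x y \<Longrightarrow> y \<in> S" "wdegree n v = wdegree n u"
  shows "v \<in> S"
proof -
  have "linked u v" using assms(3) linked_iff by simp
  then show ?thesis by (induction rule: rtranclp_induct) (use assms in auto)
qed

lemma unique_factorization:
  assumes "\<And>y. \<not> move m y" "wdegree n v = wdegree n m"
  shows "v = m"
  using factorizations_closed[of m "{m}" v] assms by blast

lemma tight_of_closed:
  assumes "m \<in> S" "\<And>x y. x \<in> S \<Longrightarrow> move x y \<Longrightarrow> y \<in> S" "\<And>x. x \<in> S \<Longrightarrow> len x \<le> len m"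
  shows "tight n m"
  unfolding tight_def using factorizations_closed[of m S, OF assms(1)] assms(2,3) by blast

lemma apery_of_closed:
  assumes "m \<in> S" "\<And>x y. x \<in> S \<Longrightarrow> move x y \<Longrightarrow> y \<in> S" "\<And>x. x \<in> S \<Longrightarrow> lookup x i = 0"
  shows "apery_mon n i m"
  unfolding apery_mon_def using factorizations_closed[of m S, OF assms(1)] assms(2,3) by blast

lemma tight_of_isolated: "(\<And>y. \<not> move m y) \<Longrightarrow> tight n m"
  by (rule tight_of_closed[of _ "{m}"]) auto

lemma apery_of_isolated: "(\<And>y. \<not> move m y) \<Longrightarrow> lookup m i = 0 \<Longrightarrow> apery_mon n i m"
  by (rule apery_of_closed[of _ "{m}"]) auto

lemma not_apery_of_move: "move m v \<Longrightarrow> lookup v i \<noteq> 0 \<Longrightarrow> \<not> apery_mon n i m"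
  using move_wdegree[of m v] by (auto simp: apery_mon_def)

text \<open>For \<open>i \<noteq> 1\<close> exactly one of the five generators has no term divisible by the variable \<open>i\<close>;
  the two terms of this generator have the same length.\<close>

definition special_homogeneous :: "4 \<Rightarrow> bool" where
  "special_homogeneous i \<longleftrightarrow> (i = 2 \<longrightarrow> e + g = D) \<and> (i = 3 \<longrightarrow> B = e) \<and> (i = 4 \<longrightarrow> C = g)"

text \<open>A move between two monomials without \<open>i\<close> must use the special binomial, and
  for \<open>i = 1\<close> there is no such move.\<close>

lemma move_len:
  assumes "special_homogeneous i" "move u v" "lookup u i = 0" "lookup v i = 0"
  shows "len u = len v"
proof (cases u rule: mk_cases)
  case (1 a b c d)
  note m = assms(2)[unfolded 1 move_mk_iff]
  show ?thesis using m assms(1,3,4) exhaust_4[of i] params unfolding 1 special_homogeneous_def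
    by (elim disjE) auto
qed

text \<open>The set consists of \<open>mk p q 0 r\<close> and what arises from it by trading
  \<open>X1^e * X4\<close> for \<open>X2^(B+1)\<close> exactly \<open>k\<close> times. The bounds
  exclude the other binomials throughout the chain.\<close>

lemma chain_closed_3:
  assumes "p < e + g" "r \<le> D" "q \<le> B" "q \<ge> 1 \<longrightarrow> p < g \<and> r < D"
    and x: "\<exists>a b d k. x = mk a b 0 d \<and> a + k * e = p \<and> b = q + k * (B + 1) \<and> d + k = r" and m: "move x y"
  shows "\<exists>a b d k. y = mk a b 0 d \<and> a + k * e = p \<and> b = q + k * (B + 1) \<and> d + k = r"
proof -
  obtain a b d k where x: "x = mk a b 0 d" "a + k * e = p" "b = q + k * (B + 1)" "d + k = r" using x by blast
  have "a < g \<and> d < D" if "b \<ge> 1"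
  proof (cases k)
    case (Suc l)
    then show ?thesis using x assms(1,2) by simp
  qed (use x assms that in simp)
  moreover have "a < e + g + 1" "d \<le> D" using x assms by simp_all
  ultimately consider "B + 1 \<le> b" "y = mk (a + e) (b - (B + 1)) 0 (d + 1)"
    | "e \<le> a" "1 \<le> d" "y = mk (a - e) (b + (B + 1)) 0 (d - 1)"
    using m[unfolded x(1) move_mk_iff] params by (elim disjE conjE) (simp_all del: mk_eq_iff)
  then show ?thesis
  proof cases
    case 1
    then obtain l where l: "k = Suc l" using x(3) assms(3) by (cases k) auto
    show ?thesis
      by (intro exI[of _ "a + e"] exI[of _ "b - (B + 1)"] exI[of _ "d + 1"] exI[of _ l])
        (use 1 x l in simp)
  next
    case 2
    show ?thesis
      by (intro exI[of _ "a - e"] exI[of _ "b + (B + 1)"] exI[of _ "d - 1"] exI[of _ "Suc k"])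
        (use 2 x in simp)
  qed
qed

text \<open>The same with the third binomial: \<open>X1^g * X2\<close> is traded for
  \<open>X3^(C+1)\<close>, starting from \<open>mk p q r 0\<close>. The condition for
  \<open>r = C\<close> keeps the fourth and fifth binomials away.\<close>

lemma chain_closed_4:
  assumes "p \<le> e + g" "q \<le> B" "r \<le> C" "r = C \<longrightarrow> p \<le> e \<and> q < B"
    and x: "\<exists>a b c k. x = mk a b c 0 \<and> a + k * g = p \<and> b + k = q \<and> c = r + k * (C + 1)" and m: "move x y"
  shows "\<exists>a b c k. y = mk a b c 0 \<and> a + k * g = p \<and> b + k = q \<and> c = r + k * (C + 1)"
proof -
  obtain a b c k where x: "x = mk a b c 0" "a + k * g = p" "b + k = q" "c = r + k * (C + 1)" using x by blast
  have "a \<le> e \<and> b < B" if "C \<le> c"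
  proof (cases k)
    case (Suc l)
    then show ?thesis using x assms(1,2) by simp
  qed (use x assms that in simp)
  moreover have "a \<le> e + g" "b \<le> B" using x assms by simp_all
  ultimately consider "C + 1 \<le> c" "y = mk (a + g) (b + 1) (c - (C + 1)) 0"
    | "g \<le> a" "1 \<le> b" "y = mk (a - g) (b - 1) (c + (C + 1)) 0"
    using m[unfolded x(1) move_mk_iff] params by (elim disjE conjE) (simp_all del: mk_eq_iff)
  then show ?thesis
  proof cases
    case 1
    then obtain l where l: "k = Suc l" using x(4) assms(3) by (cases k) auto
    show ?thesis
      by (intro exI[of _ "a + g"] exI[of _ "b + 1"] exI[of _ "c - (C + 1)"] exI[of _ l])
        (use 1 x l in simp)
  next
    case 2
    show ?thesis
      by (intro exI[of _ "a - g"] exI[of _ "b - 1"] exI[of _ "c + (C + 1)"] exI[of _ "Suc k"])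
        (use 2 x in simp)
  qed
qed

text \<open>The terms of the special binomial are the only factorizations of their degree, which
  therefore lies in the Apery set and forces equal lengths. Conversely, moves within an Apery degree
  avoid \<open>i\<close> and preserve the length.\<close>

lemma homogeneous_iff:
  assumes i: "n i = Min (range n)"
  shows "homogeneous_semigroup n \<longleftrightarrow> special_homogeneous i"
proof
  assume "homogeneous_semigroup n"
  then have h: "len m' = len m" if "apery_mon n i m" "wdegree n m' = wdegree n m" for m m'
    using that unfolding homogeneous_semigroup_iff[OF i] by blast
  have "e + g = D" if "i = 2"
  proof -
    let ?S = "{mk (e + g + 1) 0 0 0, mk 0 0 1 D}"
    have "apery_mon n i (mk (e + g + 1) 0 0 0)"
      by (rule apery_of_closed[of _ ?S]) (use params that in \<open>auto simp: move_mk_iff\<close>)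
    then show ?thesis using h[of "mk (e + g + 1) 0 0 0" "mk 0 0 1 D"] degree_relations by simp
  qed
  moreover have "B = e" if "i = 3"
  proof -
    let ?S = "{mk 0 (B + 1) 0 0, mk e 0 0 1}"
    have "apery_mon n i (mk 0 (B + 1) 0 0)"
      by (rule apery_of_closed[of _ ?S]) (use params that in \<open>auto simp: move_mk_iff\<close>)
    then show ?thesis using h[of "mk 0 (B + 1) 0 0" "mk e 0 0 1"] degree_relations by simp
  qed
  moreover have "C = g" if "i = 4"
  proof -
    let ?S = "{mk 0 0 (C + 1) 0, mk g 1 0 0}"
    have "apery_mon n i (mk 0 0 (C + 1) 0)"
      by (rule apery_of_closed[of _ ?S]) (use params that in \<open>auto simp: move_mk_iff\<close>)
    then show ?thesis using h[of "mk 0 0 (C + 1) 0" "mk g 1 0 0"] degree_relations by simp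
  qed
  ultimately show "special_homogeneous i" by (simp add: special_homogeneous_def)
next
  assume special: "special_homogeneous i"
  show "homogeneous_semigroup n"
    unfolding homogeneous_semigroup_iff[OF i]
  proof (intro allI impI)
    fix m m' assume m: "apery_mon n i m" "wdegree n m' = wdegree n m"
    then have "linked m m'" by (simp add: linked_iff)
    then show "len m' = len m"
    proof (induction rule: rtranclp_induct)
      case (step y z)
      have "wdegree n y = wdegree n m" "wdegree n z = wdegree n m"
        using linked_wdegree[OF step(1)] move_wdegree[OF step(2)] by simp_all
      then have "lookup y i = 0" "lookup z i = 0" using m(1) by (simp_all add: apery_mon_def)
      then show ?case using move_len[OF special step(2)] step(3) by simp
    qed simp
  qed
qed

text \<open>If the two terms have different lengths, then dividing the shorter one, or a suitable multiple of it,
  by one of its variables \<open>j\<close> gives an additional socle element \<open>m\<close> of the tangent cone modulo the variable \<open>i\<close>: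
  multiplying \<open>m\<close> by \<open>j\<close> does not leave the Apery set, but the product has the longer factorization \<open>v\<close>.\<close>

lemma special_homogeneous_if_type:
  assumes reg: "param_regular n i" and type: "homogeneous_type TYPE('k::field) n"
  shows "special_homogeneous i"
proof -
  have contradiction: False
    if "apery_mon n i m" "tight n m" "j \<noteq> i" "apery_mon n i (m + single j 1)"
      "move (m + single j 1) v" "len (m + single j 1) < len v"
      "\<And>l. l \<noteq> i \<Longrightarrow> l \<noteq> j \<Longrightarrow> \<not> apery_mon n i (m + single l 1)" for m v j
  proof -
    have "\<not> tight n (m + single j 1)" using move_wdegree[OF that(5)] that(6) by (auto simp: tight_def not_le)
    then show False using homogeneous_type_maximal[OF reg type that(1,2) _ that(3)] that(4,7) by blast
  qed
  have "e + g = D" if i: "i = 2"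
  proof (rule ccontr)
    assume "e + g \<noteq> D"
    then consider "e + g < D" | "D < e + g" by linarith
    then show False
    proof cases
      case 1
      \<comment> \<open>Variable 1 completes a term of the first binomial, which lengthens it. The
        exponent \<open>C - 1\<close> lets variable 3 complete a term of the fifth binomial, and
        variable 4 one of the second; both produce variable 2.\<close>
      let ?m = "mk (e + g) 0 (C - 1) 0" and ?S = "{mk (e + g + 1) 0 (C - 1) 0, mk 0 0 C D}"
      show False
      proof (rule contradiction[of ?m 1 "mk 0 0 C D"])
        show "apery_mon n i ?m" "tight n ?m"
          using params i by (auto simp: move_mk_iff intro!: apery_of_isolated tight_of_isolated)
        show "apery_mon n i (?m + single 1 1)"
          by (rule apery_of_closed[of _ ?S]) (use params i in \<open>auto simp: move_mk_iff single_eq_mk\<close>)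
        have "move (?m + single 3 1) (mk (e + g - (e + 1)) (0 + 1) (C - C) (0 + D))"
          "move (?m + single 4 1) (mk (e + g - e) (0 + (B + 1)) (C - 1) (1 - 1))"
          using params by (simp_all add: move_mk_iff single_eq_mk)
        from this[THEN not_apery_of_move, of i] show "\<not> apery_mon n i (?m + single l 1)" if "l \<noteq> i" "l \<noteq> 1" for l
          using that i exhaust_4[of l] by auto
      qed (use i 1 params in \<open>auto simp: move_mk_iff single_eq_mk\<close>)
    next
      case 2
      \<comment> \<open>The first binomial in the other direction, completed by variable 3. The
        exponent \<open>e - 1\<close> lets variable 1 complete a term of the second binomial;
        variable 4 uses the fourth.\<close>
      let ?m = "mk (e - 1) 0 0 D" and ?v = "mk (2 * e + g) 0 0 0"
      let ?S = "{mk (e - 1) 0 1 D, ?v}"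
      show False
      proof (rule contradiction[of ?m 3 ?v])
        show "apery_mon n i ?m" "tight n ?m"
          using params i by (auto simp: move_mk_iff intro!: apery_of_isolated tight_of_isolated)
        show "apery_mon n i (?m + single 3 1)"
          by (rule apery_of_closed[of _ ?S]) (use params i in \<open>auto simp: move_mk_iff single_eq_mk\<close>)
        have "move (?m + single 1 1) (mk (e - e) (0 + (B + 1)) 0 (D - 1))"
          "move (?m + single 4 1) (mk (e - 1 + 1) (0 + B) (0 + C) (D + 1 - (D + 1)))"
          using params by (simp_all add: move_mk_iff single_eq_mk)
        from this[THEN not_apery_of_move, of i] show "\<not> apery_mon n i (?m + single l 1)" if "l \<noteq> i" "l \<noteq> 3" for l
          using that i exhaust_4[of l] params by auto
      qed (use i 2 params in \<open>auto simp: move_mk_iff single_eq_mk\<close>)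
    qed
  qed
  moreover have "B = e" if i: "i = 3"
  proof (rule ccontr)
    assume "B \<noteq> e"
    then consider "B < e" | "e < B" by linarith
    then show False
    proof cases
      case 1
      \<comment> \<open>Variable 2 completes \<open>X2^(B+1)\<close>, which the second binomial
        lengthens. The exponents \<open>g - 1\<close> and \<open>D - 1\<close> let variables 1 and 4
        complete terms of the third and fifth. More trades along the second binomial may be
        possible, hence chains instead of two-element sets.\<close>
      let ?m = "mk (g - 1) B 0 (D - 1)" and ?v = "mk (e + g - 1) 0 0 D"
      let ?S = "{x. \<exists>a b d k. x = mk a b 0 d \<and> a + k * e = g - 1 \<and> b = B + k * (B + 1) \<and> d + k = D - 1}"
      let ?T = "{x. \<exists>a b d k. x = mk a b 0 d \<and> a + k * e = e + g - 1 \<and> b = 0 + k * (B + 1) \<and> d + k = D}"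
      have S: "y \<in> ?S" if "x \<in> ?S" "move x y" for x y
        using chain_closed_3[of "g - 1" "D - 1" B x y] that params by simp
      have T: "y \<in> ?T" if "x \<in> ?T" "move x y" for x y
        using chain_closed_3[of "e + g - 1" D 0 x y] that params by simp
      have mS: "?m \<in> ?S" by (auto intro!: exI[of _ 0])
      have mT: "?m + single 2 1 \<in> ?T" using params by (auto simp: single_eq_mk intro!: exI[of _ 1])
      show False
      proof (rule contradiction[of ?m 2 ?v])
        show "apery_mon n i ?m" by (rule apery_of_closed[of _ ?S, OF mS S]) (use i in auto)
        have le: "len x \<le> len ?m" if xS: "x \<in> ?S" for x
        proof -
          obtain a b d k where x: "x = mk a b 0 d" "a + k * e = g - 1" "b = B + k * (B + 1)" "d + k = D - 1" using xS by blast
          have "k * (B + 1) \<le> k * e" using 1 by (intro mult_le_mono2) simp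
          then show ?thesis using x by simp
        qed
        show "tight n ?m" by (rule tight_of_closed[of _ ?S, OF mS S le])
        show "apery_mon n i (?m + single 2 1)" by (rule apery_of_closed[of _ ?T, OF mT T]) (use i in auto)
        have "move (?m + single 1 1) (mk (g - g) (B - 1) (0 + (C + 1)) (D - 1))"
          "move (?m + single 4 1) (mk (g - 1 + (e + 1)) (B - 1) (0 + C) (D - D))"
          using params by (simp_all add: move_mk_iff single_eq_mk)
        from this[THEN not_apery_of_move, of i] show "\<not> apery_mon n i (?m + single l 1)" if "l \<noteq> i" "l \<noteq> 2" for l
          using that i exhaust_4[of l] params by auto
      qed (use i 1 params in \<open>auto simp: move_mk_iff single_eq_mk\<close>)
    next
      case 2
      \<comment> \<open>The second binomial in the other direction; variables 2 and 4 leave the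
        Apery set through the fifth and fourth.\<close>
      let ?m = "mk (e - 1) 0 0 D" and ?v = "mk 0 (B + 1) 0 (D - 1)"
      let ?S = "{mk e 0 0 D, ?v}"
      show False
      proof (rule contradiction[of ?m 1 ?v])
        show "apery_mon n i ?m" "tight n ?m"
          using params i by (auto simp: move_mk_iff intro!: apery_of_isolated tight_of_isolated)
        show "apery_mon n i (?m + single 1 1)"
          by (rule apery_of_closed[of _ ?S]) (use params i in \<open>auto simp: move_mk_iff single_eq_mk\<close>)
        have "move (?m + single 2 1) (mk (e - 1 + (e + 1)) (1 - 1) (0 + C) (D - D))"
          "move (?m + single 4 1) (mk (e - 1 + 1) (0 + B) (0 + C) (D + 1 - (D + 1)))"
          using params by (simp_all add: move_mk_iff single_eq_mk)
        from this[THEN not_apery_of_move, of i] show "\<not> apery_mon n i (?m + single l 1)" if "l \<noteq> i" "l \<noteq> 1" for l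
          using that i exhaust_4[of l] params by auto
      qed (use i 2 params in \<open>auto simp: move_mk_iff single_eq_mk\<close>)
    qed
  qed
  moreover have "C = g" if i: "i = 4"
  proof (rule ccontr)
    assume "C \<noteq> g"
    then consider "C < g" | "g < C" by linarith
    then show False
    proof cases
      case 1
      \<comment> \<open>Variable 3 completes \<open>X3^(C+1)\<close>; variables 1 and 2 complete
        terms of the fifth and fourth binomials, which produce variable 4. Repeated trades along the
        third binomial again call for chains.\<close>
      let ?m = "mk e (B - 1) C 0" and ?v = "mk (e + g) B 0 0"
      let ?S = "{x. \<exists>a b c k. x = mk a b c 0 \<and> a + k * g = e \<and> b + k = B - 1 \<and> c = C + k * (C + 1)}"
      let ?T = "{x. \<exists>a b c k. x = mk a b c 0 \<and> a + k * g = e + g \<and> b + k = B \<and> c = 0 + k * (C + 1)}"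
      have S: "y \<in> ?S" if "x \<in> ?S" "move x y" for x y
        using chain_closed_4[of e "B - 1" C x y] that params by simp
      have T: "y \<in> ?T" if "x \<in> ?T" "move x y" for x y
        using chain_closed_4[of "e + g" B 0 x y] that params by simp
      have mS: "?m \<in> ?S" by (auto intro!: exI[of _ 0])
      have mT: "?m + single 3 1 \<in> ?T" using params by (auto simp: single_eq_mk intro!: exI[of _ 1])
      show False
      proof (rule contradiction[of ?m 3 ?v])
        show "apery_mon n i ?m" by (rule apery_of_closed[of _ ?S, OF mS S]) (use i in auto)
        have le: "len x \<le> len ?m" if xS: "x \<in> ?S" for x
        proof -
          obtain a b c k where x: "x = mk a b c 0" "a + k * g = e" "b + k = B - 1" "c = C + k * (C + 1)" using xS by blast
          have "k * (C + 1) \<le> k * g" using 1 by (intro mult_le_mono2) simp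
          then show ?thesis using x by simp
        qed
        show "tight n ?m" by (rule tight_of_closed[of _ ?S, OF mS S le])
        show "apery_mon n i (?m + single 3 1)" by (rule apery_of_closed[of _ ?T, OF mT T]) (use i in auto)
        have "move (?m + single 1 1) (mk (e + 1 - (e + 1)) (B - 1 + 1) (C - C) (0 + D))"
          "move (?m + single 2 1) (mk (e - 1) (B - B) (C - C) (0 + (D + 1)))"
          using params by (simp_all add: move_mk_iff single_eq_mk)
        from this[THEN not_apery_of_move, of i] show "\<not> apery_mon n i (?m + single l 1)" if "l \<noteq> i" "l \<noteq> 3" for l
          using that i exhaust_4[of l] params by auto
      qed (use i 1 params in \<open>auto simp: move_mk_iff single_eq_mk\<close>)
    next
      case 2
      \<comment> \<open>Variable 2 completes \<open>X1^g * X2\<close>, while variables 1 and 3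
        complete terms of the first and fifth binomials.\<close>
      let ?m = "mk (e + g) 0 (C - 1) 0" and ?v = "mk e 0 (2 * C) 0"
      let ?S = "{mk (e + g) 1 (C - 1) 0, ?v}"
      show False
      proof (rule contradiction[of ?m 2 ?v])
        show "apery_mon n i ?m" "tight n ?m"
          using params i by (auto simp: move_mk_iff intro!: apery_of_isolated tight_of_isolated)
        show "apery_mon n i (?m + single 2 1)"
          by (rule apery_of_closed[of _ ?S]) (use params i in \<open>auto simp: move_mk_iff single_eq_mk\<close>)
        have "move (?m + single 1 1) (mk (e + g + 1 - (e + g + 1)) 0 (C - 1 + 1) (0 + D))"
          "move (?m + single 3 1) (mk (e + g - (e + 1)) (0 + 1) (C - C) (0 + D))"
          using params by (simp_all add: move_mk_iff single_eq_mk)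
        from this[THEN not_apery_of_move, of i] show "\<not> apery_mon n i (?m + single l 1)" if "l \<noteq> i" "l \<noteq> 2" for l
          using that i exhaust_4[of l] params by auto
      qed (use i 2 params in \<open>auto simp: move_mk_iff single_eq_mk\<close>)
    qed
  qed
  ultimately show ?thesis by (simp add: special_homogeneous_def)
qed

text \<open>An isolated factorization is tight and stays so after adding copies of a regular
  \<open>i\<close>. Applied to a binomial with a term \<open>X_i^k * m\<close>, this says that the
  other term is not longer.\<close>

lemma len_le_of_param_regular:
  assumes reg: "param_regular n i" and unique: "\<And>y. \<not> move m y"
    and deg: "wdegree n m' = wdegree n (single i k + m)"
  shows "len m' \<le> k + len m"
proof -
  have "tight n m" using unique by (rule tight_of_isolated)
  then have "tight n (single i k + m)"
  proof (induction k)
    case (Suc k)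
    then have "tight n (single i 1 + (single i k + m))" using reg by (simp add: param_regular_def)
    then show ?case by (simp flip: add.assoc single_add)
  qed simp
  then show ?thesis using deg by (auto simp: tight_def wdegree_add)
qed

section \<open>Length inequalities for each position of the multiplicity\<close>

lemma len_inequalities_1:
  assumes reg: "param_regular n 1"
  shows "D \<le> e + g" "B \<le> e" "C \<le> g" "D \<le> B + C" "D \<le> e + C"
proof -
  show "D \<le> e + g"
    using len_le_of_param_regular[OF reg, of "mk 0 0 0 0" "mk 0 0 1 D" "e + g + 1"] degree_relations(1) params
    by (simp add: single_eq_mk move_mk_iff)
  show "B \<le> e"
    using len_le_of_param_regular[OF reg, of "mk 0 0 0 1" "mk 0 (B + 1) 0 0" e] degree_relations(2) params
    by (simp add: single_eq_mk move_mk_iff)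
  show "C \<le> g"
    using len_le_of_param_regular[OF reg, of "mk 0 1 0 0" "mk 0 0 (C + 1) 0" g] degree_relations(3) params
    by (simp add: single_eq_mk move_mk_iff)
  show "D \<le> B + C"
    using len_le_of_param_regular[OF reg, of "mk 0 B C 0" "mk 0 0 0 (D + 1)" 1] degree_relations(4) params
    by (simp add: single_eq_mk move_mk_iff)
  show "D \<le> e + C"
    using len_le_of_param_regular[OF reg, of "mk 0 0 C 0" "mk 0 1 0 D" "e + 1"] degree_relations(5) params
    by (simp add: single_eq_mk move_mk_iff)
qed

lemma len_inequalities_2:
  assumes reg: "param_regular n 2"
  shows "e \<le> B" "C \<le> g" "D \<le> B + C" "e + C \<le> D"
proof -
  show "e \<le> B"
    using len_le_of_param_regular[OF reg, of "mk 0 0 0 0" "mk e 0 0 1" "B + 1"] degree_relations(2) params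
    by (simp add: single_eq_mk move_mk_iff)
  show "C \<le> g"
    using len_le_of_param_regular[OF reg, of "mk g 0 0 0" "mk 0 0 (C + 1) 0" 1] degree_relations(3) params
    by (simp add: single_eq_mk move_mk_iff)
  show "D \<le> B + C"
    using len_le_of_param_regular[OF reg, of "mk 1 0 C 0" "mk 0 0 0 (D + 1)" B] degree_relations(4) params
    by (simp add: single_eq_mk move_mk_iff)
  show "e + C \<le> D"
    using len_le_of_param_regular[OF reg, of "mk 0 0 0 D" "mk (e + 1) 0 C 0" 1] degree_relations(5) params
    by (simp add: single_eq_mk move_mk_iff)
qed

lemma len_inequalities_3:
  assumes reg: "param_regular n 3"
  shows "e + g \<le> D" "g \<le> C" "D \<le> e + C"
proof -
  show "e + g \<le> D"
    using len_le_of_param_regular[OF reg, of "mk 0 0 0 D" "mk (e + g + 1) 0 0 0" 1] degree_relations(1) params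
    by (simp add: single_eq_mk move_mk_iff)
  show "g \<le> C"
    using len_le_of_param_regular[OF reg, of "mk 0 0 0 0" "mk g 1 0 0" "C + 1"] degree_relations(3) params
    by (simp add: single_eq_mk move_mk_iff)
  show "D \<le> e + C"
    using len_le_of_param_regular[OF reg, of "mk (e + 1) 0 0 0" "mk 0 1 0 D" C] degree_relations(5) params
    by (simp add: single_eq_mk move_mk_iff)
qed

lemma len_inequalities_4:
  assumes reg: "param_regular n 4"
  shows "e + g \<le> D" "B \<le> e" "B + C \<le> D" "e + C \<le> D"
proof -
  show "e + g \<le> D"
    using len_le_of_param_regular[OF reg, of "mk 0 0 1 0" "mk (e + g + 1) 0 0 0" D] degree_relations(1) params
    by (simp add: single_eq_mk move_mk_iff)
  show "B \<le> e"
    using len_le_of_param_regular[OF reg, of "mk e 0 0 0" "mk 0 (B + 1) 0 0" 1] degree_relations(2) params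
    by (simp add: single_eq_mk move_mk_iff)
  show "B + C \<le> D"
    using len_le_of_param_regular[OF reg, of "mk 0 0 0 0" "mk 1 B C 0" "D + 1"] degree_relations(4) params
    by (simp add: single_eq_mk move_mk_iff)
  show "e + C \<le> D"
    using len_le_of_param_regular[OF reg, of "mk 0 1 0 0" "mk (e + 1) 0 C 0" D] degree_relations(5) params
    by (simp add: single_eq_mk move_mk_iff)
qed

end

section \<open>Parameters and distinctness of the generators\<close>

lemma pseudo_symmetric_komeda:
  assumes "pseudo_symmetric_4_generated n"
  obtains e g B C D where "komeda n e g B C D"
proof -
  obtain \<alpha> :: "4 \<Rightarrow> int" and a21 :: int where a: "\<And>i. \<alpha> i > 1" "0 < a21" "a21 < \<alpha> 1 - 1"
    and n: "int (n 1) = \<alpha> 2 * \<alpha> 3 * (\<alpha> 4 - 1) + 1"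
      "int (n 2) = a21 * \<alpha> 3 * \<alpha> 4 + (\<alpha> 1 - a21 - 1) * (\<alpha> 3 - 1) + \<alpha> 3"
      "int (n 3) = \<alpha> 1 * \<alpha> 4 + (\<alpha> 1 - a21 - 1) * (\<alpha> 2 - 1) * (\<alpha> 4 - 1) - \<alpha> 4 + 1"
      "int (n 4) = \<alpha> 1 * \<alpha> 2 * (\<alpha> 3 - 1) + a21 * (\<alpha> 2 - 1) + \<alpha> 2"
    and min: "minimally_generated n"
    using assms unfolding pseudo_symmetric_4_generated_def by blast
  define e g B C D where "e = nat a21" and "g = nat (\<alpha> 1 - a21 - 1)" and "B = nat (\<alpha> 2 - 1)"
    and "C = nat (\<alpha> 3 - 1)" and "D = nat (\<alpha> 4 - 1)"
  note defs = this
  have i: "a21 = int e" "\<alpha> 1 = int e + int g + 1" "\<alpha> 2 = int B + 1" "\<alpha> 3 = int C + 1" "\<alpha> 4 = int D + 1"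
    using a(2,3) a(1)[of 2] a(1)[of 3] a(1)[of 4] by (simp_all add: defs)
  have "komeda n e g B C D"
  proof
    show "e \<ge> 1" "g \<ge> 1" "B \<ge> 1" "C \<ge> 1" "D \<ge> 1"
      using a(2,3) a(1)[of 2] a(1)[of 3] a(1)[of 4] by (simp_all add: defs)
    have "int (n 1) = int ((B + 1) * (C + 1) * D + 1)"
      unfolding n i by (simp add: algebra_simps)
    then show "n 1 = (B + 1) * (C + 1) * D + 1" by (simp only: of_nat_eq_iff)
    have "int (n 2) = int (e * (C + 1) * (D + 1) + g * C + C + 1)"
      unfolding n i by (simp add: algebra_simps)
    then show "n 2 = e * (C + 1) * (D + 1) + g * C + C + 1" by (simp only: of_nat_eq_iff)
    have "int (n 3) = int ((e + g) * (D + 1) + g * B * D + 1)"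
      unfolding n i by (simp add: algebra_simps)
    then show "n 3 = (e + g) * (D + 1) + g * B * D + 1" by (simp only: of_nat_eq_iff)
    have "int (n 4) = int ((e + g + 1) * (B + 1) * C + e * B + B + 1)"
      unfolding n i by (simp add: algebra_simps)
    then show "n 4 = (e + g + 1) * (B + 1) * C + e * B + B + 1" by (simp only: of_nat_eq_iff)
    show "Gcd (range n) = 1" using min by (simp add: minimally_generated_def)
  qed
  then show ?thesis by (rule that)
qed

text \<open>Of two equal generators one could absorb the coefficient of the other, against
  minimality. Distinctness makes the multiplicity strictly smallest.\<close>

lemma minimally_generated_inj:
  assumes "minimally_generated n"
  shows "inj n"
proof (rule injI, rule ccontr)
  fix i j assume ij: "n i = n j" "i \<noteq> j"
  have "semigroup_on (UNIV - {j}) n = semigroup_of n"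
  proof (intro equalityI subsetI)
    fix s assume "s \<in> semigroup_on (UNIV - {j}) n"
    then obtain u where "s = (\<Sum>l\<in>UNIV - {j}. u l * n l)" by (auto simp: semigroup_on_def)
    also have "\<dots> = (\<Sum>l\<in>UNIV. (if l = j then 0 else u l) * n l)"
      by (rule sum.mono_neutral_cong_left) auto
    finally have "\<exists>u. s = (\<Sum>l\<in>UNIV. u l * n l)" by (rule exI[of _ "\<lambda>l. if l = j then 0 else u l"])
    then show "s \<in> semigroup_of n" by (simp add: semigroup_on_def)
  next
    fix s assume "s \<in> semigroup_of n"
    then obtain u where "s = (\<Sum>l\<in>UNIV. u l * n l)" by (auto simp: semigroup_on_def)
    also have "\<dots> = u j * n j + (u i * n i + (\<Sum>l\<in>UNIV - {j} - {i}. u l * n l))"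
      using ij(2) by (simp add: sum.remove[of UNIV j] sum.remove[of "UNIV - {j}" i])
    also have "\<dots> = (u i + u j) * n i + (\<Sum>l\<in>UNIV - {j} - {i}. (u(i := u i + u j)) l * n l)"
      using ij(1) by (simp add: distrib_right)
    also have "\<dots> = (\<Sum>l\<in>UNIV - {j}. (u(i := u i + u j)) l * n l)"
      using ij(2) by (simp add: sum.remove[of "UNIV - {j}" i])
    finally have "\<exists>u. s = (\<Sum>l\<in>UNIV - {j}. u l * n l)" by (rule exI[of _ "u(i := u i + u j)"])
    then show "s \<in> semigroup_on (UNIV - {j}) n" by (simp add: semigroup_on_def)
  qed
  moreover have "UNIV - {j} \<subset> UNIV" by blast
  ultimately show False using assms unfolding minimally_generated_def by blast
qed

section \<open>The resolution of the semigroup ring\<close>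

lemma is_complexI:
  assumes "\<And>i k l. k < b i \<Longrightarrow> l < b (Suc (Suc i)) \<Longrightarrow> (\<Sum>j<b (Suc i). \<Phi> i k j * \<Phi> (Suc i) j l) = 0"
  shows "is_complex b \<Phi>"
  unfolding is_complex_def
proof (intro allI ext)
  fix i v k
  have "(\<Sum>j<b (Suc i). \<Phi> i k j * (\<Sum>l<b (Suc (Suc i)). \<Phi> (Suc i) j l * v l)) = 0" if k: "k < b i"
  proof -
    have "(\<Sum>j<b (Suc i). \<Phi> i k j * (\<Sum>l<b (Suc (Suc i)). \<Phi> (Suc i) j l * v l)) =
        (\<Sum>l<b (Suc (Suc i)). (\<Sum>j<b (Suc i). \<Phi> i k j * \<Phi> (Suc i) j l) * v l)"
      by (simp add: sum_distrib_left sum_distrib_right mult.assoc) (rule sum.swap)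
    then show ?thesis using assms[OF k] by simp
  qed
  then show "matrix_map (b i) (b (Suc i)) (\<Phi> i) (matrix_map (b (Suc i)) (b (Suc (Suc i))) (\<Phi> (Suc i)) v) k = 0"
    by (simp add: matrix_map_def)
qed

section \<open>Syzygies of monomials by division with remainder\<close>

lemma single_le_iff: "(\<exists>s. m = single i k + s) \<longleftrightarrow> k \<le> lookup (m :: 'v \<Rightarrow>\<^sub>0 nat) i"
proof
  assume "k \<le> lookup m i"
  then have "m = single i k + (m - single i k)"
    by (intro poly_mapping_eqI) (auto simp: lookup_add lookup_minus lookup_single when_def)
  then show "\<exists>s. m = single i k + s" ..
qed (auto simp: lookup_add)

lemma monomial_division:
  fixes p :: "('v, 'k::comm_ring_1) mpoly"
  obtains u r where "p = mon (single i k) * u + r" "\<And>m. m \<in> keys r \<Longrightarrow> lookup m i < k"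
proof -
  have "mon (single i k) dvd keep {m. k \<le> lookup m i} p"
    unfolding mon_dvd_iff by (auto simp: keys_keep single_le_iff)
  then obtain u where "keep {m. k \<le> lookup m i} p = mon (single i k) * u" by (auto simp: dvd_def)
  moreover have "p = keep {m. k \<le> lookup m i} p + keep {m. lookup m i < k} p"
    by (rule poly_mapping_eqI) (simp add: lookup_add)
  ultimately have "p = mon (single i k) * u + keep {m. lookup m i < k} p" by simp
  then show ?thesis by (rule that) (simp add: keys_keep)
qed

lemma monomial_remainder_unique:
  fixes u r :: "('v, 'k::comm_ring_1) mpoly"
  assumes "mon (single i k) * u + r = 0" "\<And>m. m \<in> keys r \<Longrightarrow> lookup m i < k"
  shows "u = 0" "r = 0"
proof -
  have r: "r = mon (single i k) * (- u)" using assms(1) by (simp add: add_eq_0_iff)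
  then have "mon (single i k) dvd r" by (rule dvdI)
  then have "\<forall>m\<in>keys r. k \<le> lookup m i" unfolding mon_dvd_iff by (metis single_le_iff)
  then have "keys r = {}" using assms(2) by (metis all_not_in_conv not_le)
  then show "r = 0" by simp
  then show "u = 0" using assms(1) by (simp add: mon_mult_eq_0_iff)
qed

lemma monomial_coprime:
  fixes p q :: "('v, 'k::comm_ring_1) mpoly"
  assumes "mon (single i k) * p = mon (single j l) * q" "i \<noteq> j"
  obtains h where "p = mon (single j l) * h" "q = mon (single i k) * h"
proof -
  have "mon (single j l) dvd p" unfolding mon_dvd_iff
  proof
    fix m assume "m \<in> keys p"
    then have "single i k + m \<in> keys (mon (single j l) * q)" by (simp flip: assms(1) add: keys_mon_mult)
    then have "\<exists>s. single i k + m = single j l + s" by (auto simp: keys_mon_mult)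
    then have "l \<le> lookup (single i k + m) j" by (simp only: single_le_iff)
    then show "\<exists>r. m = single j l + r" using assms(2) by (simp add: single_le_iff lookup_add lookup_single when_def)
  qed
  then obtain h where h: "p = mon (single j l) * h" by (auto simp: dvd_def)
  have "mon (single j l) * q = mon (single j l) * (mon (single i k) * h)"
    using assms(1) by (simp add: h mult_ac)
  then show ?thesis using that h by (simp add: mon_mult_cancel)
qed

lemma keys_add_mon_mult_less:
  fixes p q :: "('v, 'k::comm_ring_1) mpoly"
  assumes "\<And>m. m \<in> keys p \<Longrightarrow> lookup m i < k" "\<And>m. m \<in> keys q \<Longrightarrow> lookup m i < k" "a \<noteq> i" "b \<noteq> i"
    and "m \<in> keys (mon (single a c) * p + mon (single b d) * q)"
  shows "lookup m i < k"
proof -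
  have "m \<in> (+) (single a c) ` keys p \<union> (+) (single b d) ` keys q"
    using assms(5) keys_add[of "mon (single a c) * p" "mon (single b d) * q"] by (auto simp: keys_mon_mult)
  then show ?thesis using assms(1-4) by (auto simp: lookup_add lookup_single when_def)
qed

lemma mon_single_add: "mon (single i (k + l)) = (mon (single i k) * mon (single i l) :: ('v, 'k::comm_ring_1) mpoly)"
  by (simp add: mon_mult single_add)

text \<open>Exactness of the Koszul complex on three variables, obtained by splitting
  \<open>p\<close> and \<open>q\<close> into multiples of the variable \<open>l\<close> and parts
  free of it.\<close>

lemma koszul_exact:
  fixes p q r :: "('v, 'k::comm_ring_1) mpoly"
  assumes "mon (single i 1) * p + mon (single j 1) * q = mon (single l 1) * r" "i \<noteq> l" "j \<noteq> l" "i \<noteq> j"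
  obtains h s t where "p = mon (single j 1) * h + mon (single l 1) * s"
    "q = - mon (single i 1) * h + mon (single l 1) * t" "r = mon (single i 1) * s + mon (single j 1) * t"
proof -
  obtain s p' where p: "p = mon (single l 1) * s + p'" "\<And>m. m \<in> keys p' \<Longrightarrow> lookup m l < 1"
    by (rule monomial_division[of p l 1]) (rule that)
  obtain t q' where q: "q = mon (single l 1) * t + q'" "\<And>m. m \<in> keys q' \<Longrightarrow> lookup m l < 1"
    by (rule monomial_division[of q l 1]) (rule that)
  let ?r = "mon (single i 1) * p' + mon (single j 1) * q'"
  have eq: "mon (single l 1) * (mon (single i 1) * s + mon (single j 1) * t - r) + ?r = 0"
    using assms(1) unfolding p(1) q(1) by (simp add: algebra_simps)
  have less: "lookup m l < 1" if "m \<in> keys ?r" for m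
    by (rule keys_add_mon_mult_less[OF p(2) q(2) assms(2,3) that])
  have "mon (single i 1) * s + mon (single j 1) * t - r = 0" "?r = 0"
    using monomial_remainder_unique[OF eq less] by blast+
  then have r: "r = mon (single i 1) * s + mon (single j 1) * t"
    and pq: "mon (single i 1) * p' = mon (single j 1) * (- q')" by (simp_all add: add_eq_0_iff)
  obtain h where "p' = mon (single j 1) * h" "- q' = mon (single i 1) * h"
    by (rule monomial_coprime[OF pq assms(4)])
  then have "p' = mon (single j 1) * h" "q' = - mon (single i 1) * h"
    by (simp, metis minus_equation_iff mult_minus_left)
  then show ?thesis using that[of h s t] p(1) q(1) r by (simp add: add.commute)
qed

text \<open>Modulo the first variable, written \<open>x, y, t\<close> for the other ones, the generators become
  \<open>y t\<^sup>D\<close>, \<open>x\<^sup>B\<^sup>+\<^sup>1\<close>, \<open>y\<^sup>C\<^sup>+\<^sup>1\<close>, \<open>t\<^sup>D\<^sup>+\<^sup>1\<close> and \<open>x t\<^sup>D\<close> up to sign.\<close>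

lemma monomial_syzygies:
  fixes g1 :: "(4, 'k::comm_ring_1) mpoly"
  assumes eq: "- (mon (mk 0 0 1 D) * g1) + mon (mk 0 (B + 1) 0 0) * g2 + mon (mk 0 0 (C + 1) 0) * g3 +
    mon (mk 0 0 0 (D + 1)) * g4 - mon (mk 0 1 0 D) * g5 = 0"
  obtains p1 p2 p3 p4 p5 p6 where
    "g1 = mon (mk 0 1 0 0) * p1 + mon (mk 0 0 0 1) * p2 + mon (mk 0 0 C 0) * p4"
    "g2 = mon (mk 0 0 0 D) * p5 + mon (mk 0 0 (C + 1) 0) * p6"
    "g3 = mon (mk 0 0 0 D) * p4 - mon (mk 0 (B + 1) 0 0) * p6"
    "g4 = mon (mk 0 0 1 0) * p2 + mon (mk 0 1 0 0) * p3"
    "g5 = - mon (mk 0 0 1 0) * p1 + mon (mk 0 0 0 1) * p3 + mon (mk 0 B 0 0) * p5"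
proof -
  define x y t :: "nat \<Rightarrow> (4, 'k) mpoly" where "x k = mon (single 2 k)" and "y k = mon (single 3 k)" and "t k = mon (single 4 k)" for k
  note xyt = this
  have mk: "mon (mk 0 k 0 0) = x k" "mon (mk 0 0 k 0) = y k" "mon (mk 0 0 0 k) = t k"
    "mon (mk 0 0 1 D) = y 1 * t D" "mon (mk 0 1 0 D) = x 1 * t D" for k
    by (simp_all add: xyt single_eq_mk mon_mult)
  have add: "x (k + l) = x k * x l" "y (k + l) = y k * y l" "t (k + l) = t k * t l" for k l
    by (simp_all add: xyt mon_single_add del: single_add)
  \<comment> \<open>The terms of \<open>g1\<close>, \<open>g4\<close> and \<open>g5\<close> are
    divisible by \<open>t^D\<close>. Dividing \<open>g2\<close> and \<open>g3\<close> by this power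
    splits the equation into a Koszul relation for the quotient and a relation between
    \<open>x^(B+1)\<close> and \<open>y^(C+1)\<close> for the remainder.\<close>
  obtain u g2' where u0: "g2 = mon (single 4 D) * u + g2'" "\<And>m. m \<in> keys g2' \<Longrightarrow> lookup m 4 < D"
    by (rule monomial_division[of g2 4 D]) (rule that)
  then have u: "g2 = t D * u + g2'" "\<And>m. m \<in> keys g2' \<Longrightarrow> lookup m 4 < D"
    by (simp_all add: xyt)
  obtain v g3' where v0: "g3 = mon (single 4 D) * v + g3'" "\<And>m. m \<in> keys g3' \<Longrightarrow> lookup m 4 < D"
    by (rule monomial_division[of g3 4 D]) (rule that)
  then have v: "g3 = t D * v + g3'" "\<And>m. m \<in> keys g3' \<Longrightarrow> lookup m 4 < D"
    by (simp_all add: xyt)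
  let ?w = "- (y 1 * g1) + x (B + 1) * u + y (C + 1) * v + t 1 * g4 - x 1 * g5"
  let ?r = "x (B + 1) * g2' + y (C + 1) * g3'"
  have eq': "t D * ?w + ?r = 0"
    using eq unfolding mk u(1) v(1) add by (simp add: algebra_simps)
  have less: "lookup m 4 < D" if "m \<in> keys ?r" for m
    by (rule keys_add_mon_mult_less[OF u(2) v(2) _ _ that[unfolded xyt]]) simp_all
  have w: "?w = 0" and r: "?r = 0"
    using monomial_remainder_unique[OF eq'[unfolded xyt] less[unfolded xyt]] unfolding xyt by blast+
  have "x (B + 1) * g2' = y (C + 1) * (- g3')" using r by (simp add: add_eq_0_iff)
  note coprime = monomial_coprime[OF this[unfolded xyt]]
  obtain h where "g2' = mon (single 3 (C + 1)) * h" "- g3' = mon (single 2 (B + 1)) * h"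
    by (rule coprime) (simp, rule that)
  then have h: "g2' = y (C + 1) * h" "g3' = - x (B + 1) * h" by (simp_all add: xyt minus_equation_iff[of g3'])
  have "y 1 * (g1 - y C * v) + x 1 * (g5 - x B * u) = t 1 * g4"
    using w unfolding add by (simp add: algebra_simps)
  note koszul = koszul_exact[OF this[unfolded xyt]]
  obtain h' s s' where "g1 - mon (single 3 C) * v = mon (single 2 1) * h' + mon (single 4 1) * s"
    "g5 - mon (single 2 B) * u = - mon (single 3 1) * h' + mon (single 4 1) * s'"
    "g4 = mon (single 3 1) * s + mon (single 2 1) * s'"
    by (rule koszul) (simp, simp, simp, rule that)
  then have "g1 - y C * v = x 1 * h' + t 1 * s" "g5 - x B * u = - y 1 * h' + t 1 * s'" "g4 = y 1 * s + x 1 * s'"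
    by (simp_all only: xyt)
  then show ?thesis
    using that[of h' s v u h s'] h u(1) v(1) unfolding mk by (simp add: algebra_simps)
qed

text \<open>Solved equation by equation: coprimality of \<open>t^D\<close> and
  \<open>y^(C+1)\<close> gives \<open>h\<close>, the third equation \<open>q4\<close>, the first
  \<open>k\<close>, \<open>q1\<close> and \<open>q2\<close>, the last \<open>q3\<close>.\<close>

lemma monomial_second_syzygies:
  fixes q1 :: "(4, 'k::comm_ring_1) mpoly"
  assumes "mon (mk 0 1 0 0) * q1 + mon (mk 0 0 0 1) * q2 + mon (mk 0 0 C 0) * q4 = 0"
    "mon (mk 0 0 0 D) * q5 + mon (mk 0 0 (C + 1) 0) * q6 = 0"
    "mon (mk 0 0 0 D) * q4 - mon (mk 0 (B + 1) 0 0) * q6 = 0"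
    "mon (mk 0 0 1 0) * q2 + mon (mk 0 1 0 0) * q3 = 0"
  obtains k h where
    "q1 = mon (mk 0 0 0 1) * k - mon (mk 0 B C 0) * h" "q2 = - mon (mk 0 1 0 0) * k" "q3 = mon (mk 0 0 1 0) * k"
    "q4 = mon (mk 0 (B + 1) 0 0) * h" "q5 = - mon (mk 0 0 (C + 1) 0) * h" "q6 = mon (mk 0 0 0 D) * h"
proof -
  define x y t :: "nat \<Rightarrow> (4, 'k) mpoly" where "x k = mon (single 2 k)" and "y k = mon (single 3 k)" and "t k = mon (single 4 k)" for k
  note xyt = this
  have mk: "mon (mk 0 k 0 0) = x k" "mon (mk 0 0 k 0) = y k" "mon (mk 0 0 0 k) = t k"
    "mon (mk 0 B C 0) = x B * y C" for k
    by (simp_all add: xyt single_eq_mk mon_mult)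
  have add: "x (k + l) = x k * x l" for k l
    by (simp_all add: xyt mon_single_add del: single_add)
  have cancel: "x k * p = x k * q \<Longrightarrow> p = q" "t k * p = t k * q \<Longrightarrow> p = q" for k p q
    by (simp_all add: xyt mon_mult_cancel)
  have "t D * q5 = y (C + 1) * (- q6)" using assms(2) unfolding mk by (simp add: add_eq_0_iff)
  note coprime = monomial_coprime[OF this[unfolded xyt]]
  obtain h where "q5 = mon (single 3 (C + 1)) * h" "- q6 = mon (single 4 D) * h"
    by (rule coprime) (simp, rule that)
  then have "q5 = y (C + 1) * h" "- q6 = t D * h" by (simp_all only: xyt)
  then have h: "q5 = - y (C + 1) * (- h)" "q6 = t D * (- h)" by (simp_all add: minus_equation_iff[of q6])
  have "t D * q4 = t D * (x (B + 1) * (- h))" using assms(3) unfolding mk h by (simp add: algebra_simps eq_neg_iff_add_eq_0)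
  then have q4: "q4 = x (B + 1) * (- h)" by (rule cancel)
  have "x 1 * (q1 + x B * y C * (- h)) = t 1 * (- q2)"
    using assms(1) unfolding mk q4 add by (simp add: algebra_simps add_eq_0_iff)
  note coprime = monomial_coprime[OF this[unfolded xyt]]
  obtain k where "q1 + mon (single 2 B) * mon (single 3 C) * (- h) = mon (single 4 1) * k" "- q2 = mon (single 2 1) * k"
    by (rule coprime) (simp, rule that)
  then have k: "q1 + x B * y C * (- h) = t 1 * k" "- q2 = x 1 * k" by (simp_all only: xyt)
  have q2: "q2 = - x 1 * k" using k(2) by (simp add: minus_equation_iff[of q2])
  have "x 1 * q3 = x 1 * (y 1 * k)" using assms(4) unfolding mk q2 by (simp add: algebra_simps)
  then have "q3 = y 1 * k" by (rule cancel)
  moreover have "q1 = t 1 * k - x B * y C * (- h)" using k(1) by (simp add: algebra_simps)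
  ultimately show ?thesis using that[of k "- h"] q2 q4 h unfolding mk by simp
qed

definition ranks :: "nat \<Rightarrow> nat" where
  "ranks i = (if i < 4 then [1, 5, 6, 2] ! i else 0)"

lemma ranks_simps: "ranks 0 = 1" "ranks (Suc 0) = 5" "ranks (Suc (Suc 0)) = 6" "ranks (Suc (Suc (Suc 0))) = 2"
  "ranks (Suc (Suc (Suc (Suc i)))) = 0"
  by (simp_all add: ranks_def)

lemma ranks_cases:
  assumes "k < ranks i" "j < ranks (Suc i)"
  shows "i = 0 \<and> k = 0 \<and> (j = 0 \<or> j = 1 \<or> j = 2 \<or> j = 3 \<or> j = 4) \<or>
    i = 1 \<and> (k = 0 \<or> k = 1 \<or> k = 2 \<or> k = 3 \<or> k = 4) \<and> (j = 0 \<or> j = 1 \<or> j = 2 \<or> j = 3 \<or> j = 4 \<or> j = 5) \<or>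
    i = 2 \<and> (k = 0 \<or> k = 1 \<or> k = 2 \<or> k = 3 \<or> k = 4 \<or> k = 5) \<and> (j = 0 \<or> j = 1)"
proof -
  consider "i = 0" | "i = 1" | "i = 2" | "3 \<le> i" by linarith
  then show ?thesis using assms by cases (auto simp: ranks_def)
qed

lemmas expand_lessThan = numeral_eq_Suc lessThan_Suc

section \<open>The explicit complex of the semigroup ring\<close>

context komeda
begin

text \<open>Setting the first variable to zero gives the monomial syzygies above; the remaining
  terms lift them to \<open>f1\<close>, ..., \<open>f5\<close>. The last column of the second matrix
  is the Koszul relation of \<open>f2\<close> and \<open>f3\<close>.\<close>

definition res_mat :: "nat \<Rightarrow> nat \<Rightarrow> nat \<Rightarrow> (4, 'k::comm_ring_1) mpoly" where
  "res_mat i k j =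
    (let f1 = mon (mk (e + g + 1) 0 0 0) - mon (mk 0 0 1 D);
         f2 = mon (mk 0 (B + 1) 0 0) - mon (mk e 0 0 1);
         f3 = mon (mk 0 0 (C + 1) 0) - mon (mk g 1 0 0);
         f4 = mon (mk 0 0 0 (D + 1)) - mon (mk 1 B C 0);
         f5 = mon (mk (e + 1) 0 C 0) - mon (mk 0 1 0 D)
     in if i = 0 then [f1, f2, f3, f4, f5] ! j
     else if i = 1 then
       [[mon (mk 0 1 0 0), mon (mk 0 0 0 1), 0, mon (mk 0 0 C 0), 0, 0],
        [0, mon (mk (g + 1) 0 0 0), mon (mk 1 0 C 0), 0, mon (mk 0 0 0 D), f3],
        [mon (mk (e + 1) 0 0 0), mon (mk 1 B 0 0), 0, mon (mk 0 0 0 D), 0, - f2],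
        [0, mon (mk 0 0 1 0), mon (mk 0 1 0 0), 0, mon (mk e 0 0 0), 0],
        [- mon (mk 0 0 1 0), 0, mon (mk 0 0 0 1), - mon (mk g 0 0 0), mon (mk 0 B 0 0), 0]] ! k ! j
     else if i = 2 then
       [[mon (mk 0 0 0 1), - mon (mk 0 B C 0)],
        [- mon (mk 0 1 0 0), mon (mk e 0 C 0)],
        [mon (mk 0 0 1 0), - mon (mk (e + g) 0 0 0)],
        [0, f2],
        [0, - f3],
        [- mon (mk 1 0 0 0), mon (mk 0 0 0 D)]] ! k ! j
     else 0)"

lemma res_mat_complex: "is_complex ranks (res_mat :: nat \<Rightarrow> nat \<Rightarrow> nat \<Rightarrow> (4, 'k::comm_ring_1) mpoly)"
proof (rule is_complexI)
  fix i k l assume "k < ranks i" "l < ranks (Suc (Suc i))"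
  then consider "i = 0" "k = 0" "l < 6" | "i = 1" "k < 5" "l < 2"
    by (cases i rule: nat.exhaust; cases "i - 1"; cases "i - 2") (auto simp: ranks_simps)
  then show "(\<Sum>j<ranks (Suc i). res_mat i k j * res_mat (Suc i) j l) = (0 :: (4, 'k) mpoly)"
  proof cases
    case 1
    then have "l = 0 \<or> l = 1 \<or> l = 2 \<or> l = 3 \<or> l = 4 \<or> l = 5" by auto
    then show ?thesis using 1
      by (elim disjE) (simp_all add: ranks_simps expand_lessThan res_mat_def mon_mult algebra_simps)
  next
    case 2
    then have "(k = 0 \<or> k = 1 \<or> k = 2 \<or> k = 3 \<or> k = 4) \<and> (l = 0 \<or> l = 1)" by auto
    then show ?thesis using 2
      by (elim conjE disjE) (simp_all add: ranks_simps expand_lessThan res_mat_def mon_mult algebra_simps)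
  qed
qed

lemma kill_mon_mk: "kill {1} (mon (mk a b c d)) = (if a = 0 then mon (mk a b c d) else 0)"
  by (simp add: mon_def kill_single free_of_def)

lemma exact_mod_first: "exact_mod ranks (res_mat :: nat \<Rightarrow> nat \<Rightarrow> nat \<Rightarrow> (4, 'k::comm_ring_1) mpoly) {1} i"
proof -
  note kill_rules = kill_add kill_minus kill_uminus kill_mult kill_mon_mk
  consider "i = 0" | "i = 1" | "i = 2" | "i \<ge> 3" by linarith
  then show ?thesis
  proof cases
    case 1
    show ?thesis unfolding exact_mod_def boundaries_mod_def 1
    proof (intro ballI impI CollectI)
      fix v :: "nat \<Rightarrow> (4, 'k) mpoly"
      assume v: "v \<in> free_module (ranks (Suc 0))" "kill_vec {1} (diff ranks res_mat 0 v) = (\<lambda>_. 0)"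
      define g where "g k = kill {1} (v k)" for k
      have "- (mon (mk 0 0 1 D) * g 0) + mon (mk 0 (B + 1) 0 0) * g (Suc 0) + mon (mk 0 0 (C + 1) 0) * g (Suc (Suc 0)) +
          mon (mk 0 0 0 (D + 1)) * g (Suc (Suc (Suc 0))) - mon (mk 0 1 0 D) * g (Suc (Suc (Suc (Suc 0)))) = 0"
        using fun_cong[OF v(2), of 0] params
        by (simp add: kill_vec_def matrix_map_def ranks_simps expand_lessThan res_mat_def kill_rules g_def algebra_simps)
      then obtain p1 p2 p3 p4 p5 p6 where p:
        "g 0 = mon (mk 0 1 0 0) * p1 + mon (mk 0 0 0 1) * p2 + mon (mk 0 0 C 0) * p4"
        "g (Suc 0) = mon (mk 0 0 0 D) * p5 + mon (mk 0 0 (C + 1) 0) * p6"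
        "g (Suc (Suc 0)) = mon (mk 0 0 0 D) * p4 - mon (mk 0 (B + 1) 0 0) * p6"
        "g (Suc (Suc (Suc 0))) = mon (mk 0 0 1 0) * p2 + mon (mk 0 1 0 0) * p3"
        "g (Suc (Suc (Suc (Suc 0)))) = - mon (mk 0 0 1 0) * p1 + mon (mk 0 0 0 1) * p3 + mon (mk 0 B 0 0) * p5"
        by (rule monomial_syzygies)
      define q where "q j = (if j < 6 then [p1, p2, p3, p4, p5, p6] ! j else 0)" for j
      have gk: "kill {1} (v k) = kill {1} (g k)" for k by (simp add: g_def kill_kill)
      have "kill {1} (v k) = kill {1} (diff ranks res_mat (Suc 0) q k)" for k
      proof -
        consider "k = 0" | "k = 1" | "k = 2" | "k = 3" | "k = 4" | "5 \<le> k" by linarith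
        then show ?thesis
        proof cases
          case 6
          then show ?thesis using v(1) by (simp add: free_module_def ranks_simps matrix_map_def)
        qed (use params in \<open>simp_all add: gk p q_def matrix_map_def ranks_simps expand_lessThan res_mat_def kill_rules algebra_simps\<close>)
      qed
      then have "kill_vec {1} v = kill_vec {1} (diff ranks res_mat (Suc 0) q)" by (simp add: kill_vec_def)
      moreover have "q \<in> free_module (ranks (Suc (Suc 0)))" by (simp add: q_def free_module_def ranks_simps)
      ultimately show "\<exists>q\<in>free_module (ranks (Suc (Suc 0))). kill_vec {1} v = kill_vec {1} (diff ranks res_mat (Suc 0) q)"
        by blast
    qed
  next
    case 2
    show ?thesis unfolding exact_mod_def boundaries_mod_def 2 One_nat_def
    proof (intro ballI impI CollectI)
      fix v :: "nat \<Rightarrow> (4, 'k) mpoly"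
      assume v: "v \<in> free_module (ranks (Suc (Suc 0)))" "kill_vec {1} (diff ranks res_mat (Suc 0) v) = (\<lambda>_. 0)"
      define g where "g k = kill {1} (v k)" for k
      have "mon (mk 0 1 0 0) * g 0 + mon (mk 0 0 0 1) * g (Suc 0) + mon (mk 0 0 C 0) * g (Suc (Suc (Suc 0))) = 0"
        "mon (mk 0 0 0 D) * g (Suc (Suc (Suc (Suc 0)))) + mon (mk 0 0 (C + 1) 0) * g (Suc (Suc (Suc (Suc (Suc 0))))) = 0"
        "mon (mk 0 0 0 D) * g (Suc (Suc (Suc 0))) - mon (mk 0 (B + 1) 0 0) * g (Suc (Suc (Suc (Suc (Suc 0))))) = 0"
        "mon (mk 0 0 1 0) * g (Suc 0) + mon (mk 0 1 0 0) * g (Suc (Suc 0)) = 0"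
        using fun_cong[OF v(2), of 0] fun_cong[OF v(2), of 1] fun_cong[OF v(2), of 2] fun_cong[OF v(2), of 3] params
        by (simp_all add: kill_vec_def matrix_map_def ranks_simps expand_lessThan res_mat_def kill_rules g_def algebra_simps)
      then obtain l h where p:
        "g 0 = mon (mk 0 0 0 1) * l - mon (mk 0 B C 0) * h" "g (Suc 0) = - mon (mk 0 1 0 0) * l" "g (Suc (Suc 0)) = mon (mk 0 0 1 0) * l"
        "g (Suc (Suc (Suc 0))) = mon (mk 0 (B + 1) 0 0) * h" "g (Suc (Suc (Suc (Suc 0)))) = - mon (mk 0 0 (C + 1) 0) * h" "g (Suc (Suc (Suc (Suc (Suc 0))))) = mon (mk 0 0 0 D) * h"
        by (rule monomial_second_syzygies)
      define q where "q j = (if j < 2 then [l, h] ! j else 0)" for j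
      have gk: "kill {1} (v k) = kill {1} (g k)" for k by (simp add: g_def kill_kill)
      have "kill {1} (v k) = kill {1} (diff ranks res_mat (Suc (Suc 0)) q k)" for k
      proof -
        consider "k = 0" | "k = 1" | "k = 2" | "k = 3" | "k = 4" | "k = 5" | "6 \<le> k" by linarith
        then show ?thesis
        proof cases
          case 7
          then show ?thesis using v(1) by (simp add: free_module_def ranks_simps matrix_map_def)
        qed (use params in \<open>simp_all add: gk p q_def matrix_map_def ranks_simps expand_lessThan res_mat_def kill_rules algebra_simps\<close>)
      qed
      then have "kill_vec {1} v = kill_vec {1} (diff ranks res_mat (Suc (Suc 0)) q)" by (simp add: kill_vec_def)
      moreover have "q \<in> free_module (ranks (Suc (Suc (Suc 0))))" by (simp add: q_def free_module_def ranks_simps)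
      ultimately show "\<exists>q\<in>free_module (ranks (Suc (Suc (Suc 0)))). kill_vec {1} v = kill_vec {1} (diff ranks res_mat (Suc (Suc 0)) q)"
        by blast
    qed
  next
    case 3
    show ?thesis unfolding exact_mod_def boundaries_mod_def 3 numeral_2_eq_2
    proof (intro ballI impI CollectI)
      fix v :: "nat \<Rightarrow> (4, 'k) mpoly"
      assume v: "v \<in> free_module (ranks (Suc (Suc (Suc 0))))" "kill_vec {1} (diff ranks res_mat (Suc (Suc 0)) v) = (\<lambda>_. 0)"
      \<comment> \<open>Modulo the first variable, row 5 of the last matrix is
        \<open>(0, X4^D)\<close> and row 2 is \<open>(X3, 0)\<close>, so the map is
        injective.\<close>
      have 1: "kill {1} (v 1) = 0"
        using fun_cong[OF v(2), of 5] params
        by (simp add: kill_vec_def matrix_map_def ranks_simps expand_lessThan res_mat_def kill_rules mon_mult_eq_0_iff)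
      moreover have "kill {1} (v 0) = 0"
        using fun_cong[OF v(2), of 2] params 1
        by (simp add: kill_vec_def matrix_map_def ranks_simps expand_lessThan res_mat_def kill_rules mon_mult_eq_0_iff)
      moreover have "v k = 0" if "2 \<le> k" for k using v(1) that by (simp add: free_module_def ranks_simps)
      ultimately have "kill {1} (v k) = 0" for k
        by (cases "k = 0"; cases "k = 1") (auto simp: numeral_2_eq_2)
      then have "kill_vec {1} v = kill_vec {1} (diff ranks res_mat (Suc (Suc (Suc 0))) (\<lambda>_. 0))"
        by (simp add: kill_vec_def)
      then show "\<exists>q\<in>free_module (ranks (Suc (Suc (Suc (Suc 0))))). kill_vec {1} v = kill_vec {1} (diff ranks res_mat (Suc (Suc (Suc 0))) q)"
        using free_module_zero by blast
    qed
  next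
    case 4
    then have "ranks (Suc i) = 0" by (simp add: ranks_def)
    then have "v = (\<lambda>_. 0)" if "v \<in> free_module (ranks (Suc i))" for v :: "nat \<Rightarrow> (4, 'k) mpoly"
      using that by (auto simp: free_module_def)
    moreover have "(\<lambda>_. 0) \<in> boundaries_mod ranks (res_mat :: nat \<Rightarrow> nat \<Rightarrow> nat \<Rightarrow> (4, 'k) mpoly) {1} (Suc i)"
      unfolding boundaries_mod_def by (auto intro!: bexI[of _ "\<lambda>_. 0"])
    ultimately show ?thesis unfolding exact_mod_def by metis
  qed
qed

lemma standard_not_move: "m \<in> standard_monomials \<Longrightarrow> \<not> move m v"
  using params unfolding standard_monomials_def by (auto simp: move_mk_iff)

lemma res_mat_gens: "res_mat 0 0 j \<in> (semigroup_ideal n :: (4, 'k::field) mpoly set)" if "j < 5"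
proof -
  have "(mk (e + g + 1) 0 0 0, mk 0 0 1 D) \<in> moves" "(mk 0 (B + 1) 0 0, mk e 0 0 1) \<in> moves"
    "(mk 0 0 (C + 1) 0, mk g 1 0 0) \<in> moves" "(mk 0 0 0 (D + 1), mk 1 B C 0) \<in> moves"
    "(mk (e + 1) 0 C 0, mk 0 1 0 D) \<in> moves"
    by (simp_all add: moves_def)
  note bin = this[THEN moves_wdegree, THEN binomial_in_semigroup_ideal]
  have "j = 0 \<or> j = 1 \<or> j = 2 \<or> j = 3 \<or> j = 4" using that by auto
  then show ?thesis unfolding res_mat_def Let_def using bin by (elim disjE) (simp_all del: wdegree_mk)
qed

text \<open>A standard monomial is the only factorization of its degree, so its coefficient in
  \<open>p\<close> vanishes; every other monomial without the first variable lies, modulo that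
  variable, in the ideal of the five binomials. Through the transfer lemma this also yields that
  they generate the ideal.\<close>

lemma cover_first:
  fixes p :: "(4, 'k::field) mpoly"
  assumes p: "p \<in> semigroup_ideal n"
  shows "\<exists>q\<in>free_module (ranks (Suc 0)). kill {1} p = kill {1} (diff ranks res_mat 0 q 0)"
proof -
  define J where "J = {p :: (4, 'k) mpoly. \<exists>q\<in>free_module (ranks (Suc 0)). kill {1} p = kill {1} (diff ranks res_mat 0 q 0)}"
  have J: "is_ideal J"
    unfolding is_ideal_def
  proof (intro conjI ballI allI)
    show "0 \<in> J" unfolding J_def by (auto intro!: bexI[of _ "\<lambda>_. 0"])
    fix a b :: "(4, 'k) mpoly" assume b: "b \<in> J"
    obtain q where q: "q \<in> free_module (ranks (Suc 0))" "kill {1} b = kill {1} (diff ranks res_mat 0 q 0)"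
      using b by (auto simp: J_def)
    have "kill {1} (a * b) = kill {1} (diff ranks res_mat 0 (\<lambda>k. a * q k) 0)"
      by (simp add: matrix_map_scale kill_mult q(2))
    then show "a * b \<in> J" unfolding J_def using free_module_scale[OF q(1)] by blast
    assume a: "a \<in> J"
    obtain r where r: "r \<in> free_module (ranks (Suc 0))" "kill {1} a = kill {1} (diff ranks res_mat 0 r 0)"
      using a by (auto simp: J_def)
    have "kill {1} (a + b) = kill {1} (diff ranks res_mat 0 (\<lambda>k. r k + q k) 0)"
      by (simp add: matrix_map_add kill_add q(2) r(2))
    moreover have "(\<lambda>k. r k + q k) \<in> free_module (ranks (Suc 0))"
      using q(1) r(1) by (simp add: free_module_def)
    ultimately show "a + b \<in> J" unfolding J_def by blast
  qed
  have gen: "res_mat 0 0 j \<in> J" if "j < 5" for j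
  proof -
    let ?q = "\<lambda>k. if k = j then 1 else 0 :: (4, 'k) mpoly"
    have "diff ranks res_mat 0 ?q 0 = res_mat 0 0 j"
      using that by (simp add: matrix_map_def ranks_simps if_distrib[of "(*) _"] cong: if_cong)
    moreover have "?q \<in> free_module (ranks (Suc 0))" using that by (simp add: free_module_def ranks_simps)
    ultimately show ?thesis unfolding J_def by force
  qed
  have first: "mon (mk (Suc a) b c d) \<in> J" for a b c d
    unfolding J_def by (auto simp: kill_mon_mk intro!: bexI[of _ "\<lambda>_. 0"])
  have multiple: "mon (q + r) \<in> J"
    if q: "mon q - mon q' \<in> J" "lookup q' 1 \<noteq> 0" for q q' r
  proof -
    obtain a b c d where abcd: "q' + r = mk a b c d" by (rule mk_cases)
    have "lookup (q' + r) 1 \<noteq> 0" using q(2) by (simp add: lookup_add)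
    then obtain a' where "a = Suc a'" unfolding abcd lookup_mk using not0_implies_Suc by blast
    then have "mon (q' + r) \<in> J" unfolding abcd by (simp only: first)
    then have "mon r * (mon q - mon q') + mon (q' + r) \<in> J"
      by (intro is_idealD(2)[OF J] is_idealD(3)[OF J] q(1))
    then show ?thesis by (simp add: right_diff_distrib mon_mult add.commute)
  qed
  have nonstandard: "mon m \<in> J" if m: "lookup m 1 = 0" "m \<notin> standard_monomials" for m
  proof (cases m rule: mk_cases)
    case (1 a b c d)
    then have m0: "m = mk 0 b c d" using m(1) by simp
    consider "B + 1 \<le> b" | "C + 1 \<le> c" | "1 \<le> c" "D \<le> d" | "D + 1 \<le> d" | "1 \<le> b" "D \<le> d"
      using m(2) unfolding m0 mk_standard_iff by linarith
    then show ?thesis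
    proof cases
      case 1
      have "mon (mk 0 (B + 1) 0 0 + mk 0 (b - (B + 1)) c d) \<in> J"
        by (rule multiple[of _ "mk e 0 0 1"]) (use gen[of 1] params in \<open>simp_all add: res_mat_def\<close>)
      then show ?thesis using 1 by (simp add: m0)
    next
      case 2
      have "mon (mk 0 0 (C + 1) 0 + mk 0 b (c - (C + 1)) d) \<in> J"
        by (rule multiple[of _ "mk g 1 0 0"]) (use gen[of 2] params in \<open>simp_all add: res_mat_def\<close>)
      then show ?thesis using 2 by (simp add: m0)
    next
      case 3
      have "mon (mk 0 0 1 D + mk 0 b (c - 1) (d - D)) \<in> J"
        by (rule multiple[of _ "mk (e + g + 1) 0 0 0"])
          (use is_idealD(4)[OF J gen[of 0]] params in \<open>simp_all add: res_mat_def\<close>)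
      then show ?thesis using 3 by (simp add: m0)
    next
      case 4
      have "mon (mk 0 0 0 (D + 1) + mk 0 b c (d - (D + 1))) \<in> J"
        by (rule multiple[of _ "mk 1 B C 0"]) (use gen[of 3] params in \<open>simp_all add: res_mat_def\<close>)
      then show ?thesis using 4 by (simp add: m0)
    next
      case 5
      have "mon (mk 0 1 0 D + mk 0 (b - 1) c (d - D)) \<in> J"
        by (rule multiple[of _ "mk (e + 1) 0 C 0"])
          (use is_idealD(4)[OF J gen[of 4]] params in \<open>simp_all add: res_mat_def\<close>)
      then show ?thesis using 5 by (simp add: m0)
    qed
  qed
  have "(\<Sum>m\<in>keys (kill {1} p). single 0 (lookup p m) * mon m) \<in> J"
  proof (intro is_ideal_sum[OF J] is_idealD(3)[OF J] nonstandard)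
    fix m assume "m \<in> keys (kill {1} p)"
    then have m: "m \<in> keys p" "lookup m 1 = 0" by (auto simp: kill_def keys_keep free_of_def)
    show "lookup m 1 = 0" by (rule m(2))
    show "m \<notin> standard_monomials"
    proof
      assume "m \<in> standard_monomials"
      then have "deg_class n (wdegree n m) = {m}"
        using unique_factorization[OF standard_not_move] by (auto simp: deg_class_def)
      moreover have "csum (deg_class n (wdegree n m)) p = 0" using p by (simp add: semigroup_ideal_eq)
      ultimately have "csum {m} p = 0" by (simp only:)
      then show False using m(1) by (simp add: csum_def in_keys_iff Int_insert_right)
    qed
  qed
  also have "(\<Sum>m\<in>keys (kill {1} p). single 0 (lookup p m) * mon m) = kill {1} p"
  proof -
    have "single 0 (lookup p m) * mon m = single m (lookup (kill {1} p) m)" if "m \<in> keys (kill {1} p)" for m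
      using that by (auto simp: mon_def mult_single kill_def keys_keep)
    then show ?thesis by (simp add: sum_single_lookup)
  qed
  finally show ?thesis by (simp add: J_def kill_kill)
qed

definition ring_degree :: "nat \<Rightarrow> nat \<Rightarrow> int" where
  "ring_degree i j =
    (if i = 1 then [int ((e + g + 1) * n 1), int ((B + 1) * n 2), int ((C + 1) * n 3), int ((D + 1) * n 4), int (n 2 + D * n 4)] ! j
     else if i = 2 then [int ((e + g + 1) * n 1 + n 2), int ((e + g + 1) * n 1 + n 4), int ((D + 1) * n 4 + n 2),
       int ((e + g + 1) * n 1 + C * n 3), int ((B + 1) * n 2 + D * n 4), int ((B + 1) * n 2 + (C + 1) * n 3)] ! j
     else if i = 3 then [int ((e + g + 1) * n 1 + n 2 + n 4), int ((B + 1) * n 2 + (C + 1) * n 3 + D * n 4)] ! j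
     else 0)"

lemma res_mat_graded:
  assumes "k < ranks i" "j < ranks (Suc i)"
  shows "homogeneous_poly n (ring_degree (Suc i) j - ring_degree i k) (res_mat i k j :: (4, 'k::comm_ring_1) mpoly)"
proof -
  have rel: "int e * int (n 1) + int g * int (n 1) + int (n 1) = int (n 3) + int D * int (n 4)"
    "int B * int (n 2) + int (n 2) = int e * int (n 1) + int (n 4)"
    "int C * int (n 3) + int (n 3) = int g * int (n 1) + int (n 2)"
    "int D * int (n 4) + int (n 4) = int (n 1) + int B * int (n 2) + int C * int (n 3)"
    using degree_relations[THEN arg_cong[where f = int]] by (simp_all add: algebra_simps)
  note rules = homogeneous_poly_uminus homogeneous_poly_minus homogeneous_poly_mon
  show ?thesis unfolding res_mat_def ring_degree_def using ranks_cases[OF assms] rel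
    by (elim disjE conjE) (simp_all add: rules distrib_right)
qed

lemma res_mat_minimal:
  assumes "k < ranks i" "j < ranks (Suc i)"
  shows "lookup (res_mat i k j :: (4, 'k::comm_ring_1) mpoly) 0 = 0"
proof -
  have mk0: "mk a b c d = 0 \<longleftrightarrow> a = 0 \<and> b = 0 \<and> c = 0 \<and> d = 0" for a b c d
    using mk_eq_iff[of a b c d 0 0 0 0] by (simp add: mk_def)
  have mon0: "lookup (mon m :: (4, 'k) mpoly) 0 = (if m = 0 then 1 else 0)" for m
    by (simp add: mon_def lookup_single when_def)
  show ?thesis unfolding res_mat_def using ranks_cases[OF assms] params
    by (elim disjE conjE) (simp_all add: lookup_minus mon0 mk0)
qed

lemma semigroup_ring_resolution:
  "minimal_graded_free_resolution n (semigroup_ideal n :: (4, 'k::field) mpoly set) ranks ring_degree (\<lambda>_. 1) res_mat"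
proof (rule resolution_transfer[OF semigroup_ideal_is_ideal n_pos semigroup_ideal_regular exact_mod_first _ _ res_mat_complex])
  show "\<exists>q\<in>free_module (ranks (Suc 0)). kill {1} p = kill {1} (matrix_map (ranks 0) (ranks (Suc 0)) (res_mat 0) q 0)"
    if "p \<in> semigroup_ideal n" for p :: "(4, 'k) mpoly"
    using that by (rule cover_first)
  show "ring_degree 0 0 = 0" by (simp add: ring_degree_def)
qed (simp_all add: res_mat_gens res_mat_graded res_mat_minimal ranks_simps)

end

section \<open>The resolution of the tangent cone\<close>

text \<open>The degree \<open>d\<close> part then agrees with \<open>p\<close> modulo
  \<open>y\<close>. No monomial of degree \<open>d\<close> has to exist, so zero entries qualify for
  every \<open>d\<close>, negative values included.\<close>

definition leading_mod :: "'v::finite \<Rightarrow> int \<Rightarrow> ('v, 'k::comm_ring_1) mpoly \<Rightarrow> bool" where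
  "leading_mod y d p \<longleftrightarrow> (\<forall>m\<in>keys p. d \<le> int (len m) \<and> (lookup m y = 0 \<longrightarrow> int (len m) = d))"

lemma leading_mod_rules:
  "leading_mod y d 0"
  "leading_mod y d (- p) \<longleftrightarrow> leading_mod y d p"
  "leading_mod y d p \<Longrightarrow> leading_mod y d q \<Longrightarrow> leading_mod y d (p - q)"
  "leading_mod y d (mon m :: ('v::finite, 'k::comm_ring_1) mpoly) \<longleftrightarrow> d \<le> int (len m) \<and> (lookup m y = 0 \<longrightarrow> int (len m) = d)"
  using keys_diff[of p q] by (auto simp: leading_mod_def)

lemma kill_leading: "leading_mod y d p \<Longrightarrow> kill {y} (keep {m. int (len m) = d} p) = kill {y} p"
proof (rule poly_mapping_eqI)
  fix k assume p: "leading_mod y d p"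
  show "lookup (kill {y} (keep {m. int (len m) = d} p)) k = lookup (kill {y} p) k"
  proof (cases "k \<in> keys p")
    case True
    then have "lookup k y = 0 \<longrightarrow> int (len k) = d" using p unfolding leading_mod_def by blast
    then show ?thesis by (simp add: kill_def free_of_def)
  qed (simp add: kill_def in_keys_iff)
qed

context komeda
begin

text \<open>The leading parts form a complex because taking them is multiplicative, and modulo
  \<open>i\<close> they agree with the matrices of the semigroup ring. The shifts \<open>d\<close>
  are a parameter since they depend on the position of the multiplicity.\<close>

lemma tangent_cone_resolution:
  fixes d :: "nat \<Rightarrow> nat \<Rightarrow> int"
  assumes i: "n i = Min (range n)" and reg: "param_regular n i" and special: "special_homogeneous i"
    and d0: "d 0 0 = 0"
    and leading: "\<And>l k j. k < ranks l \<Longrightarrow> j < ranks (Suc l) \<Longrightarrow>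
      leading_mod i (d (Suc l) j - d l k) (res_mat l k j :: (4, 'k::field) mpoly)"
  shows "\<exists>\<Psi>. minimal_graded_free_resolution standard_weight (max_ideal :: (4, 'k) mpoly set) ranks d (\<lambda>_. 1) \<Psi>"
proof
  let ?\<Psi> = "\<lambda>l k j. keep {m. int (len m) = d (Suc l) j - d l k} (res_mat l k j :: (4, 'k) mpoly)"
  show "minimal_graded_free_resolution standard_weight (max_ideal :: (4, 'k) mpoly set) ranks d (\<lambda>_. 1) ?\<Psi>"
  proof (rule resolution_transfer[where \<Phi> = res_mat and y = i])
    show "is_ideal (max_ideal :: (4, 'k) mpoly set)" by (rule max_ideal_is_ideal)
    show "p \<in> max_ideal" if "var i * p \<in> max_ideal" for p :: "(4, 'k) mpoly"
      by (rule max_ideal_regular[OF reg that])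
    show "exact_mod ranks (res_mat :: nat \<Rightarrow> nat \<Rightarrow> nat \<Rightarrow> (4, 'k) mpoly) {i} l" for l
      by (rule res_exact_mod_var[OF semigroup_ring_resolution semigroup_ideal_is_ideal semigroup_ideal_regular])
    show "\<exists>q\<in>free_module (ranks (Suc 0)). kill {i} p = kill {i} (diff ranks res_mat 0 q 0)"
      if p: "p \<in> max_ideal" for p :: "(4, 'k) mpoly"
    proof -
      \<comment> \<open>In Apery degrees all factorizations have the same length and are tight, so
        both ideals impose the same condition modulo \<open>i\<close>.\<close>
      have "csum (deg_class n (wdegree n m)) p = 0" if m: "apery_mon n i m" for m
      proof -
        have hom: "\<forall>m m'. apery_mon n i m \<longrightarrow> wdegree n m' = wdegree n m \<longrightarrow> len m' = len m"
          using special unfolding homogeneous_iff[OF i, symmetric] homogeneous_semigroup_iff[OF i] .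
        have len: "len x = len m" if "wdegree n x = wdegree n m" for x
          using m that by (rule hom[rule_format])
        have "tight n x" if x: "wdegree n x = wdegree n m" for x
          unfolding tight_def
        proof (intro allI impI)
          fix m' assume "wdegree n m' = wdegree n x"
          then have "len m' = len m" unfolding x by (rule len)
          then show "len m' \<le> len x" using len[OF x] by (simp only: order_refl)
        qed
        then have "deg_class n (wdegree n m) = max_class n (wdegree n m)"
          unfolding deg_class_def max_class_def by blast
        then show ?thesis using p by (simp add: max_ideal_def)
      qed
      then have "p \<in> mod_ideal i (semigroup_ideal n)" by (simp add: mod_semigroup_ideal_iff)
      then obtain p' where p': "p' \<in> semigroup_ideal n" "kill {i} p = kill {i} p'" by (auto simp: mod_ideal_def)
      let ?z = "\<lambda>k::nat. if k = 0 then p' else 0"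
      have "?z \<in> free_module (ranks 0)" by (simp add: free_module_def ranks_simps)
      moreover have "augment ranks (\<lambda>_. 1) ?z = p'"
        by (simp add: augment_def[OF semigroup_ring_resolution semigroup_ideal_is_ideal semigroup_ideal_regular] ranks_simps)
      ultimately obtain q where q: "q \<in> free_module (ranks (Suc 0))" "?z = diff ranks res_mat 0 q"
        using augment_ker[OF semigroup_ring_resolution semigroup_ideal_is_ideal semigroup_ideal_regular[where i = i], where z = ?z] p'(1) by auto
      have "p' = diff ranks res_mat 0 q 0" using fun_cong[OF q(2), of 0] by simp
      then show ?thesis using p'(2) q(1) by blast
    qed
    show "kill {i} (?\<Psi> l k j) = kill {i} (res_mat l k j)" if "k < ranks l" "j < ranks (Suc l)" for l k j
      by (rule kill_leading[OF leading[OF that]])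
    show "is_complex ranks ?\<Psi>"
    proof (rule is_complexI)
      fix l k j assume k: "k < ranks l" and j: "j < ranks (Suc (Suc l))"
      let ?d = "\<lambda>l j k. d (Suc l) j - d l k"
      have "?\<Psi> l k t * ?\<Psi> (Suc l) t j =
          keep {m. int (len m) = ?d l t k + ?d (Suc l) j t} (res_mat l k t * res_mat (Suc l) t j)" if "t < ranks (Suc l)" for t
        using leading[OF k that] leading[OF that j]
        by (intro keep_eq_mult_leading[symmetric]) (auto simp: leading_mod_def)
      then have "(\<Sum>t<ranks (Suc l). ?\<Psi> l k t * ?\<Psi> (Suc l) t j) =
          keep {m. int (len m) = d (Suc (Suc l)) j - d l k} (\<Sum>t<ranks (Suc l). res_mat l k t * res_mat (Suc l) t j)"
        by (simp add: keep_sum algebra_simps)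
      also have "(\<Sum>t<ranks (Suc l). res_mat l k t * res_mat (Suc l) t j) = (0 :: (4, 'k) mpoly)"
      proof -
        let ?v = "\<lambda>s. if s = j then 1 else 0 :: (4, 'k) mpoly"
        have "diff ranks res_mat l (diff ranks res_mat (Suc l) ?v) k = 0"
          using res_mat_complex unfolding is_complex_def by metis
        then show ?thesis using k j by (simp add: matrix_map_def if_distrib[of "(*) _"] cong: if_cong)
      qed
      finally show "(\<Sum>t<ranks (Suc l). ?\<Psi> l k t * ?\<Psi> (Suc l) t j) = 0" by simp
    qed
    show "?\<Psi> 0 0 j \<in> max_ideal" if "j < ranks (Suc 0)" for j
    proof -
      have lead: "leading_mod i (d (Suc 0) j) (res_mat 0 0 j :: (4, 'k) mpoly)"
        using leading[of 0 0 j] that d0 by (simp add: ranks_simps)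
      have "keep {m. len m = nat (d (Suc 0) j)} (res_mat 0 0 j) \<in> (max_ideal :: (4, 'k) mpoly set)"
        by (rule leading_in_max_ideal) (use that lead res_mat_gens in \<open>auto simp: ranks_simps leading_mod_def\<close>)
      moreover have "keep {m. len m = nat (d (Suc 0) j)} (res_mat 0 0 j :: (4, 'k) mpoly) = ?\<Psi> 0 0 j \<or> ?\<Psi> 0 0 j = 0"
      proof (cases "0 \<le> d (Suc 0) j")
        case True
        then have "{m :: 4 \<Rightarrow>\<^sub>0 nat. len m = nat (d (Suc 0) j)} = {m. int (len m) = d (Suc 0) j - d 0 0}"
          using d0 by auto
        then show ?thesis by simp
      qed (auto simp: keep_eq_0_iff d0)
      ultimately show ?thesis using is_idealD(1)[OF max_ideal_is_ideal] by auto
    qed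
  qed (use d0 in \<open>simp_all add: ranks_simps homogeneous_poly_keep_eq res_mat_minimal\<close>)
qed

text \<open>For \<open>l = 1\<close> these are the lengths of the terms of \<open>f1\<close>, ...,
  \<open>f5\<close> that avoid \<open>i\<close>; for larger \<open>l\<close> the length of a
  monomial free of \<open>i\<close> in the respective column is added to the shift of its
  row.\<close>

definition cone_degree :: "4 \<Rightarrow> nat \<Rightarrow> nat \<Rightarrow> int" where
  "cone_degree i l j = int (
    if l = 1 then
      (if i = 1 then [D + 1, B + 1, C + 1, D + 1, D + 1]
       else if i = 2 then [D + 1, e + 1, C + 1, D + 1, e + C + 1]
       else if i = 3 then [e + g + 1, e + 1, g + 1, D + 1, D + 1]
       else [e + g + 1, B + 1, C + 1, B + C + 1, e + C + 1]) ! j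
    else if l = 2 then
      (if i = 1 then [D + 2, D + 2, D + 2, D + C + 1, B + D + 1, B + C + 2]
       else if i = 2 then [e + C + 2, D + 2, e + C + 2, D + C + 1, e + D + 1, e + C + 2]
       else if i = 3 then [e + g + 2, e + g + 2, D + 2, g + D + 1, e + D + 1, e + g + 2]
       else [e + g + 2, B + C + 2, B + C + 2, e + g + C + 1, B + C + e + 1, B + C + 2]) ! j
    else if l = 3 then
      (if i = 1 then [D + 3, B + C + D + 2]
       else if i = 2 then [e + C + 3, e + C + D + 2]
       else if i = 3 then [e + g + 3, e + g + D + 2]
       else [B + C + 3, e + g + B + C + 2]) ! j
    else 0)"

text \<open>Regularity and the special equation give the inequalities by which no monomial of an
  entry is shorter than those free of \<open>i\<close>; the rest is a comparison entry by
  entry.\<close>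

lemma cone_degree_leading:
  assumes reg: "param_regular n i" and special: "special_homogeneous i"
    and kj: "k < ranks l" "j < ranks (Suc l)"
  shows "leading_mod i (cone_degree i (Suc l) j - cone_degree i l k) (res_mat l k j :: (4, 'k::field) mpoly)"
proof -
  consider (1) "i = 1" "D \<le> e + g" "B \<le> e" "C \<le> g" "D \<le> B + C" "D \<le> e + C"
    | (2) "i = 2" "D = e + g" "e \<le> B" "C \<le> g" "D \<le> B + C" "e + C \<le> D"
    | (3) "i = 3" "B = e" "e + g \<le> D" "g \<le> C" "D \<le> e + C"
    | (4) "i = 4" "C = g" "e + g \<le> D" "B \<le> e" "B + C \<le> D" "e + C \<le> D"
    using exhaust_4[of i]
  proof (elim disjE)
    assume i: "i = 1"
    show thesis using len_inequalities_1[OF reg[unfolded i]] by (intro that(1) i)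
  next
    assume i: "i = 2"
    have "D = e + g" using special i by (simp add: special_homogeneous_def)
    then show thesis using len_inequalities_2[OF reg[unfolded i]] by (intro that(2) i)
  next
    assume i: "i = 3"
    have "B = e" using special i by (simp add: special_homogeneous_def)
    then show thesis using len_inequalities_3[OF reg[unfolded i]] by (intro that(3) i)
  next
    assume i: "i = 4"
    have "C = g" using special i by (simp add: special_homogeneous_def)
    then show thesis using len_inequalities_4[OF reg[unfolded i]] by (intro that(4) i)
  qed
  note cases_i = this
  show ?thesis unfolding res_mat_def cone_degree_def
    by (cases rule: cases_i; use ranks_cases[OF kj] in \<open>elim disjE conjE\<close>) (simp_all add: leading_mod_rules)
qed

lemma homogeneous_type_if_special:
  assumes "n i = Min (range n)" "param_regular n i" "special_homogeneous i"
  shows "homogeneous_type TYPE('k::field) n"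
proof -
  obtain \<Psi> where "minimal_graded_free_resolution standard_weight (max_ideal :: (4, 'k) mpoly set) ranks (cone_degree i) (\<lambda>_. 1) \<Psi>"
    using tangent_cone_resolution[OF assms, of "cone_degree i"] cone_degree_leading[OF assms(2,3)]
    by (auto simp: cone_degree_def[of _ 0])
  then show ?thesis
    unfolding homogeneous_type_def betti_sequence_def tangent_cone_ideal_eq
    using semigroup_ring_resolution by blast
qed

end

theorem mainTheorem2:
  fixes n :: "4 \<Rightarrow> nat"
  assumes "pseudo_symmetric_4_generated n"
    and "cohen_macaulay (mpoly_ring Quot (tangent_cone_ideal n :: (4, 'k::field) mpoly set))"
  shows "homogeneous_type TYPE('k) n \<longleftrightarrow> homogeneous_semigroup n"
proof -
  obtain e g B C D where "komeda n e g B C D" using assms(1) by (rule pseudo_symmetric_komeda)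
  then interpret komeda n e g B C D .
  have "Min (range n) \<in> range n" by (rule Min_in) simp_all
  then obtain i where i: "n i = Min (range n)" by (metis rangeE)
  have "inj n" using assms(1) by (intro minimally_generated_inj) (simp add: pseudo_symmetric_4_generated_def)
  then have "n i < n j" if "j \<noteq> i" for j
    using Min_le[of "range n" "n j"] that by (auto simp: i[symmetric] order_less_le dest: injD)
  then have reg: "param_regular n i"
    using cohen_macaulay_imp_param_regular[OF n_pos _ assms(2)] by blast
  show ?thesis
    using homogeneous_iff[OF i] special_homogeneous_if_type[OF reg] homogeneous_type_if_special[OF i reg] by blast
qed

end
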